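(* Let $\mathcal U\subset\mathbb C^n$ be a minimal bounded homogeneous domain on which the Forelli–Rudin estimates (FR) stated in the context hold. Let $1\le q,s,r<\infty$ with $q\ge s$, and let $\alpha>-1$. Then there is a positive number $\tau=\tau(s,\alpha,q)$ such that the following holds. Let $\{z_k\}_{k\ge1}$ be a sampling sequence in $\mathcal U$ with parameter $r$, and let $\mu$ be a positive Borel measure on $\mathcal U$. If there is a constant $C>0$ with \[\mu(B(z_k,r))\le C\,\bigl(\mathrm{Vol}(B(z_k,r))\bigr)^{\tau}\qquad\text{for all } k=1,2,\dots,\] then there is a constant $C'>0$ such that for every $f\in H(\mathcal U)$ \[\int_{\mathcal U}|f(z)|^q\,d\mu(z)\le C'\int_{\mathcal U}\left(\int_{B(\omega,r)}|f(z)|^s\,dV_{\alpha}(z)\right)^{q/s}dV(\omega).\]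
   Context: A bounded domain $\mathcal U\subset\mathbb C^n$ is minimal with center $t\in\mathcal U$ if every biholomorphism $\psi:\mathcal U\to\mathcal U'$ onto a domain $\mathcal U'$ with $\det J(\psi,t)=1$ satisfies $\mathrm{Vol}(\mathcal U')\ge\mathrm{Vol}(\mathcal U)$, where $J(\psi,t)$ is the complex Jacobi matrix of $\psi$ at $t$. It is homogeneous if its group of biholomorphic automorphisms acts transitively. $\mathrm{Vol}$ and $dV$ denote Lebesgue measure, $H(\mathcal U)$ the space of analytic functions on $\mathcal U$, and $K_{\mathcal U}(z,\omega)$ the (unweighted) Bergman kernel of $\mathcal U$. For $\beta\in\mathbb R$, $dV_\beta(z)=K_{\mathcal U}(z,z)^{-\beta}dV(z)$. The number $\beta_{\min}$ is the threshold such that the weighted Bergman spaces $L^p(\mathcal U,dV_\beta)\cap H(\mathcal U)$ are non-trivial if and only if $\beta>\beta_{\min}$. $d_{\mathcal U}$ is the Bergman distance on $\mathcal U$, and $B(z,r)=\{\omega\in\mathcal U: d_{\mathcal U}(z,\omega)\le r\}$. A sampling sequence with parameter $\rho>0$ is a sequence $\{z_k\}_{k\ge 1}\subset\mathcal U$ such that $\mathcal U=\bigcup_{k}B(z_k,\rho)$, $B(z_i,\rho/4)\cap B(z_j,\rho/4)=\emptyset$ for $i\ne j$, and there is a positive integer $N$ such that each $z\in\mathcal U$ belongs to at most $N$ of the sets $B(z_k,2\rho)$. (FR): for every $\beta>\beta_{\min}$ there is $\alpha_*(\beta)$ such that for every $\alpha'>\alpha_*(\beta)$ there is a constant $c(\alpha',\beta)$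 with $\int_{\mathcal U}|K_{\mathcal U}(z,w)|^{1+\alpha'}dV_\beta(w)\le c(\alpha',\beta)K_{\mathcal U}(z,z)^{\alpha'-\beta}$ for all $z\in\mathcal U$. The constant $C$ does not depend on $k$ and the constant $C'$ does not depend on $f$. The right-hand side of the inequality may be $+\infty$. *)

theory Defs
  imports "HOL-Analysis.Analysis"
begin

section \<open>Holomorphic functions and maps on domains in complex n-space\<close>

definition domain :: "(complex ^ 'n) set \<Rightarrow> bool" where
  "domain U \<longleftrightarrow> open U \<and> connected U \<and> U \<noteq> {}"

definition hol_fun :: "(complex ^ 'n \<Rightarrow> complex) \<Rightarrow> (complex ^ 'n) set \<Rightarrow> bool" where
  "hol_fun f U \<longleftrightarrow>
     (\<forall>z\<in>U. \<exists>a :: complex ^ 'n. (f has_derivative (\<lambda>v. \<Sum>j\<in>UNIV. a $ j * v $ j)) (at z))"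

definition hol_map :: "(complex ^ 'n \<Rightarrow> complex ^ 'n) \<Rightarrow> (complex ^ 'n) set \<Rightarrow> bool" where
  "hol_map \<psi> U \<longleftrightarrow>
     (\<forall>z\<in>U. \<exists>A :: complex ^ 'n ^ 'n. (\<psi> has_derivative (\<lambda>v. A *v v)) (at z))"

definition complex_jacobian ::
  "(complex ^ 'n \<Rightarrow> complex ^ 'n) \<Rightarrow> complex ^ 'n \<Rightarrow> complex ^ 'n ^ 'n" where
  "complex_jacobian \<psi> t = (\<chi> i j. frechet_derivative \<psi> (at t) (axis j 1) $ i)"

definition biholomorphism ::
  "(complex ^ 'n \<Rightarrow> complex ^ 'n) \<Rightarrow> (complex ^ 'n) set \<Rightarrow> (complex ^ 'n) set \<Rightarrow> bool" where
  "biholomorphism \<psi> U U' \<longleftrightarrow>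
     bij_betw \<psi> U U' \<and> hol_map \<psi> U \<and> hol_map (inv_into U \<psi>) U'"

definition homogeneous :: "(complex ^ 'n) set \<Rightarrow> bool" where
  "homogeneous U \<longleftrightarrow> (\<forall>z\<in>U. \<forall>w\<in>U. \<exists>\<psi>. biholomorphism \<psi> U U \<and> \<psi> z = w)"

text \<open>The competing domain \<open>U'\<close> may be unbounded, so volumes are compared as
  extended nonnegative reals.\<close>

definition minimal_with_center :: "(complex ^ 'n) set \<Rightarrow> complex ^ 'n \<Rightarrow> bool" where
  "minimal_with_center U t \<longleftrightarrow> t \<in> U \<and>
     (\<forall>\<psi> U'. domain U' \<and> biholomorphism \<psi> U U' \<and> det (complex_jacobian \<psi> t) = 1
        \<longrightarrow> emeasure lborel U \<le> emeasure lborel U')"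

definition minimal_bounded_homogeneous_domain :: "(complex ^ 'n) set \<Rightarrow> bool" where
  "minimal_bounded_homogeneous_domain U \<longleftrightarrow>
     domain U \<and> bounded U \<and> (\<exists>t. minimal_with_center U t) \<and> homogeneous U"


section \<open>Bergman kernel and weighted Bergman spaces\<close>

definition square_integrable_hol :: "(complex ^ 'n) set \<Rightarrow> (complex ^ 'n \<Rightarrow> complex) set" where
  "square_integrable_hol U =
     {f. hol_fun f U \<and> (\<integral>\<^sup>+z. ennreal ((cmod (f z))\<^sup>2) \<partial>restrict_space lborel U) < \<infinity>}"

text \<open>The reproducing kernel of the space above. The reproducing property only determines
  the values on \<open>U \<times> U\<close>; setting the kernel to zero elsewhere makes the description definite.\<close>

definition bergman_kernel ::
  "(complex ^ 'n) set \<Rightarrow> complex ^ 'n \<Rightarrow> complex ^ 'n \<Rightarrow> complex" where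
  "bergman_kernel U = (THE K.
     (\<forall>w\<in>U. (\<lambda>z. K z w) \<in> square_integrable_hol U) \<and>
     (\<forall>f\<in>square_integrable_hol U. \<forall>w\<in>U.
        f w = (\<integral>z. f z * cnj (K z w) \<partial>restrict_space lborel U)) \<and>
     (\<forall>z w. z \<notin> U \<or> w \<notin> U \<longrightarrow> K z w = 0))"

definition bergman_diag :: "(complex ^ 'n) set \<Rightarrow> complex ^ 'n \<Rightarrow> real" where
  "bergman_diag U z = Re (bergman_kernel U z z)"

definition weighted_volume :: "(complex ^ 'n) set \<Rightarrow> real \<Rightarrow> (complex ^ 'n) measure" where
  "weighted_volume U \<beta> =
     density (restrict_space lborel U) (\<lambda>z. ennreal (bergman_diag U z powr (- \<beta>)))"

definition weighted_bergman_space ::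
  "(complex ^ 'n) set \<Rightarrow> real \<Rightarrow> real \<Rightarrow> (complex ^ 'n \<Rightarrow> complex) set" where
  "weighted_bergman_space U p \<beta> =
     {f. hol_fun f U \<and> (\<integral>\<^sup>+z. ennreal (cmod (f z) powr p) \<partial>weighted_volume U \<beta>) < \<infinity>}"

definition beta_min :: "(complex ^ 'n) set \<Rightarrow> real" where
  "beta_min U = (THE b. \<forall>p\<ge>1. \<forall>\<beta>.
     (\<exists>f\<in>weighted_bergman_space U p \<beta>. \<exists>z\<in>U. f z \<noteq> 0) \<longleftrightarrow> \<beta> > b)"

definition forelli_rudin :: "(complex ^ 'n) set \<Rightarrow> bool" where
  "forelli_rudin U \<longleftrightarrow>
     (\<forall>\<beta>>beta_min U. \<exists>\<alpha>\<^sub>0::real. \<forall>\<alpha>'>\<alpha>\<^sub>0. \<exists>c::real. \<forall>z\<in>U.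
        (\<integral>\<^sup>+w. ennreal (cmod (bergman_kernel U z w) powr (1 + \<alpha>')) \<partial>weighted_volume U \<beta>)
          \<le> ennreal (c * bergman_diag U z powr (\<alpha>' - \<beta>)))"


section \<open>Bergman metric, Bergman distance and sampling sequences\<close>

text \<open>Wirtinger derivatives with respect to the \<open>j\<close>-th coordinate \<open>z\<^sub>j = x\<^sub>j + i y\<^sub>j\<close>:
  the real directions \<open>axis j 1\<close> and \<open>axis j \<i>\<close> give the derivatives in \<open>x\<^sub>j\<close> and \<open>y\<^sub>j\<close>.\<close>

definition wirtinger :: "'n \<Rightarrow> (complex ^ 'n \<Rightarrow> complex) \<Rightarrow> complex ^ 'n \<Rightarrow> complex" where
  "wirtinger j F z =
     (frechet_derivative F (at z) (axis j 1) - \<i> * frechet_derivative F (at z) (axis j \<i>)) / 2"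

definition wirtinger_bar :: "'n \<Rightarrow> (complex ^ 'n \<Rightarrow> complex) \<Rightarrow> complex ^ 'n \<Rightarrow> complex" where
  "wirtinger_bar j F z =
     (frechet_derivative F (at z) (axis j 1) + \<i> * frechet_derivative F (at z) (axis j \<i>)) / 2"

definition bergman_metric :: "(complex ^ 'n) set \<Rightarrow> complex ^ 'n \<Rightarrow> complex ^ 'n ^ 'n" where
  "bergman_metric U z =
     (\<chi> i j. wirtinger i (wirtinger_bar j (\<lambda>u. complex_of_real (ln (bergman_diag U u)))) z)"

text \<open>The quadratic form is normalised as the sum of \<open>g\<^sub>i\<^sub>j v\<^sub>i cnj v\<^sub>j\<close>,
  without a further factor 2.\<close>

definition bergman_norm :: "(complex ^ 'n) set \<Rightarrow> complex ^ 'n \<Rightarrow> complex ^ 'n \<Rightarrow> real" where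
  "bergman_norm U z v =
     sqrt (Re (\<Sum>i\<in>UNIV. \<Sum>j\<in>UNIV. bergman_metric U z $ i $ j * v $ i * cnj (v $ j)))"

text \<open>The library's piecewise continuously differentiable paths may have infinite length
  (the derivative can be unbounded near the exceptional points), so lengths are extended reals:
  a real-valued integral would assign length 0 to such a path.\<close>

definition bergman_length :: "(complex ^ 'n) set \<Rightarrow> (real \<Rightarrow> complex ^ 'n) \<Rightarrow> ennreal" where
  "bergman_length U \<gamma> =
     (\<integral>\<^sup>+t\<in>{0..1}. ennreal (bergman_norm U (\<gamma> t) (vector_derivative \<gamma> (at t))) \<partial>lborel)"

definition bergman_dist :: "(complex ^ 'n) set \<Rightarrow> complex ^ 'n \<Rightarrow> complex ^ 'n \<Rightarrow> real" where
  "bergman_dist U z w = enn2real (Inf {bergman_length U \<gamma> | \<gamma>.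
     valid_path \<gamma> \<and> path_image \<gamma> \<subseteq> U \<and> pathstart \<gamma> = z \<and> pathfinish \<gamma> = w})"

definition bergman_ball :: "(complex ^ 'n) set \<Rightarrow> complex ^ 'n \<Rightarrow> real \<Rightarrow> (complex ^ 'n) set" where
  "bergman_ball U z r = {w\<in>U. bergman_dist U z w \<le> r}"

definition sampling_sequence ::
  "(complex ^ 'n) set \<Rightarrow> real \<Rightarrow> (nat \<Rightarrow> complex ^ 'n) \<Rightarrow> bool" where
  "sampling_sequence U \<rho> z \<longleftrightarrow> \<rho> > 0 \<and>
     (\<forall>k. z k \<in> U) \<and>
     U = (\<Union>k. bergman_ball U (z k) \<rho>) \<and>
     (\<forall>i j. i \<noteq> j \<longrightarrow> bergman_ball U (z i) (\<rho> / 4) \<inter> bergman_ball U (z j) (\<rho> / 4) = {}) \<and>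
     (\<exists>N>0. \<forall>w\<in>U. finite {k. w \<in> bergman_ball U (z k) (2 * \<rho>)} \<and>
        card {k. w \<in> bergman_ball U (z k) (2 * \<rho>)} \<le> N)"

text \<open>Real powers of extended nonnegative reals, meant for positive exponents.\<close>

definition ennreal_powr :: "ennreal \<Rightarrow> real \<Rightarrow> ennreal" where
  "ennreal_powr x a = (if x = \<infinity> then \<infinity> else ennreal (enn2real x powr a))"

end

(*
  Write J for the Jacobian determinant of an automorphism psi with psi(t) = a, for a fixed base point t. Substituting
  w = psi(z) in the Forelli-Rudin estimate at the point a turns it, for suitable exponents, into a bound on the
  integral of |J(t)/J(z)|^m that is uniform in psi. By the sub-mean value property J(t)/J is uniformly bounded near t,
  so the Cauchy estimates bound dJ(t)/J(t), and the transformation law K(z,z) = |J(z)|^2 K(psi z, psi z) turns this into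
  a bound on the gradient of ln K(z,z) in the Bergman metric. Hence K(z,z) is comparable on Bergman balls of a fixed
  radius, their volume is comparable to 1/K(z,z), and transporting the sub-mean value inequality from t gives
    |f(x)|^s <= C K(x,x)^(1+alpha) int_{B(x,r/2)} |f|^s dV_alpha.
  For w in B(x,r/2) the ball B(w,r) contains B(x,r/2). Averaging over these w and summing over the sampling sequence
  proves the theorem with tau = (1+alpha) q/s + 1.
*)
theory Submission
  imports Defs "HOL-Complex_Analysis.Cauchy_Integral_Formula"
begin

section \<open>Holomorphic functions of several variables\<close>

text \<open>The quantity to control is the logarithmic derivative of K(z,z). Differentiating the
  transformation law at t gives \<open>K1 z v / kd z\<close> = \<open>K1 t u / kd t\<close> -
  dJ(u)/J(t), where v is the image of u under the Jacobi matrix at t. So all that is needed is a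
  bound for dJ/J at the single point t, uniform over all automorphisms. Forelli-Rudin yields it
  because, for m = \<alpha> - 1 - 2\<beta>, the powers of |J(t)| on its two sides agree. This bound
  involves the Euclidean norm of u; restating it in the Bergman metric requires that metric to be
  positive definite at t, and proving this takes a separate extremal argument with the kernel.
  Origin of \<tau>: raising the sub-mean value inequality to the power q/s produces K(x,x) to the
  power (1+\<alpha>) q/s, averaging over B(x,r/2), of volume about 1/K(x,x), produces one more
  factor K(x,x), and the hypothesis on the measure contributes K to the power -\<tau>, which cancels
  both. The radius r affects constants only. Points of B(x,r/2) with x in B(z_k,r) lie in B(z_k,2r),
  the family with bounded overlap.\<close>

definition dd :: "(complex ^ 'n \<Rightarrow> complex) \<Rightarrow> complex ^ 'n \<Rightarrow> complex ^ 'n \<Rightarrow> complex" where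
  "dd f z v = frechet_derivative f (at z) v"

lemma norm_vector_scalar: "norm (c *s (v :: complex ^ 'n)) = cmod c * norm v"
  unfolding norm_vec_def vector_scalar_mult_def
  by (simp add: norm_mult L2_set_right_distrib)

lemma dd_eqI: "(f has_derivative f') (at z) \<Longrightarrow> dd f z v = f' v"
  using frechet_derivative_at unfolding dd_def by metis

lemma vec_expand: "(v :: complex ^ 'n) = (\<Sum>j\<in>UNIV. v $ j *s axis j 1)"
  by (simp add: vec_eq_iff axis_def if_distrib sum.delta cong: if_cong)

text \<open>A real-linear map that commutes with complex scalars is fixed by its values on the axis
  vectors. The closure lemmas below therefore supply a derivative and its complex homogeneity and
  never exhibit a coefficient vector.\<close>

lemma hol_funI:
  assumes "\<And>z. z \<in> U \<Longrightarrow> (f has_derivative f' z) (at z)"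
    and "\<And>z c v. z \<in> U \<Longrightarrow> f' z (c *s v) = c * f' z v"
  shows "hol_fun f U"
  unfolding hol_fun_def
proof
  fix z assume z: "z \<in> U"
  interpret bounded_linear "f' z" using assms(1)[OF z] by (rule has_derivative_bounded_linear)
  have "f' z v = (\<Sum>j\<in>UNIV. (\<chi> j. f' z (axis j 1)) $ j * v $ j)" for v
    by (subst vec_expand[of v]) (simp add: sum assms(2)[OF z] mult.commute)
  then have "f' z = (\<lambda>v. \<Sum>j\<in>UNIV. (\<chi> j. f' z (axis j 1)) $ j * v $ j)" by (rule ext)
  then show "\<exists>a. (f has_derivative (\<lambda>v. \<Sum>j\<in>UNIV. a $ j * v $ j)) (at z)"
    using assms(1)[OF z] by metis
qed

lemma hol_fun_has_derivative:
  assumes "hol_fun f U" "z \<in> U"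
  shows "(f has_derivative dd f z) (at z)"
proof -
  obtain a where "(f has_derivative (\<lambda>v. \<Sum>j\<in>UNIV. a $ j * v $ j)) (at z)"
    using assms unfolding hol_fun_def by blast
  then show ?thesis unfolding dd_def
    using frechet_derivative_works differentiable_def by (metis eta_contract_eq)
qed

lemma dd_scale:
  assumes "hol_fun f U" "z \<in> U"
  shows "dd f z (c *s v) = c * dd f z v"
proof -
  obtain a where a: "(f has_derivative (\<lambda>v. \<Sum>j\<in>UNIV. a $ j * v $ j)) (at z)"
    using assms unfolding hol_fun_def by blast
  show ?thesis unfolding dd_eqI[OF a] by (simp add: sum_distrib_left mult_ac)
qed

lemma dd_linear: "hol_fun f U \<Longrightarrow> z \<in> U \<Longrightarrow> bounded_linear (dd f z)"
  using hol_fun_has_derivative has_derivative_bounded_linear by blast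

lemma dd_sum_axis:
  assumes "hol_fun f U" "z \<in> U"
  shows "dd f z v = (\<Sum>j\<in>UNIV. v $ j * dd f z (axis j 1))"
proof -
  interpret bounded_linear "dd f z" using dd_linear[OF assms] .
  have "dd f z v = dd f z (\<Sum>j\<in>UNIV. v $ j *s axis j 1)" by (simp only: vec_expand[symmetric])
  also have "\<dots> = (\<Sum>j\<in>UNIV. v $ j * dd f z (axis j 1))"
    unfolding sum by (intro sum.cong refl dd_scale[OF assms])
  finally show ?thesis .
qed

lemma hol_fun_continuous: "hol_fun f U \<Longrightarrow> continuous_on U f"
  by (meson hol_fun_has_derivative has_derivative_continuous continuous_at_imp_continuous_on)

lemma hol_fun_subset: "hol_fun f U \<Longrightarrow> V \<subseteq> U \<Longrightarrow> hol_fun f V"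
  unfolding hol_fun_def by blast

lemma hol_fun_const [intro]: "hol_fun (\<lambda>z. c) U"
  by (rule hol_funI[where f' = "\<lambda>_ _. 0"]) auto

lemma hol_fun_add: "hol_fun f U \<Longrightarrow> hol_fun g U \<Longrightarrow> hol_fun (\<lambda>z. f z + g z) U"
  by (rule hol_funI[where f' = "\<lambda>z v. dd f z v + dd g z v"])
     (auto intro!: has_derivative_add hol_fun_has_derivative simp: dd_scale algebra_simps)

lemma hol_fun_mult: "hol_fun f U \<Longrightarrow> hol_fun g U \<Longrightarrow> hol_fun (\<lambda>z. f z * g z) U"
proof (rule hol_funI[where f' = "\<lambda>z v. f z * dd g z v + dd f z v * g z"])
  fix z assume "hol_fun f U" "hol_fun g U" "z \<in> U"
  then show "((\<lambda>z. f z * g z) has_derivative (\<lambda>v. f z * dd g z v + dd f z v * g z)) (at z)"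
    by (intro has_derivative_mult hol_fun_has_derivative)
qed (simp add: dd_scale algebra_simps)

lemma hol_fun_cmult: "hol_fun f U \<Longrightarrow> hol_fun (\<lambda>z. c * f z) U"
  by (intro hol_fun_mult hol_fun_const)

lemma hol_fun_diff: "hol_fun f U \<Longrightarrow> hol_fun g U \<Longrightarrow> hol_fun (\<lambda>z. f z - g z) U"
  using hol_fun_add[OF _ hol_fun_cmult[of g U "-1"]] by simp

lemma hol_fun_sum: "(\<And>i. i \<in> I \<Longrightarrow> hol_fun (f i) U) \<Longrightarrow> hol_fun (\<lambda>z. \<Sum>i\<in>I. f i z) U"
  by (induction I rule: infinite_finite_induct) (auto intro: hol_fun_add)

lemma hol_fun_prod: "(\<And>i. i \<in> I \<Longrightarrow> hol_fun (f i) U) \<Longrightarrow> hol_fun (\<lambda>z. \<Prod>i\<in>I. f i z) U"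
  by (induction I rule: infinite_finite_induct) (auto intro: hol_fun_mult)

lemma hol_fun_inverse:
  assumes "hol_fun f U" "\<And>z. z \<in> U \<Longrightarrow> f z \<noteq> 0"
  shows "hol_fun (\<lambda>z. inverse (f z)) U"
proof (rule hol_funI[where f' = "\<lambda>z v. - (inverse (f z) * dd f z v * inverse (f z))"])
  fix z assume z: "z \<in> U"
  show "((\<lambda>z. inverse (f z)) has_derivative (\<lambda>v. - (inverse (f z) * dd f z v * inverse (f z)))) (at z)"
    by (rule Deriv.has_derivative_inverse[OF assms(2)[OF z] hol_fun_has_derivative[OF assms(1) z]])
qed (simp add: dd_scale[OF assms(1)])

lemma hol_fun_comp:
  fixes U :: "(complex ^ 'n) set"
  assumes f: "hol_fun f U'" and p: "hol_map \<psi> U" and "\<psi> ` U \<subseteq> U'"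
  shows "hol_fun (\<lambda>z. f (\<psi> z)) U"
proof -
  obtain A :: "complex ^ 'n \<Rightarrow> complex ^ 'n ^ 'n"
    where A: "\<And>z. z \<in> U \<Longrightarrow> (\<psi> has_derivative (\<lambda>v. A z *v v)) (at z)"
    using p unfolding hol_map_def by metis
  show ?thesis
  proof (rule hol_funI[where f' = "\<lambda>z v. dd f (\<psi> z) (A z *v v)"])
    fix z assume z: "z \<in> U"
    show "((\<lambda>z. f (\<psi> z)) has_derivative (\<lambda>v. dd f (\<psi> z) (A z *v v))) (at z)"
      by (rule has_derivative_compose[OF A[OF z]])
         (use assms z in \<open>auto intro: hol_fun_has_derivative\<close>)
  next
    fix z c v assume z: "z \<in> U"
    have "\<psi> z \<in> U'" using assms z by auto
    then show "dd f (\<psi> z) (A z *v (c *s v)) = c * dd f (\<psi> z) (A z *v v)"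
      by (simp add: dd_scale[OF f, symmetric] vector_scalar_commute)
  qed
qed

lemma hol_fun_cong:
  assumes "open U" "hol_fun f U" "\<And>z. z \<in> U \<Longrightarrow> f z = g z"
  shows "hol_fun g U"
proof (rule hol_funI[where f' = "dd f"])
  fix z assume z: "z \<in> U"
  show "(g has_derivative dd f z) (at z)"
    by (rule has_derivative_transform_within_open[OF hol_fun_has_derivative[OF assms(2) z] assms(1) z])
       (rule assms(3))
qed (rule dd_scale[OF assms(2)])

lemma hol_fun_coord: "hol_fun (\<lambda>z. z $ i) U"
  by (rule hol_funI[where f' = "\<lambda>_ v. v $ i"])
     (simp_all add: bounded_linear_imp_has_derivative bounded_linear_vec_nth)

section \<open>Restriction to complex lines and Cauchy estimates\<close>

lemma slice_deriv:
  assumes "hol_fun f U" "z + c *s v \<in> U"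
  shows "((\<lambda>c. f (z + c *s v)) has_field_derivative dd f (z + c *s v) v) (at c)"
proof -
  have "linear (\<lambda>c. c *s v)"
    by (rule linearI) (auto simp: vec_eq_iff algebra_simps)
  then have "bounded_linear (\<lambda>c. c *s v)" by (simp add: linear_conv_bounded_linear)
  from has_derivative_add[OF has_derivative_const bounded_linear_imp_has_derivative[OF this]]
  have "((\<lambda>c. z + c *s v) has_derivative (\<lambda>c. c *s v)) (at c)" by simp
  from has_derivative_compose[OF this hol_fun_has_derivative[OF assms]]
  show ?thesis
    by (rule has_derivative_imp_has_field_derivative) (simp add: dd_scale[OF assms])
qed

lemma slice_holomorphic:
  assumes "hol_fun f U" "\<And>c. c \<in> D \<Longrightarrow> z + c *s v \<in> U"
  shows "(\<lambda>c. f (z + c *s v)) holomorphic_on D"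
  unfolding holomorphic_on_def field_differentiable_def
  using slice_deriv[OF assms(1) assms(2)] has_field_derivative_at_within by blast

lemma mem_ball_scale:
  assumes "cmod c \<le> a" "a * norm v < R"
  shows "z + c *s (v::complex^'n) \<in> ball z R"
proof -
  have "cmod c * norm v \<le> a * norm v" using assms by (intro mult_right_mono) auto
  then show ?thesis using assms by (simp add: dist_norm norm_vector_scalar)
qed

text \<open>On the complex line through z in direction v, f becomes a function of one variable on
  the disc of radius R/|v|, and Cauchy's inequality for its first derivative applies there.\<close>

lemma cauchy_bound:
  assumes f: "hol_fun f (ball z R)" and R: "0 < R" and M: "\<And>y. y \<in> ball z R \<Longrightarrow> cmod (f y) \<le> M"
  shows "cmod (dd f z v) \<le> M * norm v / R"
proof (cases "v = 0")
  case True
  have "dd f z 0 = 0" using dd_linear[OF f, of z] R by (simp add: linear_simps)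
  moreover have "0 \<le> M" using M[of z] R by (meson centre_in_ball norm_ge_zero order_trans)
  ultimately show ?thesis using True by simp
next
  case False
  have *: "cmod (dd f z v) \<le> M / \<rho>" if "0 < \<rho>" "\<rho> * norm v < R" for \<rho>
  proof -
    let ?g = "\<lambda>c. f (z + c *s v)"
    have mem: "z + c *s v \<in> ball z R" if "cmod c \<le> \<rho>" for c
      using mem_ball_scale[OF that] \<open>\<rho> * norm v < R\<close> by blast
    have h: "?g holomorphic_on cball 0 \<rho>"
      by (rule slice_holomorphic[OF f]) (use mem in auto)
    have "cmod ((deriv ^^ 1) ?g 0) \<le> fact 1 * M / \<rho> ^ 1"
      by (rule Cauchy_inequality)
         (use h mem M that in \<open>auto intro: holomorphic_on_subset holomorphic_on_imp_continuous_on\<close>)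
    moreover have "deriv ?g 0 = dd f z v"
      using slice_deriv[OF f, of z 0 v] R by (intro DERIV_imp_deriv) auto
    ultimately show ?thesis by simp
  qed
  \<comment> \<open>The closed disc of radius exactly R/|v| is not contained in the open ball, so
    the optimal radius is reached only as a limit from the left.\<close>
  have "((\<lambda>\<rho>. M / \<rho>) \<longlongrightarrow> M / (R / norm v)) (at_left (R / norm v))"
    using False R by (intro tendsto_intros) auto
  moreover have "eventually (\<lambda>\<rho>. cmod (dd f z v) \<le> M / \<rho>) (at_left (R / norm v))"
    unfolding eventually_at_left_field
    by (rule exI[of _ 0]) (use False R * in \<open>auto simp: field_simps\<close>)
  ultimately have "cmod (dd f z v) \<le> M / (R / norm v)"
    by (rule tendsto_lowerbound) (simp add: trivial_limit_at_left_real)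
  then show ?thesis by simp
qed

lemma cauchy_bound_at:
  assumes f: "hol_fun f (ball a R)" and M: "\<And>y. y \<in> ball a R \<Longrightarrow> cmod (f y) \<le> M"
    and y: "y \<in> ball a (R/2)"
  shows "cmod (dd f y v) \<le> 2 * M * norm v / R"
proof -
  have sub: "ball y (R/2) \<subseteq> ball a R"
  proof
    fix x assume "x \<in> ball y (R/2)"
    then show "x \<in> ball a R" using y dist_triangle[of a x y] by simp
  qed
  have R: "0 < R" using y zero_le_dist[of a y] by (simp del: zero_le_dist)
  have "cmod (dd f y v) \<le> M * norm v / (R/2)"
    by (rule cauchy_bound) (use sub f M R in \<open>auto intro: hol_fun_subset\<close>)
  then show ?thesis by (simp add: mult_ac)
qed

lemma hol_lipschitz:
  assumes f: "hol_fun f (ball a R)" and M: "\<And>y. y \<in> ball a R \<Longrightarrow> cmod (f y) \<le> M"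
    and x: "x \<in> ball a (R/2)" and y: "y \<in> ball a (R/2)"
  shows "cmod (f x - f y) \<le> 2 * M / R * norm (x - y)"
proof (rule differentiable_bound[of "ball a (R/2)"])
  have R: "0 < R" using y zero_le_dist[of a y] by (simp del: zero_le_dist)
  fix w assume w: "w \<in> ball a (R/2)"
  then have "w \<in> ball a R" using R by auto
  then show "(f has_derivative dd f w) (at w within ball a (R/2))"
    using hol_fun_has_derivative[OF f] has_derivative_at_withinI by blast
  show "onorm (dd f w) \<le> 2 * M / R"
    using cauchy_bound_at[OF f M w] by (intro onorm_le) (auto simp: field_simps)
qed (use x y in auto)

text \<open>Taylor's formula for the slice between the parameters 0 and 1, with the second
  derivative bounded by Cauchy's inequality. The bound depends on f only through R and M, so it is
  uniform over bounded families.\<close>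

lemma second_order_bound:
  assumes f: "hol_fun f (ball z R)" and R: "0 < R" and M: "\<And>y. y \<in> ball z R \<Longrightarrow> cmod (f y) \<le> M"
    and v: "norm v \<le> R / 4"
  shows "cmod (f (z + v) - f z - dd f z v) \<le> 8 * M / R\<^sup>2 * (norm v)\<^sup>2"
proof (cases "v = 0")
  case True
  have "dd f z 0 = 0" using dd_linear[OF f, of z] R by (simp add: linear_simps)
  with True show ?thesis by simp
next
  case False
  have M0: "0 \<le> M" using M[of z] R by (meson centre_in_ball norm_ge_zero order_trans)
  \<comment> \<open>Half the radius of the disc on which the slice is defined. The assumption on |v|
    makes it at least 2, so the disc of radius \<open>\<rho>\<close> about any point of modulus
    below 2 stays inside that disc.\<close>
  define \<rho> where "\<rho> = R / (2 * norm v)"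
  have nv: "norm v > 0" using False by simp
  have \<rho>: "\<rho> \<ge> 2" using v nv by (simp add: \<rho>_def field_simps)
  let ?g = "\<lambda>c. f (z + c *s v)"
  have mem: "z + c *s v \<in> ball z R" if "cmod c < 2 * \<rho>" for c
    using mem_ball_scale[of c "cmod c" v R z] that nv by (simp add: \<rho>_def field_simps)
  have h: "?g holomorphic_on ball 0 (2*\<rho>)"
    by (rule slice_holomorphic[OF f]) (use mem in auto)
  have B: "cmod ((deriv ^^ 2) ?g c) \<le> 2 * M / \<rho>\<^sup>2" if "c \<in> ball 0 2" for c
  proof -
    have sub: "cball c \<rho> \<subseteq> ball 0 (2 * \<rho>)"
    proof
      fix x assume "x \<in> cball c \<rho>"
      then have "cmod x \<le> cmod c + \<rho>"
        using norm_triangle_ineq[of c "x - c"] by (simp add: dist_norm norm_minus_commute)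
      then show "x \<in> ball 0 (2*\<rho>)" using that \<rho> by auto
    qed
    have "cmod ((deriv ^^ 2) ?g c) \<le> fact 2 * M / \<rho> ^ 2"
    proof (rule Cauchy_inequality)
      show "?g holomorphic_on ball c \<rho>"
        using h sub holomorphic_on_subset ball_subset_cball by (metis subset_trans)
      show "continuous_on (cball c \<rho>) ?g"
        using h sub holomorphic_on_subset holomorphic_on_imp_continuous_on by blast
      show "cmod (?g x) \<le> M" if "cmod (c - x) = \<rho>" for x
      proof -
        have "x \<in> cball c \<rho>" using that by (simp add: dist_norm)
        then show ?thesis using sub mem M by (meson mem_ball_0 subsetD)
      qed
    qed (use \<rho> in auto)
    then show ?thesis by simp
  qed
  have "cmod ((deriv ^^ 0) ?g 1 - (\<Sum>i\<le>1. (deriv ^^ i) ?g 0 * (1 - 0) ^ i / fact i))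
      \<le> 2 * M / \<rho>\<^sup>2 * cmod (1 - 0) ^ Suc 1 / fact 1"
  proof (rule complex_Taylor[where S = "ball 0 2"])
    fix i :: nat and x :: complex assume x: "x \<in> ball 0 2"
    have "(deriv ^^ i) ?g holomorphic_on ball 0 (2 * \<rho>)"
      by (rule holomorphic_higher_deriv[OF h]) auto
    then have "((deriv ^^ i) ?g has_field_derivative deriv ((deriv ^^ i) ?g) x) (at x)"
      using x \<rho> by (intro holomorphic_derivI[of _ "ball 0 (2*\<rho>)"]) auto
    then show "((deriv ^^ i) ?g has_field_derivative (deriv ^^ Suc i) ?g x) (at x within ball 0 2)"
      by (simp add: has_field_derivative_at_within)
  next
    fix x :: complex assume x: "x \<in> ball 0 2"
    show "cmod ((deriv ^^ Suc 1) ?g x) \<le> 2 * M / \<rho>\<^sup>2"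
      using B[OF x] by (simp add: numeral_2_eq_2)
  qed auto
  moreover have "deriv ?g 0 = dd f z v"
    using slice_deriv[OF f, of z 0 v] R by (intro DERIV_imp_deriv) auto
  ultimately have "cmod (f (z + v) - f z - dd f z v) \<le> 2 * M / \<rho>\<^sup>2"
    by (simp add: algebra_simps)
  also have "\<dots> = 8 * M / R\<^sup>2 * (norm v)\<^sup>2"
    using nv R by (simp add: \<rho>_def field_simps power2_eq_square)
  finally show ?thesis .
qed

text \<open>An explicit quadratic remainder survives pointwise limits and sums of several error
  terms, which a bare o(|v|) would not; differentiability is therefore derived from it.\<close>

lemma has_derivative_quadratic:
  fixes f :: "'a::real_normed_vector \<Rightarrow> 'b::real_normed_vector"
  assumes "bounded_linear f'" "0 < r"
    and "\<And>v. norm v < r \<Longrightarrow> norm (f (z + v) - f z - f' v) \<le> C * (norm v)\<^sup>2"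
  shows "(f has_derivative f') (at z)"
proof -
  have "((\<lambda>h::'a. C * norm h) \<longlongrightarrow> C * norm (0::'a)) (at 0)"
    by (rule tendsto_mult[OF tendsto_const tendsto_norm[OF tendsto_ident_at]])
  moreover have "eventually (\<lambda>h. norm (norm (f (z + h) - f z - f' h) / norm h) \<le> C * norm h) (at 0)"
    unfolding eventually_at
    by (rule exI[of _ r]) (use assms in \<open>auto simp: field_simps power2_eq_square\<close>)
  ultimately have "(\<lambda>h. norm (f (z + h) - f z - f' h) / norm h) \<midarrow>0\<rightarrow> 0"
    using Lim_null_comparison[of "\<lambda>h. norm (f (z + h) - f z - f' h) / norm h"] by simp
  then show ?thesis using assms(1) by (simp add: has_derivative_at)
qed

text \<open>By the Cauchy estimates the gradients stay bounded, and \<open>second_order_bound\<close> passes to the limit along a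
  subsequence of convergent gradients; so pointwise convergence suffices.\<close>

lemma hol_pointwise_limit_at:
  fixes z :: "complex ^ 'n"
  assumes R: "0 < R" and F: "\<And>n. hol_fun (F n) (ball z R)"
    and M: "\<And>n y. y \<in> ball z R \<Longrightarrow> cmod (F n y) \<le> M"
    and lim: "\<And>y. y \<in> ball z R \<Longrightarrow> (\<lambda>n. F n y) \<longlonglongrightarrow> f y"
  shows "hol_fun f {z}"
proof -
  define a where "a n = (\<chi> j. dd (F n) z (axis j 1))" for n
  have "norm (a n) \<le> of_nat CARD('n) * (M / R)" for n
  proof -
    have "norm (a n) \<le> (\<Sum>j\<in>UNIV. norm (a n $ j))" by (simp add: norm_vec_def L2_set_le_sum)
    also have "\<dots> \<le> (\<Sum>j\<in>(UNIV::'n set). M / R)"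
      using cauchy_bound[OF F R M, where v = "axis _ 1"] by (intro sum_mono) (simp add: a_def)
    finally show ?thesis by simp
  qed
  then have "bounded (range a)" unfolding bounded_iff by blast
  then obtain l r where r: "strict_mono (r::nat\<Rightarrow>nat)" and l: "(a \<circ> r) \<longlonglongrightarrow> l"
    using bounded_imp_convergent_subsequence by blast
  have "(f has_derivative (\<lambda>v. \<Sum>j\<in>UNIV. l $ j * v $ j)) (at z)"
  proof (rule has_derivative_quadratic)
    show "bounded_linear (\<lambda>v. \<Sum>j\<in>UNIV. l $ j * v $ j)"
      by (intro bounded_linear_sum bounded_linear_mult_const[THEN bounded_linear_compose]
          bounded_linear_const_mult bounded_linear_vec_nth)
    show "0 < R / 4" using R by simp
    fix v :: "complex ^ 'n" assume v: "norm v < R / 4"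
    have zv: "z + v \<in> ball z R" using v R by (simp add: dist_norm)
    have "(\<lambda>n. cmod (F (r n) (z + v) - F (r n) z - (\<Sum>j\<in>UNIV. a (r n) $ j * v $ j)))
        \<longlonglongrightarrow> cmod (f (z + v) - f z - (\<Sum>j\<in>UNIV. l $ j * v $ j))"
      using l LIMSEQ_subseq_LIMSEQ[OF lim[OF zv] r] LIMSEQ_subseq_LIMSEQ[OF lim[of z] r] R
      by (intro tendsto_intros) (auto simp: o_def)
    moreover have "cmod (F (r n) (z + v) - F (r n) z - (\<Sum>j\<in>UNIV. a (r n) $ j * v $ j))
        \<le> 8 * M / R\<^sup>2 * (norm v)\<^sup>2" for n
    proof -
      have "(\<Sum>j\<in>UNIV. a (r n) $ j * v $ j) = dd (F (r n)) z v"
        using R by (subst dd_sum_axis[OF F]) (auto simp: a_def mult.commute)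
      then show ?thesis using second_order_bound[OF F[of "r n"] R M[of _ "r n"], of v] v by simp
    qed
    ultimately show "cmod (f (z + v) - f z - (\<Sum>j\<in>UNIV. l $ j * v $ j)) \<le> 8 * M / R\<^sup>2 * (norm v)\<^sup>2"
      by (intro LIMSEQ_le_const2) auto
  qed
  then show ?thesis unfolding hol_fun_def by blast
qed

section \<open>Directional derivatives as limits of difference quotients\<close>

lemma diff_quotient_bound:
  assumes f: "hol_fun f (ball a R)" and M: "\<And>y. y \<in> ball a R \<Longrightarrow> cmod (f y) \<le> M"
    and y: "y \<in> ball a (R/2)" and e: "0 < e" "e * norm v \<le> R / 8"
  shows "cmod ((f (y + of_real e *s v) - f y) / of_real e - dd f y v) \<le> 32 * M / R\<^sup>2 * (norm v)\<^sup>2 * e"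
proof -
  have R: "0 < R" using y zero_le_dist[of a y] by (simp del: zero_le_dist)
  have sub: "ball y (R/2) \<subseteq> ball a R"
  proof
    fix x assume "x \<in> ball y (R/2)"
    then show "x \<in> ball a R" using y dist_triangle[of a x y] by simp
  qed
  have ya: "y \<in> ball a R" using y R by simp
  let ?v = "of_real e *s v"
  have nv: "norm ?v = e * norm v" using e by (simp add: norm_vector_scalar)
  have "cmod (f (y + ?v) - f y - dd f y ?v) \<le> 8 * M / (R/2)\<^sup>2 * (norm ?v)\<^sup>2"
    by (rule second_order_bound) (use sub f M R e nv in \<open>auto intro: hol_fun_subset\<close>)
  then have *: "cmod (f (y + ?v) - f y - of_real e * dd f y v) \<le> 32 * M / R\<^sup>2 * (norm v)\<^sup>2 * e * e"
    unfolding nv dd_scale[OF f ya] by (simp add: power2_eq_square mult_ac)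
  have "(f (y + ?v) - f y) / of_real e - dd f y v = (f (y + ?v) - f y - of_real e * dd f y v) / of_real e"
    using e by (simp add: field_simps)
  then have "cmod ((f (y + ?v) - f y) / of_real e - dd f y v)
      = cmod (f (y + ?v) - f y - of_real e * dd f y v) / e"
    using e by (simp add: norm_divide)
  also have "\<dots> \<le> (32 * M / R\<^sup>2 * (norm v)\<^sup>2 * e * e) / e"
    by (rule divide_right_mono[OF *]) (use e in auto)
  finally show ?thesis using e by simp
qed

lemma hol_fun_add_const:
  assumes "hol_fun f U" "\<And>y. y \<in> V \<Longrightarrow> y + c \<in> U"
  shows "hol_fun (\<lambda>y. f (y + c)) V"
proof (rule hol_funI[where f' = "\<lambda>z. dd f (z + c)"])
  fix z assume z: "z \<in> V"
  have "((\<lambda>y. y + c) has_derivative (\<lambda>h. h)) (at z)" by (auto intro!: derivative_eq_intros)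
  from has_derivative_compose[OF this hol_fun_has_derivative[OF assms(1) assms(2)[OF z]]]
  show "((\<lambda>y. f (y + c)) has_derivative dd f (z + c)) (at z)" .
qed (rule dd_scale[OF assms(1) assms(2)])

text \<open>Used with t = |v|. The bound R/8 keeps the shifted points inside the ball,
  \<open>e n \<le> 1\<close> turns an error linear in the step into a uniform bound, and t + 1 in
  the denominator admits v = 0.\<close>

lemma small_steps:
  fixes R t :: real
  assumes "0 < R" "0 \<le> t"
  obtains e :: "nat \<Rightarrow> real" where "\<And>n. 0 < e n" "\<And>n. e n * t \<le> R / 8" "\<And>n. e n \<le> 1" "e \<longlonglongrightarrow> 0"
proof
  define d where "d = min 1 (R / (8 * (t + 1)))"
  have "d \<le> R / (8 * (t + 1))" by (simp add: d_def)
  then have "d * (8 * (t + 1)) \<le> R" using assms by (simp add: pos_le_divide_eq)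
  then have "d * (t + 1) \<le> R / 8" by (simp add: algebra_simps)
  then have d: "0 < d" "d \<le> 1" "d * (t + 1) \<le> R / 8" using assms by (auto simp: d_def)
  let ?e = "\<lambda>n::nat. d / (real n + 1)"
  show "0 < ?e n" "?e n \<le> 1" for n using d by (auto simp: field_simps)
  have "?e n \<le> d" for n using d by (simp add: field_simps)
  then have "?e n * t \<le> d * (t + 1)" for n using d assms by (intro mult_mono) auto
  then show "?e n * t \<le> R / 8" for n using d(3) order_trans by blast
  show "?e \<longlonglongrightarrow> 0" using LIMSEQ_Suc[OF lim_const_over_n[of d]] by (simp add: add.commute)
qed

lemma hol_fun_locally_bounded:
  assumes "hol_fun f U" "open U" "z \<in> U"
  obtains R M where "0 < R" "ball z R \<subseteq> U" "\<And>y. y \<in> ball z R \<Longrightarrow> cmod (f y) \<le> M"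
proof -
  obtain R where R: "0 < R" "cball z R \<subseteq> U" using assms(2,3) open_contains_cball by blast
  have "bounded (f ` cball z R)"
    using R(2) hol_fun_continuous[OF assms(1)]
    by (intro compact_imp_bounded compact_continuous_image) (auto intro: continuous_on_subset)
  then obtain M where "\<forall>y\<in>f ` cball z R. cmod y \<le> M" unfolding bounded_iff by blast
  with R show ?thesis using that[of R M] ball_subset_cball by blast
qed

lemma scale_in_ball:
  fixes v y :: "complex ^ 'n"
  assumes "y \<in> ball a (R/2)" "0 < e" "e * norm v \<le> R / 8"
  shows "y + of_real e *s v \<in> ball a R"
proof -
  have "norm (of_real e *s v) \<le> R / 8" using assms by (simp add: norm_vector_scalar)
  then have "dist y (y + of_real e *s v) \<le> R / 8" by (simp add: dist_norm)
  then show ?thesis using assms(1) dist_triangle[of a "y + of_real e *s v" y] zero_le_dist[of a y]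
    by (simp del: zero_le_dist)
qed

lemma diff_quotient_tendsto:
  assumes f: "hol_fun f (ball a R)" and M: "\<And>y. y \<in> ball a R \<Longrightarrow> cmod (f y) \<le> M"
    and y: "y \<in> ball a (R/2)" and e: "\<And>n. 0 < e n" "\<And>n. e n * norm v \<le> R / 8" "e \<longlonglongrightarrow> 0"
  shows "(\<lambda>n. (f (y + of_real (e n) *s v) - f y) / of_real (e n)) \<longlonglongrightarrow> dd f y v"
proof -
  have "(\<lambda>n. 32 * M / R\<^sup>2 * (norm v)\<^sup>2 * e n) \<longlonglongrightarrow> 32 * M / R\<^sup>2 * (norm v)\<^sup>2 * 0"
    by (intro tendsto_intros e)
  then have "(\<lambda>n. (f (y + of_real (e n) *s v) - f y) / of_real (e n) - dd f y v) \<longlonglongrightarrow> 0"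
    by (intro Lim_null_comparison[OF always_eventually[OF allI[OF diff_quotient_bound[OF f M y e(1) e(2)]]]]) auto
  then show ?thesis using LIM_zero_iff by blast
qed

text \<open>The difference quotients along v are holomorphic, uniformly bounded on a smaller ball
  and pointwise convergent to the derivative, so the limit theorem applies.\<close>

lemma hol_fun_dd:
  assumes f: "hol_fun f U" and U: "open U"
  shows "hol_fun (\<lambda>z. dd f z v) U"
proof -
  have "hol_fun (\<lambda>z. dd f z v) {z}" if z: "z \<in> U" for z
  proof -
    obtain R M where R: "0 < R" "ball z R \<subseteq> U" and M: "\<And>y. y \<in> ball z R \<Longrightarrow> cmod (f y) \<le> M"
      by (rule hol_fun_locally_bounded[OF f U z]; blast)
    have M0: "0 \<le> M" using M[of z] R by (meson centre_in_ball norm_ge_zero order_trans)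
    have fR: "hol_fun f (ball z R)" using f R(2) by (rule hol_fun_subset)
    obtain e where e: "\<And>n. 0 < e n" "\<And>n. e n * norm v \<le> R / 8" "\<And>n. e n \<le> 1" "e \<longlonglongrightarrow> 0"
      using small_steps[of R "norm v"] R by auto
    let ?F = "\<lambda>n y. (f (y + of_real (e n) *s v) - f y) / of_real (e n)"
    show ?thesis
    proof (rule hol_pointwise_limit_at[of "R/2" ?F])
      show "hol_fun (?F n) (ball z (R/2))" for n
      proof -
        have "hol_fun (\<lambda>y. f (y + of_real (e n) *s v)) (ball z (R/2))"
          by (rule hol_fun_add_const[OF fR]) (use scale_in_ball[of _ z R "e n" v] e in auto)
        moreover have "hol_fun f (ball z (R/2))" using R by (intro hol_fun_subset[OF fR]) auto
        ultimately show ?thesis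
          unfolding divide_inverse by (rule hol_fun_mult[OF hol_fun_diff hol_fun_const])
      qed
      fix n y assume y: "y \<in> ball z (R/2)"
      have "cmod (?F n y) \<le> cmod (dd f y v) + cmod (?F n y - dd f y v)"
        using norm_triangle_ineq[of "dd f y v" "?F n y - dd f y v"] by simp
      also have "\<dots> \<le> 2 * M * norm v / R + 32 * M / R\<^sup>2 * (norm v)\<^sup>2 * e n"
        using cauchy_bound_at[OF fR M y, of v] diff_quotient_bound[OF fR M y e(1)[of n] e(2)[of n]]
        by (rule add_mono)
      also have "\<dots> \<le> 2 * M * norm v / R + 32 * M / R\<^sup>2 * (norm v)\<^sup>2"
        using mult_left_mono[OF e(3)[of n], of "32 * M / R\<^sup>2 * (norm v)\<^sup>2"] M0 by simp
      finally show "cmod (?F n y) \<le> 2 * M * norm v / R + 32 * M / R\<^sup>2 * (norm v)\<^sup>2" .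
    next
      fix y assume y: "y \<in> ball z (R/2)"
      show "(\<lambda>n. ?F n y) \<longlonglongrightarrow> dd f y v"
        by (rule diff_quotient_tendsto[OF fR M y e(1) e(2) e(4)])
    qed (use R in auto)
  qed
  then show ?thesis unfolding hol_fun_def by blast
qed

lemma dd_diff: "hol_fun f U \<Longrightarrow> hol_fun g U \<Longrightarrow> z \<in> U \<Longrightarrow> dd (\<lambda>z. f z - g z) z v = dd f z v - dd g z v"
  by (intro dd_eqI[where f' = "\<lambda>v. dd f z v - dd g z v"] has_derivative_diff hol_fun_has_derivative)

section \<open>Sesquiholomorphic kernels\<close>

text \<open>Holomorphic in the first variable and antiholomorphic in the second. Local boundedness
  on products of balls is included because it makes the Cauchy estimates in one variable uniform in
  the other; joint regularity follows from that without Hartogs' theorem.\<close>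

definition sesq :: "(complex ^ 'n \<Rightarrow> complex ^ 'n \<Rightarrow> complex) \<Rightarrow> (complex ^ 'n) set \<Rightarrow> bool" where
  "sesq L U \<longleftrightarrow>
     (\<forall>w\<in>U. hol_fun (\<lambda>z. L z w) U) \<and> (\<forall>z\<in>U. hol_fun (\<lambda>w. cnj (L z w)) U) \<and>
     (\<forall>a\<in>U. \<forall>b\<in>U. \<exists>R>0. \<exists>M. ball a R \<subseteq> U \<and> ball b R \<subseteq> U \<and>
        (\<forall>z\<in>ball a R. \<forall>w\<in>ball b R. cmod (L z w) \<le> M))"

lemma sesqD1: "sesq L U \<Longrightarrow> w \<in> U \<Longrightarrow> hol_fun (\<lambda>z. L z w) U"
  and sesqD2: "sesq L U \<Longrightarrow> z \<in> U \<Longrightarrow> hol_fun (\<lambda>w. cnj (L z w)) U"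
  unfolding sesq_def by blast+

lemma sesqD3:
  assumes "sesq L U" "a \<in> U" "b \<in> U"
  obtains R M where "0 < R" "ball a R \<subseteq> U" "ball b R \<subseteq> U"
    "\<And>z w. z \<in> ball a R \<Longrightarrow> w \<in> ball b R \<Longrightarrow> cmod (L z w) \<le> M"
  using assms unfolding sesq_def by meson

lemma sesq_swap: "sesq L U \<Longrightarrow> sesq (\<lambda>z w. cnj (L w z)) U"
  unfolding sesq_def by (auto; meson)

text \<open>For a fixed step the difference quotient in z is antiholomorphic in w, and its bound
  does not depend on the step; so antiholomorphy in w passes to the limit. With
  \<open>sesq_swap\<close> the same holds for derivatives in the second variable.\<close>

lemma sesq_dd:
  assumes L: "sesq L U" and U: "open U"
  shows "sesq (\<lambda>z w. dd (\<lambda>z. L z w) z v) U"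
  unfolding sesq_def
proof (intro conjI ballI)
  fix w assume "w \<in> U"
  then show "hol_fun (\<lambda>z. dd (\<lambda>z. L z w) z v) U" using sesqD1[OF L] U hol_fun_dd by blast
next
  fix z assume z: "z \<in> U"
  have "hol_fun (\<lambda>w. cnj (dd (\<lambda>z. L z w) z v)) {b}" if b: "b \<in> U" for b
  proof -
    obtain R M where R: "0 < R" "ball z R \<subseteq> U" "ball b R \<subseteq> U"
      and M: "\<And>y w. y \<in> ball z R \<Longrightarrow> w \<in> ball b R \<Longrightarrow> cmod (L y w) \<le> M"
      by (rule sesqD3[OF L z b]; blast)
    have M0: "0 \<le> M" using M[of z b] R by (meson centre_in_ball norm_ge_zero order_trans)
    obtain e where e: "\<And>n. 0 < e n" "\<And>n. e n * norm v \<le> R / 8" "\<And>n. e n \<le> 1" "e \<longlonglongrightarrow> 0"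
      using small_steps[of R "norm v"] R by auto
    let ?G = "\<lambda>n w. (L (z + of_real (e n) *s v) w - L z w) / of_real (e n)"
    have hL: "hol_fun (\<lambda>z. L z w) (ball z R)" if "w \<in> ball b R" for w
      using sesqD1[OF L] that R by (meson hol_fun_subset subsetD)
    have zR: "z \<in> ball z (R/2)" using R by simp
    show ?thesis
    proof (rule hol_pointwise_limit_at[of R "\<lambda>n w. cnj (?G n w)"])
      fix n
      have "z + of_real (e n) *s v \<in> U" using scale_in_ball[OF zR e(1)[of n] e(2)[of n]] R by auto
      from sesqD2[OF L this] sesqD2[OF L z]
      have "hol_fun (\<lambda>w. inverse (of_real (e n)) * (cnj (L (z + of_real (e n) *s v) w) - cnj (L z w))) U"
        by (intro hol_fun_cmult hol_fun_diff)
      then show "hol_fun (\<lambda>w. cnj (?G n w)) (ball b R)"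
        using R by (auto simp: divide_inverse mult.commute intro: hol_fun_subset)
      fix y assume y: "y \<in> ball b R"
      have "cmod (?G n y) \<le> cmod (dd (\<lambda>z. L z y) z v) + cmod (?G n y - dd (\<lambda>z. L z y) z v)"
        using norm_triangle_ineq[of "dd (\<lambda>z. L z y) z v" "?G n y - dd (\<lambda>z. L z y) z v"] by simp
      also have "\<dots> \<le> 2 * M * norm v / R + 32 * M / R\<^sup>2 * (norm v)\<^sup>2 * e n"
        using cauchy_bound_at[OF hL[OF y] M[OF _ y] zR, of v]
          diff_quotient_bound[OF hL[OF y] M[OF _ y] zR e(1)[of n] e(2)[of n]]
        by (rule add_mono)
      also have "\<dots> \<le> 2 * M * norm v / R + 32 * M / R\<^sup>2 * (norm v)\<^sup>2"
        using mult_left_mono[OF e(3)[of n], of "32 * M / R\<^sup>2 * (norm v)\<^sup>2"] M0 by simp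
      finally show "cmod (cnj (?G n y)) \<le> 2 * M * norm v / R + 32 * M / R\<^sup>2 * (norm v)\<^sup>2"
        by (simp only: complex_mod_cnj)
    next
      fix y assume y: "y \<in> ball b R"
      show "(\<lambda>n. cnj (?G n y)) \<longlonglongrightarrow> cnj (dd (\<lambda>z. L z y) z v)"
        by (intro tendsto_cnj diff_quotient_tendsto[OF hL[OF y] M[OF _ y] zR e(1) e(2) e(4)])
    qed (use R in auto)
  qed
  then show "hol_fun (\<lambda>w. cnj (dd (\<lambda>z. L z w) z v)) U" unfolding hol_fun_def by blast
next
  fix a b assume ab: "a \<in> U" "b \<in> U"
  obtain R M where R: "0 < R" "ball a R \<subseteq> U" "ball b R \<subseteq> U"
    and M: "\<And>y w. y \<in> ball a R \<Longrightarrow> w \<in> ball b R \<Longrightarrow> cmod (L y w) \<le> M"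
    by (rule sesqD3[OF L ab]; blast)
  have "cmod (dd (\<lambda>z. L z w) z v) \<le> 2 * M * norm v / R"
    if "z \<in> ball a (R/2)" and w: "w \<in> ball b (R/2)" for z w
  proof (rule cauchy_bound_at[OF _ _ that(1)])
    show "hol_fun (\<lambda>z. L z w) (ball a R)"
      by (rule hol_fun_subset[OF sesqD1[OF L] R(2)]) (use w R in auto)
  qed (use M w R in auto)
  then show "\<exists>R>0. \<exists>M. ball a R \<subseteq> U \<and> ball b R \<subseteq> U \<and>
      (\<forall>z\<in>ball a R. \<forall>w\<in>ball b R. cmod (dd (\<lambda>z. L z w) z v) \<le> M)"
    using R by (intro exI[of _ "R/2"] conjI exI[of _ "2 * M * norm v / R"]) auto
qed

text \<open>The increment along the diagonal is split into a step in the first variable with the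
  second argument at z + v and a step in the second variable with the first argument at z. The
  derivative in the first step belongs to the wrong second argument; that error is quadratic as
  well.\<close>

lemma sesq_diag_derivative:
  assumes L: "sesq L U" and z: "z \<in> U"
  shows "((\<lambda>z. L z z) has_derivative
     (\<lambda>h. dd (\<lambda>y. L y z) z h + cnj (dd (\<lambda>w. cnj (L z w)) z h))) (at z)"
proof -
  obtain R M where R: "0 < R" "ball z R \<subseteq> U"
    and M: "\<And>y w. y \<in> ball z R \<Longrightarrow> w \<in> ball z R \<Longrightarrow> cmod (L y w) \<le> M"
    by (rule sesqD3[OF L z z]; blast)
  have zR: "z \<in> ball z R" using R by simp
  have M0: "0 \<le> M" using M[OF zR zR] by (meson norm_ge_zero order_trans)
  have h1: "hol_fun (\<lambda>y. L y w) (ball z R)" if "w \<in> ball z R" for w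
    using sesqD1[OF L] that R by (meson hol_fun_subset subsetD)
  have h2: "hol_fun (\<lambda>w. cnj (L y w)) (ball z R)" if "y \<in> ball z R" for y
    using sesqD2[OF L] that R by (meson hol_fun_subset subsetD)
  show ?thesis
  \<comment> \<open>18 = 8 + 8 + 2: two Taylor remainders, and the change of the first derivative
    when its second argument moves from z + v to z.\<close>
  proof (rule has_derivative_quadratic[where r = "R/4" and C = "18 * M / R\<^sup>2"])
    show "bounded_linear (\<lambda>h. dd (\<lambda>y. L y z) z h + cnj (dd (\<lambda>w. cnj (L z w)) z h))"
      by (intro bounded_linear_add bounded_linear_compose[OF bounded_linear_cnj]
          dd_linear[OF h1[OF zR] zR] dd_linear[OF h2[OF zR] zR])
    fix v :: "complex ^ 'a" assume v: "norm v < R / 4"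
    let ?w = "z + v"
    have w: "?w \<in> ball z R" "?w \<in> ball z (R/2)" using v R by (auto simp: dist_norm)
    have A: "cmod (L ?w ?w - L z ?w - dd (\<lambda>y. L y ?w) z v) \<le> 8 * M / R\<^sup>2 * (norm v)\<^sup>2"
      by (rule second_order_bound[OF h1[OF w(1)] R(1) M[OF _ w(1)]]) (use v in auto)
    have B: "cmod (cnj (L z ?w) - cnj (L z z) - dd (\<lambda>w. cnj (L z w)) z v) \<le> 8 * M / R\<^sup>2 * (norm v)\<^sup>2"
      by (rule second_order_bound[OF h2[OF zR] R(1)]) (use v M zR in auto)
    then have B': "cmod (L z ?w - L z z - cnj (dd (\<lambda>w. cnj (L z w)) z v)) \<le> 8 * M / R\<^sup>2 * (norm v)\<^sup>2"
      using complex_mod_cnj[of "L z ?w - L z z - cnj (dd (\<lambda>w. cnj (L z w)) z v)"] by simp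
    \<comment> \<open>The difference of the two functions of y is of size |v| on the whole ball by
      the Lipschitz bound in the second variable; Cauchy's estimate contributes the other factor
      |v|.\<close>
    have "cmod (dd (\<lambda>y. L y ?w - L y z) z v) \<le> (2 * M / R * norm v) * norm v / R"
    proof (rule cauchy_bound)
      fix y assume y: "y \<in> ball z R"
      have "cmod (cnj (L y ?w) - cnj (L y z)) \<le> 2 * M / R * norm (?w - z)"
        by (rule hol_lipschitz[OF h2[OF y] _ w(2)]) (use M y R in auto)
      then show "cmod (L y ?w - L y z) \<le> 2 * M / R * norm v"
        using complex_mod_cnj[of "L y ?w - L y z"] by simp
    qed (use R in \<open>auto intro!: hol_fun_diff h1 w\<close>)
    then have "cmod (dd (\<lambda>y. L y ?w) z v - dd (\<lambda>y. L y z) z v) \<le> 2 * M / R\<^sup>2 * (norm v)\<^sup>2"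
      by (simp add: dd_diff[OF h1[OF w(1)] h1[OF zR] zR] power2_eq_square mult_ac)
    with A B' have "cmod ((L ?w ?w - L z ?w - dd (\<lambda>y. L y ?w) z v)
        + (L z ?w - L z z - cnj (dd (\<lambda>w. cnj (L z w)) z v))
        + (dd (\<lambda>y. L y ?w) z v - dd (\<lambda>y. L y z) z v))
        \<le> 8 * M / R\<^sup>2 * (norm v)\<^sup>2 + 8 * M / R\<^sup>2 * (norm v)\<^sup>2 + 2 * M / R\<^sup>2 * (norm v)\<^sup>2"
      by (intro order_trans[OF norm_triangle_ineq] add_mono)
    also have "\<dots> = 18 * M / R\<^sup>2 * (norm v)\<^sup>2" by (simp add: field_simps)
    finally show "cmod (L ?w ?w - L z z - (dd (\<lambda>y. L y z) z v + cnj (dd (\<lambda>w. cnj (L z w)) z v)))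
        \<le> 18 * M / R\<^sup>2 * (norm v)\<^sup>2"
      by (simp add: algebra_simps)
  qed (use R in auto)
qed

lemma sesq_diag_continuous: "sesq L U \<Longrightarrow> continuous_on U (\<lambda>z. L z z)"
  by (rule continuous_at_imp_continuous_on) (blast intro: has_derivative_continuous[OF sesq_diag_derivative])

section \<open>Change of variables\<close>

text \<open>The library states the change of variables theorem for \<open>real ^ 'm\<close> with a finite well-ordered index type \<open>'m\<close>.
  This is such an index type of the right size for an arbitrary Euclidean space.\<close>

typedef (overloaded) ('a::euclidean_space) bix = "{..<DIM('a)}"
  using DIM_positive by blast

instantiation bix :: (euclidean_space) wellorder
begin

definition less_eq_bix :: "'a bix \<Rightarrow> 'a bix \<Rightarrow> bool" where "less_eq_bix a b \<longleftrightarrow> Rep_bix a \<le> Rep_bix b"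
definition less_bix :: "'a bix \<Rightarrow> 'a bix \<Rightarrow> bool" where "less_bix a b \<longleftrightarrow> Rep_bix a < Rep_bix b"

instance
proof
  fix P :: "'a bix \<Rightarrow> bool" and a :: "'a bix"
  assume *: "\<And>x. (\<And>y. y < x \<Longrightarrow> P y) \<Longrightarrow> P x"
  show "P a"
    by (induction "Rep_bix a" arbitrary: a rule: less_induct) (metis * less_bix_def)
qed (auto simp: less_eq_bix_def less_bix_def Rep_bix_inject)

end

lemma UNIV_bix: "(UNIV :: 'a::euclidean_space bix set) = Abs_bix ` {..<DIM('a)}"
  by (metis type_definition.Abs_image type_definition_bix)

instance bix :: (euclidean_space) finite
  by standard (simp add: UNIV_bix)

lemma card_bix: "CARD('a::euclidean_space bix) = DIM('a)"
  unfolding UNIV_bix by (subst card_image) (auto simp: inj_on_def Abs_bix_inject)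

definition basis_of :: "'a::euclidean_space bix \<Rightarrow> 'a" where
  "basis_of = (SOME f. bij_betw f UNIV Basis)"

lemma bij_basis_of: "bij_betw basis_of UNIV (Basis :: 'a::euclidean_space set)"
proof -
  have "\<exists>f. bij_betw f (UNIV :: 'a bix set) (Basis :: 'a set)"
    by (rule finite_same_card_bij) (auto simp: card_bix)
  then show ?thesis unfolding basis_of_def by (rule someI_ex)
qed

lemma basis_of_Basis [simp]: "basis_of i \<in> Basis"
  using bij_basis_of unfolding bij_betw_def by blast

lemma inner_basis_of [simp]: "basis_of i \<bullet> basis_of j = (if i = j then 1 else 0)"
  using bij_basis_of by (auto simp: inner_Basis bij_betw_def dest: injD)

definition to_coords :: "'a::euclidean_space \<Rightarrow> real ^ 'a bix" where
  "to_coords x = (\<chi> i. x \<bullet> basis_of i)"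

definition of_coords :: "real ^ 'a bix \<Rightarrow> 'a::euclidean_space" where
  "of_coords y = (\<Sum>i\<in>UNIV. y $ i *\<^sub>R basis_of i)"

lemma to_of_coords [simp]: "to_coords (of_coords y) = y"
  by (simp add: to_coords_def of_coords_def vec_eq_iff inner_sum_left if_distrib cong: if_cong)

lemma of_to_coords [simp]: "of_coords (to_coords x) = x"
proof -
  have "of_coords (to_coords x) = (\<Sum>b\<in>Basis. (x \<bullet> b) *\<^sub>R b)"
    unfolding of_coords_def to_coords_def
    using sum.reindex_bij_betw[OF bij_basis_of, of "\<lambda>b. (x \<bullet> b) *\<^sub>R b"] by simp
  then show ?thesis by (simp add: euclidean_representation)
qed

lemma linear_to_coords: "linear to_coords"
  by (rule linearI) (auto simp: to_coords_def vec_eq_iff inner_add_left)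

lemma linear_of_coords: "linear of_coords"
  by (rule linearI) (auto simp: of_coords_def scaleR_add_left sum.distrib scaleR_sum_right)

lemma bounded_linear_to_coords: "bounded_linear to_coords"
  and bounded_linear_of_coords: "bounded_linear of_coords"
  using linear_to_coords linear_of_coords by (simp_all add: linear_conv_bounded_linear)

lemma to_coords_measurable [measurable]: "to_coords \<in> borel_measurable borel"
  and of_coords_measurable [measurable]: "of_coords \<in> borel_measurable borel"
  by (intro borel_measurable_continuous_onI linear_continuous_on bounded_linear_to_coords
      bounded_linear_of_coords)+

lemma lborel_distr_to_coords: "distr lborel borel (to_coords :: 'a::euclidean_space \<Rightarrow> _) = lborel"
proof (rule lborel_eqI[symmetric])
  fix l u :: "real ^ 'a bix"
  assume lu: "\<And>b. b \<in> Basis \<Longrightarrow> l \<bullet> b \<le> u \<bullet> b"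
  have bij_axis: "bij_betw (\<lambda>i. axis i 1) UNIV (Basis :: (real ^ 'a bix) set)"
    by (auto simp: bij_betw_def Basis_vec_def inj_on_def axis_eq_axis)
  have coord: "of_coords y \<bullet> basis_of i = y $ i" for y :: "real ^ 'a bix" and i
    using to_of_coords[of y] unfolding to_coords_def by (metis vec_lambda_beta)
  have in_B: "b \<in> Basis \<longleftrightarrow> (\<exists>i. b = basis_of i)" for b :: 'a
    using bij_basis_of unfolding bij_betw_def by (metis UNIV_I image_iff)
  have le: "l $ i \<le> u $ i" for i
    using lu[of "axis i 1"] by (simp add: inner_axis axis_in_Basis_iff)
  have "to_coords -` box l u = (box (of_coords l) (of_coords u) :: 'a set)"
    by (auto simp: mem_box_cart mem_box in_B to_coords_def) (metis coord basis_of_Basis)+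
  then have "emeasure (distr lborel borel to_coords) (box l u) = emeasure lborel (box (of_coords l) (of_coords u) :: 'a set)"
    by (subst emeasure_distr) auto
  also have "\<dots> = (\<Prod>b\<in>Basis. (of_coords u - of_coords l :: 'a) \<bullet> b)"
    by (rule emeasure_lborel_box) (auto simp: in_B coord le)
  also have "(\<Prod>b\<in>Basis. (of_coords u - of_coords l :: 'a) \<bullet> b) = (\<Prod>i\<in>UNIV. u $ i - l $ i)"
    by (subst prod.reindex_bij_betw[OF bij_basis_of, symmetric]) (simp add: inner_diff_left coord)
  also have "\<dots> = (\<Prod>b\<in>Basis. (u - l) \<bullet> b)"
    by (subst prod.reindex_bij_betw[OF bij_axis, symmetric]) (simp add: inner_axis)
  finally show "emeasure (distr lborel borel (to_coords :: 'a \<Rightarrow> _)) (box l u) = (\<Prod>b\<in>Basis. (u - l) \<bullet> b)" .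
qed simp

section \<open>Volume factors of real-linear maps\<close>

definition vol_factor :: "('a::euclidean_space \<Rightarrow> 'a) \<Rightarrow> real" where
  "vol_factor L = \<bar>det (matrix (to_coords \<circ> L \<circ> of_coords))\<bar>"

lemma vol_factor_nonneg: "0 \<le> vol_factor L"
  by (simp add: vol_factor_def)

lemma vol_factor_comp:
  assumes "linear L" "linear M"
  shows "vol_factor (L \<circ> M) = vol_factor L * vol_factor M"
proof -
  have "to_coords \<circ> (L \<circ> M) \<circ> of_coords = (to_coords \<circ> L \<circ> of_coords) \<circ> (to_coords \<circ> M \<circ> of_coords)"
    by (auto simp: fun_eq_iff)
  moreover have "linear (to_coords \<circ> L \<circ> of_coords)" "linear (to_coords \<circ> M \<circ> of_coords)"
    using assms by (auto intro!: linear_compose linear_to_coords linear_of_coords)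
  ultimately show ?thesis
    unfolding vol_factor_def by (simp add: matrix_compose det_mul abs_mult)
qed

lemma vol_factor_id: "vol_factor (\<lambda>x. x) = 1"
proof -
  have "to_coords \<circ> (\<lambda>x::'a. x) \<circ> of_coords = id" by (auto simp: fun_eq_iff)
  then show ?thesis unfolding vol_factor_def by (simp add: matrix_id_mat_1)
qed

lemma vol_factor_involution:
  assumes "linear L" "\<And>x. L (L x) = x"
  shows "vol_factor L = 1"
proof -
  have "vol_factor L * vol_factor L = 1"
    using vol_factor_comp[OF assms(1,1), symmetric] assms(2) vol_factor_id by (simp add: o_def)
  then show ?thesis using vol_factor_nonneg[of L] by (simp add: square_eq_1_iff)
qed

text \<open>The measure of an injective differentiable image, carried over from real coordinate
  space by \<open>to_coords\<close>, which preserves Lebesgue measure. Measurability and finiteness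
  permit the passage from the gauge integral to the nonnegative Lebesgue integral.\<close>

proposition emeasure_differentiable_image:
  fixes g :: "'a::euclidean_space \<Rightarrow> 'a"
  assumes S: "S \<in> sets borel" and gS: "g ` S \<in> sets borel" and fin: "emeasure lborel (g ` S) < \<infinity>"
    and der: "\<And>x. x \<in> S \<Longrightarrow> (g has_derivative g' x) (at x)" and inj: "inj_on g S"
    and meas: "(\<lambda>x. vol_factor (g' x) * indicator S x) \<in> borel_measurable borel"
  shows "(\<integral>\<^sup>+x. ennreal (vol_factor (g' x) * indicator S x) \<partial>lborel) = emeasure lborel (g ` S)"
proof -
  let ?f = "\<lambda>y. to_coords (g (of_coords y))"
  let ?f' = "\<lambda>y. to_coords \<circ> g' (of_coords y) \<circ> of_coords"
  let ?S = "to_coords ` S"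
  have img: "to_coords ` A = of_coords -` A" for A :: "'a set"
    by (auto simp: image_iff) (metis to_of_coords)
  have SB: "?S \<in> sets borel" "to_coords ` g ` S \<in> sets borel"
    unfolding img using measurable_sets[OF of_coords_measurable S] measurable_sets[OF of_coords_measurable gS] by simp_all
  have fS: "?f ` ?S = to_coords ` g ` S" by (auto simp: image_image)
  have em: "emeasure lborel (to_coords ` A) = emeasure lborel A" if "A \<in> sets borel" for A :: "'a set"
  proof -
    have "emeasure lborel (to_coords ` A) = emeasure (distr lborel borel to_coords) (to_coords ` A)"
      by (simp add: lborel_distr_to_coords)
    also have "\<dots> = emeasure lborel (to_coords -` (to_coords ` A))"
      using that measurable_sets[OF of_coords_measurable that] by (subst emeasure_distr) (auto simp: img)
    also have "to_coords -` (to_coords ` A) = A"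
      by (auto simp: image_iff) (metis of_to_coords)
    finally show ?thesis .
  qed
  have "((\<lambda>y. \<bar>det (matrix (?f' y))\<bar>) has_integral measure lebesgue (?f ` ?S)) ?S"
  proof (rule has_measure_differentiable_image[THEN iffD1])
    show "?S \<in> sets lebesgue" using SB by auto
    fix y assume "y \<in> ?S"
    then have y: "of_coords y \<in> S" by auto
    have "((\<lambda>y. g (of_coords y)) has_derivative (\<lambda>h. g' (of_coords y) (of_coords h))) (at y)"
      using has_derivative_compose[OF bounded_linear_imp_has_derivative[OF bounded_linear_of_coords] der[OF y]] .
    from has_derivative_compose[OF this bounded_linear_imp_has_derivative[OF bounded_linear_to_coords]]
    show "(?f has_derivative ?f' y) (at y within ?S)"
      by (simp add: o_def has_derivative_at_withinI)
  next
    show "inj_on ?f ?S"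
      using inj by (auto simp: inj_on_def) (metis of_to_coords)
    show "?f ` ?S \<in> lmeasurable \<and> measure lebesgue (?f ` ?S) = measure lebesgue (?f ` ?S)"
      unfolding fS using SB fin em[OF gS] by (auto intro!: fmeasurableI)
  qed
  then have "((\<lambda>y. vol_factor (g' (of_coords y)) * indicator S (of_coords y)) has_integral measure lebesgue (?f ` ?S)) UNIV"
    unfolding vol_factor_def has_integral_restrict_UNIV[symmetric, of _ _ ?S]
    by (rule has_integral_eq[rotated]) (auto simp: img)
  moreover have "measure lebesgue (?f ` ?S) = measure lborel (g ` S)"
    unfolding fS measure_def using em[OF gS] SB by (simp add: emeasure_completion)
  moreover have [measurable]: "(\<lambda>y. vol_factor (g' (of_coords y)) * indicator S (of_coords y)) \<in> borel_measurable borel"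
    using measurable_compose[OF of_coords_measurable meas] by simp
  ultimately have "(\<integral>\<^sup>+y. ennreal (vol_factor (g' (of_coords y)) * indicator S (of_coords y)) \<partial>lborel) = ennreal (measure lborel (g ` S))"
    by (intro nn_integral_has_integral_lborel) (auto simp: vol_factor_nonneg)
  also have "\<dots> = emeasure lborel (g ` S)" using fin by (simp add: emeasure_eq_ennreal_measure)
  also have "(\<integral>\<^sup>+y. ennreal (vol_factor (g' (of_coords y)) * indicator S (of_coords y)) \<partial>lborel)
      = (\<integral>\<^sup>+y. ennreal (vol_factor (g' (of_coords y)) * indicator S (of_coords y)) \<partial>distr lborel borel to_coords)"
    by (simp add: lborel_distr_to_coords)
  also have "\<dots> = (\<integral>\<^sup>+x. ennreal (vol_factor (g' x) * indicator S x) \<partial>lborel)"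
    by (subst nn_integral_distr) auto
  finally show ?thesis .
qed

section \<open>Complex matrices scale volume by the squared modulus of the determinant\<close>

lemma linear_matrix_vector: "linear (\<lambda>v. (A :: complex ^ 'n ^ 'm) *v v)"
proof -
  have "A *v (r *\<^sub>R v) = r *\<^sub>R (A *v v)" for r v
    by (simp add: vec_eq_iff matrix_vector_mult_def scaleR_sum_right)
  then show ?thesis by (intro linearI) (simp_all add: matrix_vector_right_distrib)
qed

lemma linear_shear: "linear (\<lambda>v. v + (v $ k) *s (u :: complex ^ 'n))"
  by (rule linearI) (auto simp: vec_eq_iff algebra_simps)

lemma linear_cscale: "linear (\<lambda>v :: complex ^ 'n. \<chi> j. if j = k then c * v $ j else v $ j)"
  by (rule linearI) (auto simp: vec_eq_iff algebra_simps)

text \<open>Conjugation by \<open>v\<^sub>k \<mapsto> - v\<^sub>k\<close> inverts a shear.\<close>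

lemma vol_factor_shear:
  assumes u: "u $ k = 0"
  shows "vol_factor (\<lambda>v. v + (v $ k) *s (u :: complex ^ 'n)) = 1"
proof -
  let ?X = "\<lambda>v :: complex ^ 'n. v + (v $ k) *s u"
  let ?Y = "\<lambda>v :: complex ^ 'n. v + (v $ k) *s (- u)"
  let ?D = "\<lambda>v :: complex ^ 'n. \<chi> j. if j = k then (-1) * v $ j else v $ j"
  have D: "vol_factor ?D = 1"
    by (rule vol_factor_involution[OF linear_cscale]) (simp add: vec_eq_iff)
  have "?D \<circ> ?X \<circ> ?D = ?Y"
    using u by (auto simp: fun_eq_iff vec_eq_iff)
  moreover have "vol_factor (?D \<circ> ?X \<circ> ?D) = vol_factor ?D * vol_factor ?X * vol_factor ?D"
    by (simp only: vol_factor_comp linear_compose linear_shear linear_cscale)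
  ultimately have YX: "vol_factor ?Y = vol_factor ?X" by (simp only: D mult_1 mult_1_right)
  have "?X \<circ> ?Y = (\<lambda>v. v)"
    using u by (auto simp: fun_eq_iff vec_eq_iff)
  moreover have "vol_factor (?X \<circ> ?Y) = vol_factor ?X * vol_factor ?Y"
    by (simp only: vol_factor_comp linear_shear)
  ultimately have "vol_factor ?X * vol_factor ?X = 1" by (simp only: YX vol_factor_id)
  then show ?thesis using vol_factor_nonneg[of ?X] unfolding square_eq_1_iff by linarith
qed

text \<open>In real coordinates the map is diagonal, with r at exactly the two basis vectors
  \<open>axis k 1\<close> and \<open>axis k \<i>\<close>; hence the square. Scaling by a complex
  number is reduced to this case.\<close>

lemma vol_factor_real_scale:
  "vol_factor (\<lambda>v :: complex ^ 'n. \<chi> j. if j = k then of_real r * v $ j else v $ j) = r\<^sup>2"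
proof -
  let ?L = "\<lambda>v :: complex ^ 'n. \<chi> j. if j = k then of_real r * v $ j else v $ j"
  let ?T = "{axis k 1, axis k \<i>} :: (complex ^ 'n) set"
  have Lb: "?L b = (if b \<in> ?T then r else 1) *\<^sub>R b" if "b \<in> Basis" for b
  proof -
    obtain i u where b: "b = axis i u" "u = 1 \<or> u = \<i>"
      using \<open>b \<in> Basis\<close> unfolding Basis_vec_def Basis_complex_def by blast
    have iff: "b \<in> ?T \<longleftrightarrow> i = k" using b by (auto simp: axis_eq_axis)
    have "?L b = (if i = k then r else 1) *\<^sub>R b"
      unfolding vec_eq_iff b(1) by (auto simp: axis_def scaleR_conv_of_real[symmetric])
    then show ?thesis by (simp only: iff)
  qed
  have M: "matrix (to_coords \<circ> ?L \<circ> of_coords) $ i $ j = (if i = j then (if basis_of i \<in> ?T then r else 1) else 0)" for i j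
  proof -
    have "of_coords (axis j 1) = (basis_of j :: complex ^ 'n)"
      by (simp add: of_coords_def axis_def if_distrib[of "\<lambda>c. c *\<^sub>R _"] cong: if_cong)
    then show ?thesis by (simp add: matrix_def to_coords_def Lb)
  qed
  have "det (matrix (to_coords \<circ> ?L \<circ> of_coords)) = (\<Prod>i\<in>UNIV. if basis_of i \<in> ?T then r else 1)"
    by (subst det_diagonal) (auto simp: M)
  also have "\<dots> = (\<Prod>b\<in>Basis. if b \<in> ?T then r else 1)"
    by (rule prod.reindex_bij_betw[OF bij_basis_of])
  also have "\<dots> = (\<Prod>b\<in>?T. r)"
    by (rule prod.mono_neutral_cong_right) (auto simp: axis_in_Basis_iff Basis_complex_def)
  also have "\<dots> = r\<^sup>2"
    by (simp add: axis_eq_axis power2_eq_square)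
  finally show ?thesis by (simp add: vol_factor_def)
qed

text \<open>Complex conjugation intertwines scaling by \<open>c\<close> and by \<open>cnj c\<close>, and their composite is real.\<close>

lemma vol_factor_cscale:
  "vol_factor (\<lambda>v :: complex ^ 'n. \<chi> j. if j = k then c * v $ j else v $ j) = (cmod c)\<^sup>2"
proof -
  let ?D = "\<lambda>c. \<lambda>v :: complex ^ 'n. \<chi> j. if j = k then c * v $ j else v $ j"
  let ?C = "\<lambda>v :: complex ^ 'n. \<chi> j. cnj (v $ j)"
  have C: "linear ?C" by (rule linearI) (auto simp: vec_eq_iff)
  have C1: "vol_factor ?C = 1" by (rule vol_factor_involution[OF C]) (simp add: vec_eq_iff)
  have "?C \<circ> ?D c \<circ> ?C = ?D (cnj c)" by (auto simp: fun_eq_iff vec_eq_iff)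
  then have "vol_factor (?D (cnj c)) = vol_factor (?D c)"
    using vol_factor_comp[OF linear_compose[OF linear_cscale[of k c] C] C] vol_factor_comp[OF C linear_cscale[of k c]] C1
    by simp
  moreover have "?D c \<circ> ?D (cnj c) = ?D (of_real ((cmod c)\<^sup>2))"
    by (auto simp: fun_eq_iff vec_eq_iff complex_norm_square mult.assoc[symmetric] simp del: of_real_power)
  then have "vol_factor (?D c) * vol_factor (?D (cnj c)) = ((cmod c)\<^sup>2)\<^sup>2"
    using vol_factor_comp[OF linear_cscale[of k c] linear_cscale[of k "cnj c"]] vol_factor_real_scale[of k "(cmod c)\<^sup>2"]
    by metis
  ultimately have "(vol_factor (?D c))\<^sup>2 = ((cmod c)\<^sup>2)\<^sup>2" by (simp add: power2_eq_square)
  then show ?thesis by (rule power2_eq_imp_eq) (auto simp: vol_factor_nonneg)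
qed

text \<open>The identity with column k replaced by c: the elementary matrix of the column
  elimination below.\<close>

definition col_matrix :: "'n \<Rightarrow> complex ^ 'n \<Rightarrow> complex ^ 'n ^ 'n" where
  "col_matrix k c = (\<chi> i j. if j = k then c $ i else mat 1 $ i $ j)"

lemma col_matrix_mult: "col_matrix k c *v v = v + (v $ k) *s (c - axis k 1)"
proof -
  have "(col_matrix k c *v v) $ i = (v + (v $ k) *s (c - axis k 1)) $ i" for i
  proof -
    have "(col_matrix k c *v v) $ i = (\<Sum>j\<in>UNIV. (if j = k then c $ i else mat 1 $ i $ j) * v $ j)"
      by (simp add: matrix_vector_mult_def col_matrix_def)
    also have "\<dots> = (\<Sum>j\<in>UNIV. mat 1 $ i $ j * v $ j + (if j = k then (c $ i - mat 1 $ i $ k) * v $ k else 0))"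
      by (rule sum.cong) (auto simp: algebra_simps)
    also have "\<dots> = (mat 1 *v v) $ i + (c $ i - mat 1 $ i $ k) * v $ k"
      by (simp add: sum.distrib matrix_vector_mult_def)
    also have "mat 1 *v v = v" by simp
    finally show ?thesis by (simp add: mat_def axis_def algebra_simps)
  qed
  then show ?thesis by (simp add: vec_eq_iff)
qed

lemma det_col_matrix: "det (col_matrix k c) = c $ k"
  using cramer_lemma[where A = "mat 1" and x = c and k = k] unfolding matrix_vector_mul_lid
  by (simp add: col_matrix_def)

text \<open>Scaling coordinate k by its pivot and then shearing along a vector with vanishing k-th
  entry gives this matrix, and the shear preserves volume.\<close>

lemma vol_factor_col_matrix:
  fixes c :: "complex ^ 'n"
  assumes "c $ k \<noteq> 0"
  shows "vol_factor (\<lambda>v. col_matrix k c *v v) = (cmod (c $ k))\<^sup>2"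
proof -
  let ?D = "\<lambda>v :: complex ^ 'n. \<chi> j. if j = k then c $ k * v $ j else v $ j"
  let ?u = "inverse (c $ k) *s (c - (c $ k) *s axis k 1)"
  let ?X = "\<lambda>v :: complex ^ 'n. v + (v $ k) *s ?u"
  have "(\<lambda>v. col_matrix k c *v v) = ?X \<circ> ?D"
    using assms by (auto simp: fun_eq_iff vec_eq_iff col_matrix_mult axis_def field_simps)
  then have "vol_factor (\<lambda>v. col_matrix k c *v v) = vol_factor ?X * vol_factor ?D"
    by (simp only: vol_factor_comp linear_shear linear_cscale)
  also have "vol_factor ?X = 1" by (rule vol_factor_shear) (simp add: axis_def)
  finally show ?thesis by (simp add: vol_factor_cscale)
qed

text \<open>Gaussian elimination: \<open>S\<close> contains the columns that are not yet unit vectors.\<close>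

theorem vol_factor_matrix:
  fixes A :: "complex ^ 'n ^ 'n"
  assumes "det A \<noteq> 0"
  shows "vol_factor (\<lambda>v. A *v v) = (cmod (det A))\<^sup>2"
proof -
  let ?P = "\<lambda>A :: complex ^ 'n ^ 'n. vol_factor (\<lambda>v. A *v v) = (cmod (det A))\<^sup>2"
  have mult: "?P (A ** B)" if "?P A" "?P B" for A B
  proof -
    have "(\<lambda>v. (A ** B) *v v) = (\<lambda>v. A *v v) \<circ> (\<lambda>v. B *v v)"
      by (auto simp: fun_eq_iff matrix_vector_mul_assoc)
    then show ?thesis
      by (simp only: vol_factor_comp linear_matrix_vector that det_mul norm_mult power_mult_distrib)
  qed
  have col: "?P (col_matrix k c)" if "c $ k \<noteq> 0" for k c
    using vol_factor_col_matrix[OF that] by (simp add: det_col_matrix)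
  have "\<forall>A. det A \<noteq> 0 \<longrightarrow> (\<forall>j. j \<notin> S \<longrightarrow> A *v axis j 1 = axis j 1) \<longrightarrow> ?P A" if "finite S" for S
    using that
  proof (induction S)
    case empty
    show ?case
    proof (intro allI impI)
      fix A :: "complex ^ 'n ^ 'n" assume "\<forall>j. j \<notin> {} \<longrightarrow> A *v axis j 1 = axis j 1"
      then have "A = mat 1"
        by (simp add: vec_eq_iff mat_def axis_def matrix_vector_mult_def if_distrib cong: if_cong)
      then show "?P A" by (simp add: vol_factor_id)
    qed
  next
    case (insert k S)
    \<comment> \<open>With a nonzero pivot, splitting off the column matrix built from column k of A
      leaves a factor whose k-th column is a unit vector too, so the induction hypothesis covers
      it.\<close>
    have step: "?P A" if A: "det A \<noteq> 0" "\<forall>j. j \<notin> insert k S \<longrightarrow> A *v axis j 1 = axis j 1"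
      and kk: "A $ k $ k \<noteq> 0" for A :: "complex ^ 'n ^ 'n"
    proof -
      let ?c = "A *v axis k 1"
      have ck: "?c $ k = A $ k $ k"
        by (simp add: matrix_vector_mult_def axis_def if_distrib cong: if_cong)
      let ?L = "col_matrix k ?c"
      have "det ?L \<noteq> 0" using kk ck by (simp add: det_col_matrix)
      then obtain M where M: "?L ** M = mat 1" "M ** ?L = mat 1"
        by (metis invertible_det_nz invertible_def)
      have AM: "A = ?L ** (M ** A)" by (simp add: matrix_mul_assoc M)
      have cancel: "M *v (?L *v v) = v" for v by (simp add: matrix_vector_mul_assoc M)
      have "det (M ** A) \<noteq> 0" using A(1) AM by (metis det_mul mult_zero_right)
      moreover have "(M ** A) *v axis j 1 = axis j 1" if "j \<notin> S" for j
      proof (cases "j = k")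
        case True
        have "?L *v axis k 1 = ?c" by (simp add: col_matrix_mult axis_def vec_eq_iff)
        then show ?thesis using cancel[of "axis k 1"] True by (simp add: matrix_vector_mul_assoc)
      next
        case False
        then have "A *v axis j 1 = axis j 1" using A(2) that by auto
        moreover have "?L *v axis j 1 = axis j 1" using False by (simp add: col_matrix_mult axis_def vec_eq_iff)
        ultimately show ?thesis using cancel[of "axis j 1"] by (simp add: matrix_vector_mul_assoc[symmetric])
      qed
      ultimately have "?P (M ** A)" using insert.IH by blast
      moreover have "?P ?L" using col kk ck by simp
      ultimately show ?thesis using mult AM by metis
    qed
    show ?case
    proof (intro allI impI)
      fix A :: "complex ^ 'n ^ 'n"
      assume A: "det A \<noteq> 0" "\<forall>j. j \<notin> insert k S \<longrightarrow> A *v axis j 1 = axis j 1"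
      show "?P A"
      proof (cases "A $ k $ k = 0")
        case False
        then show ?thesis using step A by blast
      next
        case True
        \<comment> \<open>Otherwise column k would be a combination of unit vectors that A fixes.
          Then A would take the same value at this combination and at \<open>axis k 1\<close>,
          against injectivity.\<close>
        have "\<exists>m\<in>S. A $ m $ k \<noteq> 0"
        proof (rule ccontr)
          assume no: "\<not> ?thesis"
          let ?v = "\<Sum>j\<in>-insert k S. A $ j $ k *s axis j (1::complex)"
          have ak: "A *v axis k 1 = ?v"
            using no True
            by (auto simp: vec_eq_iff matrix_vector_mult_def axis_def if_distrib sum.delta cong: if_cong)
          have "A *v ?v = (\<Sum>j\<in>-insert k S. A $ j $ k *s (A *v axis j (1::complex)))"
            by (simp add: linear_sum[OF linear_matrix_vector] vector_scalar_commute)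
          also have "\<dots> = ?v" using A(2) by (intro sum.cong) auto
          finally have "A *v axis k 1 = A *v ?v" using ak by simp
          then have "axis k 1 = ?v"
            using A(1) by (metis invertible_det_nz invertible_def matrix_vector_mul_assoc matrix_vector_mul_lid)
          then have "axis k (1::complex) $ k = ?v $ k" by simp
          then show False by (simp add: axis_def if_distrib sum.delta cong: if_cong)
        qed
        then obtain m where m: "m \<in> S" "A $ m $ k \<noteq> 0" by blast
        then have mk: "m \<noteq> k" using insert by auto
        \<comment> \<open>Left multiplication by \<open>?X 1\<close> adds row m to row k, which
          makes the pivot nonzero. As m lies in S, the columns that are already unit vectors have
          entry 0 in row m and are unchanged.\<close>
        let ?X = "\<lambda>a. col_matrix m (axis m 1 + a *s axis k (1::complex))"
        have X: "?X a *v v = v + (v $ m * a) *s axis k 1" for a v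
          by (simp add: col_matrix_mult vec_eq_iff)
        have "?X (-1) *v (?X 1 *v v) = v" for v
          unfolding X using mk by (simp add: axis_def vec_eq_iff)
        then have "?X (-1) ** ?X 1 = mat 1"
          by (subst matrix_eq) (simp only: matrix_vector_mul_assoc[symmetric] matrix_vector_mul_lid simp_thms)
        then have A': "A = ?X (-1) ** (?X 1 ** A)" by (simp add: matrix_mul_assoc)
        have PX: "?P (?X a)" for a using mk by (intro col) (simp add: axis_def)
        have "?P (?X 1 ** A)"
        proof (rule step)
          show "det (?X 1 ** A) \<noteq> 0" using A(1) A' by (metis det_mul mult_zero_right)
          show "\<forall>j. j \<notin> insert k S \<longrightarrow> ?X 1 ** A *v axis j 1 = axis j 1"
            unfolding matrix_vector_mul_assoc[symmetric] X using A(2) m by (auto simp: axis_def vec_eq_iff)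
          have "(?X 1 ** A) $ k $ k = ((?X 1 ** A) *v axis k 1) $ k"
            by (simp add: matrix_vector_mult_def axis_def if_distrib cong: if_cong)
          also have "\<dots> = A $ k $ k + A $ m $ k"
            unfolding matrix_vector_mul_assoc[symmetric] X
            by (simp add: matrix_vector_mult_def axis_def if_distrib cong: if_cong)
          finally show "(?X 1 ** A) $ k $ k \<noteq> 0" using True m by simp
        qed
        then show ?thesis using mult PX A' by metis
      qed
    qed
  qed
  from this[of UNIV] show ?thesis using assms by simp
qed

section \<open>Automorphisms of bounded domains\<close>

abbreviation jac :: "(complex ^ 'n \<Rightarrow> complex ^ 'n) \<Rightarrow> complex ^ 'n \<Rightarrow> complex" where
  "jac \<psi> z \<equiv> det (complex_jacobian \<psi> z)"

lemma matrix_mult_axis: "((A :: complex ^ 'n ^ 'm) *v axis j 1) $ i = A $ i $ j"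
  by (simp add: matrix_vector_mult_def axis_def if_distrib cong: if_cong)

lemma hol_map_has_derivative:
  fixes \<psi> :: "complex ^ 'n \<Rightarrow> complex ^ 'n"
  assumes "hol_map \<psi> U" "z \<in> U"
  shows "(\<psi> has_derivative (\<lambda>v. complex_jacobian \<psi> z *v v)) (at z)"
proof -
  obtain A :: "complex ^ 'n ^ 'n" where A: "(\<psi> has_derivative (\<lambda>v. A *v v)) (at z)"
    using assms unfolding hol_map_def by blast
  then have "frechet_derivative \<psi> (at z) = (\<lambda>v. A *v v)" using frechet_derivative_at by metis
  then have "complex_jacobian \<psi> z = A"
    by (simp add: complex_jacobian_def vec_eq_iff matrix_mult_axis)
  then show ?thesis using A by simp
qed

lemma hol_fun_component: "hol_map \<psi> U \<Longrightarrow> hol_fun (\<lambda>z. \<psi> z $ i) U"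
  using hol_fun_comp[OF hol_fun_coord[where U = UNIV]] by blast

lemma hol_map_continuous: "hol_map \<psi> U \<Longrightarrow> continuous_on U (\<psi> :: complex ^ 'n \<Rightarrow> complex ^ 'n)"
  by (rule continuous_at_imp_continuous_on) (blast intro: has_derivative_continuous[OF hol_map_has_derivative])

lemma hol_fun_jacobian_entry:
  fixes \<psi> :: "complex ^ 'n \<Rightarrow> complex ^ 'n"
  assumes "hol_map \<psi> U" "open U"
  shows "hol_fun (\<lambda>z. complex_jacobian \<psi> z $ i $ j) U"
proof (rule hol_fun_cong[OF assms(2) hol_fun_dd[OF hol_fun_component[OF assms(1)] assms(2)]])
  fix z assume "z \<in> U"
  then have "((\<lambda>z. \<psi> z $ i) has_derivative (\<lambda>v. (complex_jacobian \<psi> z *v v) $ i)) (at z)"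
    using bounded_linear.has_derivative[OF bounded_linear_vec_nth hol_map_has_derivative[OF assms(1)]] by blast
  from dd_eqI[OF this] show "dd (\<lambda>z. \<psi> z $ i) z (axis j 1) = complex_jacobian \<psi> z $ i $ j"
    by (simp add: matrix_mult_axis)
qed

lemma hol_fun_jac: "hol_map \<psi> U \<Longrightarrow> open U \<Longrightarrow> hol_fun (jac \<psi>) U"
  unfolding det_def
  by (intro hol_fun_sum hol_fun_mult hol_fun_const hol_fun_prod hol_fun_jacobian_entry)

locale automorphism =
  fixes U :: "(complex ^ 'n) set" and \<psi>
  assumes open_U: "open U" and bounded_U: "bounded U" and bihol: "biholomorphism \<psi> U U"
begin

abbreviation "\<phi> \<equiv> inv_into U \<psi>"

lemma bij: "bij_betw \<psi> U U" and hol: "hol_map \<psi> U" and hol_inv: "hol_map \<phi> U"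
  using bihol by (auto simp: biholomorphism_def)

lemma maps_to: "z \<in> U \<Longrightarrow> \<psi> z \<in> U" and inv_maps_to: "z \<in> U \<Longrightarrow> \<phi> z \<in> U"
  and inv_left [simp]: "z \<in> U \<Longrightarrow> \<phi> (\<psi> z) = z" and inv_right [simp]: "z \<in> U \<Longrightarrow> \<psi> (\<phi> z) = z"
  using bij by (auto simp: bij_betw_apply bij_betw_inv_into_left bij_betw_inv_into_right
      bij_betw_apply[OF bij_betw_inv_into])

lemma image_U: "\<psi> ` U = U"
  using bij by (simp add: bij_betw_def)

lemma derivative: "z \<in> U \<Longrightarrow> (\<psi> has_derivative (\<lambda>v. complex_jacobian \<psi> z *v v)) (at z)"
  by (rule hol_map_has_derivative[OF hol])

lemma jac_inverse:
  assumes z: "z \<in> U"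
  shows "complex_jacobian \<phi> (\<psi> z) ** complex_jacobian \<psi> z = mat 1"
proof -
  have "((\<lambda>x. \<phi> (\<psi> x)) has_derivative (\<lambda>v. complex_jacobian \<phi> (\<psi> z) *v (complex_jacobian \<psi> z *v v))) (at z)"
    by (rule has_derivative_compose[OF derivative[OF z] hol_map_has_derivative[OF hol_inv maps_to[OF z]]])
  then have "((\<lambda>x. x) has_derivative (\<lambda>v. complex_jacobian \<phi> (\<psi> z) *v (complex_jacobian \<psi> z *v v))) (at z)"
    by (rule has_derivative_transform_within_open[OF _ open_U z]) simp
  then have "(\<lambda>v. complex_jacobian \<phi> (\<psi> z) *v (complex_jacobian \<psi> z *v v)) = (\<lambda>v. v)"
    using has_derivative_unique has_derivative_ident by blast
  then have "complex_jacobian \<phi> (\<psi> z) *v (complex_jacobian \<psi> z *v v) = v" for v by meson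
  then show ?thesis by (simp add: matrix_eq matrix_vector_mul_assoc[symmetric] del: matrix_vector_mul_assoc)
qed

lemma jac_nz: "z \<in> U \<Longrightarrow> jac \<psi> z \<noteq> 0"
  using jac_inverse[of z] det_mul[of "complex_jacobian \<phi> (\<psi> z)" "complex_jacobian \<psi> z"] by auto

lemma hol_jac: "hol_fun (jac \<psi>) U"
  by (rule hol_fun_jac[OF hol open_U])

lemma continuous: "continuous_on U \<psi>" and continuous_inv: "continuous_on U \<phi>"
  using hol hol_inv hol_map_continuous by auto

lemma U_borel [measurable]: "U \<in> sets borel"
  using open_U by simp

lemma measurable_psi [measurable]: "\<psi> \<in> measurable (restrict_space lborel U) (restrict_space lborel U)"
proof (rule measurable_restrict_space2)
  show "\<psi> \<in> space (restrict_space lborel U) \<rightarrow> U" using maps_to by (auto simp: space_restrict_space)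
  have "\<psi> \<in> borel_measurable (restrict_space borel U)"
    by (rule borel_measurable_continuous_on_restrict[OF continuous])
  then show "\<psi> \<in> measurable (restrict_space lborel U) lborel"
    by (simp cong: measurable_cong_sets sets_restrict_space_cong)
qed

lemma jac_measurable [measurable]: "jac \<psi> \<in> borel_measurable (restrict_space lborel U)"
proof -
  have "jac \<psi> \<in> borel_measurable (restrict_space borel U)"
    by (rule borel_measurable_continuous_on_restrict[OF hol_fun_continuous[OF hol_jac]])
  then show ?thesis
    by (simp cong: measurable_cong_sets sets_restrict_space_cong)
qed

lemma sets_MI: "A \<in> sets (restrict_space lborel U) \<longleftrightarrow> A \<subseteq> U \<and> A \<in> sets borel"
  by (subst sets_restrict_space_iff) auto

text \<open>The real Jacobian of a holomorphic map is the squared modulus of its complex one.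
  Boundedness of U makes the image measure finite.\<close>

lemma image_measure:
  assumes S: "S \<in> sets (restrict_space lborel U)"
  shows "(\<integral>\<^sup>+x\<in>S. ennreal ((cmod (jac \<psi> x))\<^sup>2) \<partial>restrict_space lborel U) = emeasure lborel (\<psi> ` S)"
proof -
  have SU: "S \<subseteq> U" "S \<in> sets borel" using S sets_MI by auto
  have "\<psi> ` S = \<phi> -` S \<inter> U"
    using SU inv_maps_to maps_to by (auto simp: image_iff) (metis inv_right)
  moreover have "\<phi> -` S \<inter> U \<in> sets borel"
  proof -
    have "\<phi> \<in> borel_measurable (restrict_space borel U)"
      by (rule borel_measurable_continuous_on_restrict[OF continuous_inv])
    from measurable_sets[OF this SU(2)] show ?thesis
      by (auto simp: space_restrict_space sets_restrict_space_iff)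
  qed
  ultimately have im: "\<psi> ` S \<in> sets borel" by simp
  have vf: "vol_factor (\<lambda>v. complex_jacobian \<psi> x *v v) = (cmod (jac \<psi> x))\<^sup>2" if "x \<in> U" for x
    by (rule vol_factor_matrix[OF jac_nz[OF that]])
  have eq: "vol_factor (\<lambda>v. complex_jacobian \<psi> x *v v) * indicator S x = (cmod (jac \<psi> x))\<^sup>2 * indicator S x" for x
    using vf SU by (auto simp: indicator_def)
  have "(\<integral>\<^sup>+x. ennreal (vol_factor (\<lambda>v. complex_jacobian \<psi> x *v v) * indicator S x) \<partial>lborel) = emeasure lborel (\<psi> ` S)"
  proof (rule emeasure_differentiable_image[OF SU(2) im])
    have "\<psi> ` S \<subseteq> U" using SU maps_to by auto
    then have "bounded (\<psi> ` S)" using bounded_U bounded_subset by blast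
    then show "emeasure lborel (\<psi> ` S) < \<infinity>" by (rule emeasure_bounded_finite)
    show "(\<psi> has_derivative (\<lambda>v. complex_jacobian \<psi> x *v v)) (at x)" if "x \<in> S" for x
      using derivative that SU by blast
    show "inj_on \<psi> S" using bij SU by (meson bij_betw_imp_inj_on inj_on_subset)
    have "(\<lambda>x. indicator U x *\<^sub>R (cmod (jac \<psi> x))\<^sup>2) \<in> borel_measurable borel"
      by (rule borel_measurable_restrict_space_iff[THEN iffD1])
         (use jac_measurable in \<open>auto cong: measurable_cong_sets sets_restrict_space_cong\<close>)
    then have "(\<lambda>x. (indicator U x *\<^sub>R (cmod (jac \<psi> x))\<^sup>2) * indicator S x) \<in> borel_measurable borel"
      using SU(2) by measurable
    also have "(\<lambda>x. (indicator U x *\<^sub>R (cmod (jac \<psi> x))\<^sup>2) * indicator S x)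
      = (\<lambda>x. vol_factor (\<lambda>v. complex_jacobian \<psi> x *v v) * indicator S x)"
      unfolding eq using SU by (auto simp: indicator_def fun_eq_iff)
    finally show "(\<lambda>x. vol_factor (\<lambda>v. complex_jacobian \<psi> x *v v) * indicator S x) \<in> borel_measurable borel" .
  qed
  also have "(\<integral>\<^sup>+x. ennreal (vol_factor (\<lambda>v. complex_jacobian \<psi> x *v v) * indicator S x) \<partial>lborel)
     = (\<integral>\<^sup>+x\<in>U. (ennreal ((cmod (jac \<psi> x))\<^sup>2) * indicator S x) \<partial>lborel)"
    unfolding eq using SU by (intro nn_integral_cong) (auto simp: indicator_def)
  also have "\<dots> = (\<integral>\<^sup>+x\<in>S. ennreal ((cmod (jac \<psi> x))\<^sup>2) \<partial>restrict_space lborel U)"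
    by (subst nn_integral_restrict_space) auto
  finally show ?thesis .
qed

text \<open>\<open>image_measure\<close> as an equality of measures: the nonnegative and the Bochner
  change of variables both follow from it by the rules for \<open>distr\<close> and
  \<open>density\<close>.\<close>

lemma distr_jac:
  "distr (density (restrict_space lborel U) (\<lambda>x. ennreal ((cmod (jac \<psi> x))\<^sup>2))) (restrict_space lborel U) \<psi>
    = restrict_space lborel U" (is "distr (density ?M ?d) _ _ = _")
proof (rule measure_eqI)
  fix A assume "A \<in> sets (distr (density ?M ?d) ?M \<psi>)"
  then have A: "A \<in> sets ?M" by simp
  let ?S = "\<psi> -` A \<inter> U"
  have S: "?S \<in> sets ?M" using measurable_sets[OF measurable_psi A] by (simp add: space_restrict_space)
  have "A \<subseteq> \<psi> ` U" using A sets_MI image_U by blast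
  then have im: "\<psi> ` ?S = A" by (simp add: image_vimage_eq Int_absorb2 flip: image_Int_subset) blast
  have "emeasure (distr (density ?M ?d) ?M \<psi>) A = emeasure (density ?M ?d) ?S"
    using A by (subst emeasure_distr) (auto simp: space_restrict_space)
  also have "\<dots> = emeasure lborel A"
    using S by (subst emeasure_density) (auto simp: image_measure im)
  also have "\<dots> = emeasure ?M A"
    using A sets_MI by (subst emeasure_restrict_space) auto
  finally show "emeasure (distr (density ?M ?d) ?M \<psi>) A = emeasure ?M A" .
qed simp

lemma nn_integral_change:
  assumes [measurable]: "g \<in> borel_measurable (restrict_space lborel U)"
  shows "(\<integral>\<^sup>+x. g (\<psi> x) * ennreal ((cmod (jac \<psi> x))\<^sup>2) \<partial>restrict_space lborel U) = (\<integral>\<^sup>+x. g x \<partial>restrict_space lborel U)"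
proof -
  have "(\<integral>\<^sup>+x. g x \<partial>restrict_space lborel U) = (\<integral>\<^sup>+x. g (\<psi> x) \<partial>density (restrict_space lborel U) (\<lambda>x. ennreal ((cmod (jac \<psi> x))\<^sup>2)))"
    by (subst distr_jac[symmetric], subst nn_integral_distr) auto
  also have "\<dots> = (\<integral>\<^sup>+x. g (\<psi> x) * ennreal ((cmod (jac \<psi> x))\<^sup>2) \<partial>restrict_space lborel U)"
    by (subst nn_integral_density) (auto simp: mult.commute)
  finally show ?thesis by simp
qed

lemma integral_change:
  fixes g :: "complex ^ 'n \<Rightarrow> complex"
  assumes [measurable]: "g \<in> borel_measurable (restrict_space lborel U)"
  shows "(\<integral>x. of_real ((cmod (jac \<psi> x))\<^sup>2) * g (\<psi> x) \<partial>restrict_space lborel U) = (\<integral>x. g x \<partial>restrict_space lborel U)"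
proof -
  have "(\<integral>x. g x \<partial>restrict_space lborel U) = (\<integral>x. g (\<psi> x) \<partial>density (restrict_space lborel U) (\<lambda>x. ennreal ((cmod (jac \<psi> x))\<^sup>2)))"
    by (subst distr_jac[symmetric], subst integral_distr) auto
  also have "\<dots> = (\<integral>x. (cmod (jac \<psi> x))\<^sup>2 *\<^sub>R g (\<psi> x) \<partial>restrict_space lborel U)"
    by (subst integral_density) auto
  finally show ?thesis by (simp add: scaleR_conv_of_real)
qed

lemma inverse_automorphism: "automorphism U \<phi>"
proof
  have inv: "inv_into U \<phi> z = \<psi> z" if "z \<in> U" for z
    using that maps_to by (metis bij bij_betw_imp_inj_on bij_betw_inv_into inv_into_f_f inv_left)
  have "hol_map (inv_into U \<phi>) U"
    unfolding hol_map_def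
  proof
    fix z assume z: "z \<in> U"
    show "\<exists>A. (inv_into U \<phi> has_derivative (*v) A) (at z)"
      by (rule exI, rule has_derivative_transform_within_open[OF derivative[OF z] open_U z])
         (simp add: inv)
  qed
  then show "biholomorphism \<phi> U U"
    using bij hol_inv by (auto simp: biholomorphism_def bij_betw_inv_into)
qed (use open_U bounded_U in auto)

end

section \<open>The sub-mean value inequality\<close>

lemma vol_factor_unit:
  assumes "cmod c = 1"
  shows "vol_factor (\<lambda>v :: complex ^ 'n. c *s v) = 1"
proof -
  let ?A = "\<chi> i j. if i = j then c else 0 :: complex ^ 'n ^ 'n"
  have "?A *v v = c *s v" for v
    by (simp add: vec_eq_iff matrix_vector_mult_def if_distrib[of "\<lambda>x. x * _"] cong: if_cong)
  moreover have d: "det ?A = c ^ CARD('n)" by (subst det_diagonal) auto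
  then have "det ?A \<noteq> 0" using assms by auto
  ultimately have "vol_factor (\<lambda>v :: complex ^ 'n. c *s v) = (cmod (c ^ CARD('n)))\<^sup>2"
    using vol_factor_matrix[of ?A] d by simp
  then show ?thesis using assms by (simp add: norm_power)
qed

lemma continuous_scale: "continuous_on A (\<lambda>v :: complex ^ 'n. c *s v)"
  unfolding vector_scalar_mult_def by (intro continuous_intros)

lemma scale_measurable [measurable]: "(\<lambda>v :: complex ^ 'n. c *s v) \<in> borel_measurable borel"
  by (intro borel_measurable_continuous_onI continuous_scale)

text \<open>Checked on boxes: the preimage of a box is its image under multiplication by
  \<open>inverse c\<close>, a linear map of volume factor 1. This invariance later replaces circle
  means by ball means.\<close>

lemma lborel_rotation:
  assumes c: "cmod c = 1"
  shows "distr lborel borel (\<lambda>v :: complex ^ 'n. c *s v) = lborel"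
proof (rule lborel_eqI[symmetric])
  fix l u :: "complex ^ 'n"
  assume lu: "\<And>b. b \<in> Basis \<Longrightarrow> l \<bullet> b \<le> u \<bullet> b"
  let ?g = "\<lambda>v :: complex ^ 'n. inverse c *s v"
  have c0: "c \<noteq> 0" using c by auto
  have im: "?g ` B = (\<lambda>v. c *s v) -` B" for B
    using c0 by (auto simp: image_iff) (metis right_inverse vector_smult_assoc vector_smult_lid left_inverse)+
  have lin: "bounded_linear ?g"
    unfolding linear_conv_bounded_linear[symmetric] by (rule linearI) (auto simp: vec_eq_iff algebra_simps)
  have "(\<integral>\<^sup>+x. ennreal (vol_factor ?g * indicator (box l u) x) \<partial>lborel) = emeasure lborel (?g ` box l u)"
  proof (rule emeasure_differentiable_image)
    show "?g ` box l u \<in> sets borel"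
      unfolding im using measurable_sets[OF scale_measurable, of "box l u" c] by simp
    show "emeasure lborel (?g ` box l u) < \<infinity>"
      by (intro emeasure_bounded_finite bounded_linear_image bounded_box lin)
    show "(?g has_derivative ?g) (at x)" if "x \<in> box l u" for x
      by (rule bounded_linear_imp_has_derivative[OF lin])
    show "inj_on ?g (box l u)" using c0 by (auto simp: inj_on_def)
  qed auto
  also have "vol_factor ?g = 1" by (rule vol_factor_unit) (use c in \<open>simp add: norm_inverse\<close>)
  finally have "emeasure lborel (box l u) = emeasure lborel ((\<lambda>v. c *s v) -` box l u)"
    by (simp add: im ennreal_indicator)
  then show "emeasure (distr lborel borel (\<lambda>v. c *s v)) (box l u) = (\<Prod>b\<in>Basis. (u - l) \<bullet> b)"
    using lu by (subst emeasure_distr) auto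
qed simp

lemma nn_integral_rotation:
  fixes F :: "complex ^ 'n \<Rightarrow> ennreal"
  assumes c: "cmod c = 1" and [measurable]: "F \<in> borel_measurable borel"
  shows "(\<integral>\<^sup>+v. F (z + c *s v) \<partial>lborel) = (\<integral>\<^sup>+v. F v \<partial>lborel)"
proof -
  have "(\<integral>\<^sup>+v. F v \<partial>lborel) = (\<integral>\<^sup>+v. F (z + v) \<partial>lborel)"
    by (subst lborel_distr_plus[of z, symmetric], subst nn_integral_distr) auto
  also have "\<dots> = (\<integral>\<^sup>+v. F (z + c *s v) \<partial>lborel)"
    by (subst lborel_rotation[OF c, symmetric], subst nn_integral_distr) auto
  finally show ?thesis by simp
qed

text \<open>The convex function x^s lies above its tangent at a. Integrated with a = |g(0)|, this is
  the instance of Jensen's inequality that \<open>circle_mean\<close> uses.\<close>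

lemma powr_tangent:
  fixes a x s :: real
  assumes "0 < a" "0 \<le> x" "1 \<le> s"
  shows "a powr s + s * a powr (s - 1) * (x - a) \<le> x powr s"
proof -
  have *: "1 + s * (y - 1) \<le> y powr s" if y: "0 \<le> y" for y
  proof (cases "y = 0")
    case False
    then have y: "0 < y" using y by simp
    \<comment> \<open>After scaling to a = 1 the claim says that t^s - s t is smallest at t = 1; its
      derivative changes sign there.\<close>
    define h where "h = (\<lambda>t::real. t powr s - s * t)"
    have der: "(h has_real_derivative s * t powr (s - 1) - s) (at t)" if "0 < t" for t
      unfolding h_def using that by (auto intro!: derivative_eq_intros)
    have "h 1 \<le> h y"
    proof (cases "1 \<le> y")
      case True
      show ?thesis
      proof (rule DERIV_nonneg_imp_nondecreasing[OF True])
        fix t assume "1 \<le> t" "t \<le> y"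
        moreover from this have "1 \<le> t powr (s - 1)" using assms by (simp add: ge_one_powr_ge_zero)
        ultimately show "\<exists>d. (h has_real_derivative d) (at t) \<and> 0 \<le> d"
          using der[of t] assms by (intro exI[of _ "s * t powr (s - 1) - s"] conjI) (auto simp: mult_le_cancel_left1)
      qed
    next
      case False
      then have "y \<le> 1" by simp
      show ?thesis
      proof (rule DERIV_nonpos_imp_nonincreasing[OF \<open>y \<le> 1\<close>])
        fix t assume t: "y \<le> t" "t \<le> 1"
        then have "t powr (s - 1) \<le> 1" using assms y by (intro powr_le1) auto
        then show "\<exists>d. (h has_real_derivative d) (at t) \<and> d \<le> 0"
          using der[of t] t y assms by (intro exI conjI) (auto simp: mult_le_cancel_left2)
      qed
    qed
    then show ?thesis by (simp add: h_def algebra_simps)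
  qed (use assms in auto)
  have "a powr s * (1 + s * (x / a - 1)) \<le> a powr s * (x / a) powr s"
    by (intro mult_left_mono *) (use assms in auto)
  also have "\<dots> = x powr s" using assms by (simp add: powr_divide)
  finally show ?thesis using assms by (simp add: powr_diff field_simps)
qed

text \<open>Cauchy's formula writes g(0) as the mean of g over the circle, hence |g(0)| is at most
  the mean of |g|; convexity raises this to the power s.\<close>

lemma circle_mean:
  assumes g: "g holomorphic_on cball 0 1" and s: "1 \<le> s"
  shows "ennreal (cmod (g 0) powr s) \<le> (\<integral>\<^sup>+t\<in>{0..1}. ennreal (cmod (g (exp (2 * of_real pi * \<i> * of_real t))) powr s) \<partial>lborel)"
proof -
  let ?e = "\<lambda>t::real. exp (2 * of_real pi * \<i> * of_real t)"
  have e1: "cmod (?e t) = 1" for t by simp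
  have ce: "continuous_on {0..1} (\<lambda>t. g (?e t))"
    by (rule continuous_on_compose2[OF holomorphic_on_imp_continuous_on[OF g]]) (auto intro!: continuous_intros)
  have "((\<lambda>u. g u / (u - 0)) has_contour_integral (2 * of_real pi * \<i> * g 0)) (circlepath 0 1)"
    by (rule Cauchy_integral_circlepath_simple[OF g]) auto
  then have "((\<lambda>t. g (?e t) / ?e t * (2 * of_real pi * \<i> * ?e t)) has_integral 2 * of_real pi * \<i> * g 0) {0..1}"
    unfolding has_contour_integral_def
    by (rule has_integral_eq[rotated])
       (simp add: vector_derivative_circlepath01, simp add: circlepath mult_ac)
  then have "((\<lambda>t. (2 * of_real pi * \<i>) * g (?e t)) has_integral 2 * of_real pi * \<i> * g 0) {0..1}"
    by (rule has_integral_eq[rotated]) simp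
  from has_integral_mult_right[OF this, of "inverse (2 * of_real pi * \<i>)"]
  have I: "((\<lambda>t. g (?e t)) has_integral g 0) {0..1}" by (simp add: field_simps)
  have cn: "continuous_on {0..1} (\<lambda>t. cmod (g (?e t)))" using ce by (intro continuous_intros)
  have cs: "continuous_on {0..1} (\<lambda>t. cmod (g (?e t)) powr s)"
    using s by (intro continuous_on_powr' cn continuous_on_const) auto
  have le1: "cmod (g 0) \<le> integral {0..1} (\<lambda>t. cmod (g (?e t)))"
    using integral_norm_bound_integral[OF has_integral_integrable[OF I] integrable_continuous_real[OF cn]]
      integral_unique[OF I] by simp
  have le: "cmod (g 0) powr s \<le> integral {0..1} (\<lambda>t. cmod (g (?e t)) powr s)"
  \<comment> \<open>The tangent inequality needs a positive base point; for g(0) = 0 the left side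
    is 0.\<close>
  proof (cases "g 0 = 0")
    case True
    then show ?thesis using s by (simp add: integral_nonneg integrable_continuous_real[OF cs])
  next
    case False
    let ?a = "cmod (g 0)"
    have a: "0 < ?a" using False by simp
    have c1: "continuous_on {0..1} (\<lambda>t. ?a powr s + s * ?a powr (s - 1) * (cmod (g (?e t)) - ?a))"
      by (intro continuous_on_add continuous_on_mult continuous_on_diff cn continuous_on_const)
    have "?a powr s \<le> ?a powr s + s * ?a powr (s - 1) * (integral {0..1} (\<lambda>t. cmod (g (?e t))) - ?a)"
      using le1 s by simp
    also have "\<dots> = integral {0..1} (\<lambda>t. ?a powr s + s * ?a powr (s - 1) * (cmod (g (?e t)) - ?a))"
    proof (rule integral_unique[symmetric])
      have "((\<lambda>t. cmod (g (?e t))) has_integral integral {0..1} (\<lambda>t. cmod (g (?e t)))) {0..1}"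
        using integrable_continuous_real[OF cn] by (rule integrable_integral)
      from has_integral_add[OF has_integral_const_real[of "?a powr s" 0 1]
          has_integral_mult_right[OF has_integral_diff[OF this has_integral_const_real[of ?a 0 1]]]]
      show "((\<lambda>t. ?a powr s + s * ?a powr (s - 1) * (cmod (g (?e t)) - ?a)) has_integral
          ?a powr s + s * ?a powr (s - 1) * (integral {0..1} (\<lambda>t. cmod (g (?e t))) - ?a)) {0..1}"
        by simp
    qed
    also have "\<dots> \<le> integral {0..1} (\<lambda>t. cmod (g (?e t)) powr s)"
      by (intro integral_le integrable_continuous_real c1 cs powr_tangent a s) auto
    finally show ?thesis .
  qed
  have "(\<integral>\<^sup>+t\<in>{0..1}. ennreal (cmod (g (?e t)) powr s) \<partial>lborel)
      = (\<integral>\<^sup>+t. ennreal (indicator {0..1} t *\<^sub>R cmod (g (?e t)) powr s) \<partial>lborel)"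
    by (intro nn_integral_cong) (auto simp: indicator_def)
  also have "\<dots> = ennreal (integral {0..1} (\<lambda>t. cmod (g (?e t)) powr s))"
  proof (rule nn_integral_has_integral_lborel)
    show "(\<lambda>t. indicator {0..1} t *\<^sub>R cmod (g (?e t)) powr s) \<in> borel_measurable borel"
      by (intro borel_measurable_continuous_on_indicator cs) auto
    have "((\<lambda>t. cmod (g (?e t)) powr s) has_integral integral {0..1} (\<lambda>t. cmod (g (?e t)) powr s)) {0..1}"
      using integrable_continuous_real[OF cs] by (rule integrable_integral)
    then show "((\<lambda>t. indicator {0..1} t *\<^sub>R cmod (g (?e t)) powr s) has_integral integral {0..1} (\<lambda>t. cmod (g (?e t)) powr s)) UNIV"
      by (subst (asm) has_integral_restrict_UNIV[symmetric])
         (erule has_integral_eq[rotated], auto simp: indicator_def)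
  qed auto
  finally show ?thesis using le by (simp add: ennreal_leI)
qed

text \<open>Average the circle means around \<open>z\<close> over the ball; by Tonelli and rotation invariance this gives the ball mean.\<close>

theorem submean:
  fixes f :: "complex ^ 'n \<Rightarrow> complex"
  assumes f: "hol_fun f (ball z R)" and s: "1 \<le> s"
  shows "ennreal (cmod (f z) powr s) * emeasure lborel (ball z R)
    \<le> (\<integral>\<^sup>+y\<in>ball z R. ennreal (cmod (f y) powr s) \<partial>lborel)"
proof -
  let ?e = "\<lambda>t::real. exp (2 * of_real pi * \<i> * of_real t)"
  define F where "F y = ennreal (cmod (f y) powr s) * indicator (ball z R) y" for y
  have "(\<lambda>y. indicator (ball z R) y *\<^sub>R (cmod (f y) powr s)) \<in> borel_measurable borel"
    using hol_fun_continuous[OF f] s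
    by (intro borel_measurable_continuous_on_indicator continuous_on_powr' continuous_intros) auto
  then have m: "(\<lambda>y. ennreal (indicator (ball z R) y *\<^sub>R (cmod (f y) powr s))) \<in> borel_measurable borel"
    by measurable
  have eq: "(\<lambda>y. ennreal (indicator (ball z R) y *\<^sub>R (cmod (f y) powr s))) = F"
    by (auto simp: F_def indicator_def fun_eq_iff)
  have F [measurable]: "F \<in> borel_measurable borel" by (rule m[unfolded eq])
  \<comment> \<open>Both sides use the form z + c v with |c| = 1, so that
    \<open>nn_integral_rotation\<close> evaluates the left side (c = 1) as well as the right side.
    Outside the ball the indicator makes the left side 0.\<close>
  have mean: "ennreal (cmod (f z) powr s) * indicator (ball z R) (z + 1 *s v)
      \<le> (\<integral>\<^sup>+t. F (z + ?e t *s v) * indicator {0..1} t \<partial>lborel)" for v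
  proof (cases "norm v < R")
    case True
    have mem: "z + c *s v \<in> ball z R" if "cmod c \<le> 1" for c
      using mem_ball_scale[OF that] True by simp
    have "ennreal (cmod (f (z + 0 *s v)) powr s)
        \<le> (\<integral>\<^sup>+t\<in>{0..1}. ennreal (cmod (f (z + ?e t *s v)) powr s) \<partial>lborel)"
      by (rule circle_mean[OF slice_holomorphic[OF f] s]) (use mem in auto)
    also have "\<dots> = (\<integral>\<^sup>+t. F (z + ?e t *s v) * indicator {0..1} t \<partial>lborel)"
      using mem by (intro nn_integral_cong) (simp add: F_def)
    finally show ?thesis by (auto simp: indicator_def)
  qed (auto simp: indicator_def dist_norm)
  have "ennreal (cmod (f z) powr s) * emeasure lborel (ball z R)
      = ennreal (cmod (f z) powr s) * (\<integral>\<^sup>+v. indicator (ball z R) (z + 1 *s v) \<partial>lborel)"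
    by (subst nn_integral_rotation) (auto intro!: borel_measurable_indicator)
  also have "\<dots> = (\<integral>\<^sup>+v. ennreal (cmod (f z) powr s) * indicator (ball z R) (z + 1 *s v) \<partial>lborel)"
    by (subst nn_integral_cmult) (auto intro!: measurable_compose[OF _ borel_measurable_indicator[of "ball z R" borel]])
  also have "\<dots> \<le> (\<integral>\<^sup>+v. (\<integral>\<^sup>+t. F (z + ?e t *s v) * indicator {0..1} t \<partial>lborel) \<partial>lborel)"
    by (intro nn_integral_mono mean)
  also have "\<dots> = (\<integral>\<^sup>+t. (\<integral>\<^sup>+v. F (z + ?e t *s v) * indicator {0..1} t \<partial>lborel) \<partial>lborel)"
  proof (rule lborel_pair.Fubini')
    have "continuous_on UNIV (\<lambda>p :: real \<times> (complex ^ 'n). z + ?e (fst p) *s snd p)"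
      unfolding vector_scalar_mult_def by (intro continuous_intros)
    then have "(\<lambda>p :: real \<times> (complex ^ 'n). z + ?e (fst p) *s snd p) \<in> borel_measurable borel"
      by (rule borel_measurable_continuous_onI)
    then have [measurable]: "(\<lambda>p :: real \<times> (complex ^ 'n). z + ?e (fst p) *s snd p) \<in> borel_measurable (lborel \<Otimes>\<^sub>M lborel)"
      by (simp add: lborel_prod)
    have "(\<lambda>p. F (z + ?e (fst p) *s snd p) * indicator {0..1} (fst p)) \<in> borel_measurable (lborel \<Otimes>\<^sub>M lborel)"
      by measurable
    then show "(\<lambda>(t, v). F (z + ?e t *s v) * indicator {0..1} t) \<in> borel_measurable (lborel \<Otimes>\<^sub>M lborel)"
      by (simp add: split_beta')
  qed
  also have "\<dots> = (\<integral>\<^sup>+t. (\<integral>\<^sup>+v. F v \<partial>lborel) * indicator {0..1::real} t \<partial>lborel)"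
  proof (intro nn_integral_cong)
    fix t :: real
    have "(\<integral>\<^sup>+v. F (z + ?e t *s v) * indicator {0..1} t \<partial>lborel)
       = (\<integral>\<^sup>+v. F (z + ?e t *s v) \<partial>lborel) * indicator {0..1} t"
      by (auto simp: indicator_def)
    then show "(\<integral>\<^sup>+v. F (z + ?e t *s v) * indicator {0..1} t \<partial>lborel) = (\<integral>\<^sup>+v. F v \<partial>lborel) * indicator {0..1} t"
      by (subst (asm) nn_integral_rotation) auto
  qed
  also have "\<dots> = (\<integral>\<^sup>+v. F v \<partial>lborel)"
    by (subst nn_integral_cmult) auto
  finally show ?thesis by (simp add: F_def)
qed

section \<open>The Bergman kernel\<close>

lemma cnj_measurable [measurable]: "cnj \<in> borel_measurable borel"
  by (intro borel_measurable_continuous_onI continuous_intros)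

locale bounded_domain =
  fixes U :: "(complex ^ 'n) set"
  assumes domain_U: "domain U" and bounded_U: "bounded U"
begin

abbreviation M :: "(complex ^ 'n) measure" where "M \<equiv> restrict_space lborel U"
abbreviation A2 :: "(complex ^ 'n \<Rightarrow> complex) set" where "A2 \<equiv> square_integrable_hol U"
definition ball_vol :: "real \<Rightarrow> real" where
  "ball_vol R = measure lborel (ball (0 :: complex ^ 'n) R)"

lemma open_U: "open U" and U_nonempty: "U \<noteq> {}" and connected_U: "connected U"
  using domain_U by (auto simp: domain_def)

lemma U_borel [measurable]: "U \<in> sets borel"
  using open_U by simp

lemma space_M [simp]: "space M = U"
  by (simp add: space_restrict_space)

lemma finite_M: "finite_measure M"
  using emeasure_bounded_finite[OF bounded_U]
  by (intro finite_measureI) (simp add: emeasure_restrict_space)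

lemma continuous_measurable:
  "continuous_on U f \<Longrightarrow> (f :: complex ^ 'n \<Rightarrow> 'b::topological_space) \<in> borel_measurable M"
  using borel_measurable_continuous_on_restrict[of U f]
  by (simp cong: measurable_cong_sets sets_restrict_space_cong)

lemma hol_measurable: "hol_fun f U \<Longrightarrow> f \<in> borel_measurable M"
  by (intro continuous_measurable hol_fun_continuous)

lemma nn_integral_M: "(\<integral>\<^sup>+z. f z \<partial>M) = (\<integral>\<^sup>+z\<in>U. f z \<partial>lborel)"
  by (rule nn_integral_restrict_space) simp

lemma ball_vol_pos: "0 < R \<Longrightarrow> 0 < ball_vol R"
  unfolding ball_vol_def by (rule content_ball_pos)

lemma emeasure_ball_vol: "0 < R \<Longrightarrow> emeasure lborel (ball (z :: complex ^ 'n) R) = ennreal (ball_vol R)"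
  unfolding ball_vol_def by (simp add: emeasure_ball content_ball)

lemma submean_M:
  assumes f: "hol_fun f U" and R: "0 < R" "ball z R \<subseteq> U" and s: "1 \<le> s"
  shows "ennreal (cmod (f z) powr s) * ennreal (ball_vol R) \<le> (\<integral>\<^sup>+y\<in>ball z R. ennreal (cmod (f y) powr s) \<partial>M)"
proof -
  have "ennreal (cmod (f z) powr s) * ennreal (ball_vol R) \<le> (\<integral>\<^sup>+y\<in>ball z R. ennreal (cmod (f y) powr s) \<partial>lborel)"
    using submean[OF hol_fun_subset[OF f R(2)] s] emeasure_ball_vol[OF R(1), of z] by simp
  also have "\<dots> = (\<integral>\<^sup>+y\<in>ball z R. ennreal (cmod (f y) powr s) \<partial>M)"
    unfolding nn_integral_M using R by (intro nn_integral_cong) (auto simp: indicator_def)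
  finally show ?thesis .
qed

text \<open>The square of the L2 norm; identities and estimates below are stated for
  squares.\<close>

definition nrm :: "(complex ^ 'n \<Rightarrow> complex) \<Rightarrow> real" where
  "nrm f = (\<integral>z. (cmod (f z))\<^sup>2 \<partial>M)"

definition ip :: "(complex ^ 'n \<Rightarrow> complex) \<Rightarrow> (complex ^ 'n \<Rightarrow> complex) \<Rightarrow> complex" where
  "ip f g = (\<integral>z. f z * cnj (g z) \<partial>M)"

lemma A2_iff: "f \<in> A2 \<longleftrightarrow> hol_fun f U \<and> integrable M (\<lambda>z. (cmod (f z))\<^sup>2)"
proof -
  have "integrable M (\<lambda>z. (cmod (f z))\<^sup>2) \<longleftrightarrow> (\<integral>\<^sup>+z. ennreal ((cmod (f z))\<^sup>2) \<partial>M) < \<infinity>" if "hol_fun f U"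
    using hol_measurable[OF that] by (simp add: integrable_iff_bounded)
  then show ?thesis unfolding square_integrable_hol_def by auto
qed

lemma A2_hol: "f \<in> A2 \<Longrightarrow> hol_fun f U"
  and A2_integrable: "f \<in> A2 \<Longrightarrow> integrable M (\<lambda>z. (cmod (f z))\<^sup>2)"
  by (auto simp: A2_iff)

lemma A2_measurable [measurable_dest]: "f \<in> A2 \<Longrightarrow> f \<in> borel_measurable M"
  by (intro hol_measurable A2_hol)

lemma nn_nrm: "f \<in> A2 \<Longrightarrow> (\<integral>\<^sup>+z. ennreal ((cmod (f z))\<^sup>2) \<partial>M) = ennreal (nrm f)"
  unfolding nrm_def by (rule nn_integral_eq_integral[OF A2_integrable]) auto

lemma nrm_nonneg: "0 \<le> nrm f"
  unfolding nrm_def by simp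

lemma A2_add: assumes "f \<in> A2" "g \<in> A2" shows "(\<lambda>z. f z + g z) \<in> A2"
  unfolding A2_iff
proof
  show "hol_fun (\<lambda>z. f z + g z) U" using assms by (intro hol_fun_add A2_hol)
  show "integrable M (\<lambda>z. (cmod (f z + g z))\<^sup>2)"
  proof (rule Bochner_Integration.integrable_bound)
    show "integrable M (\<lambda>z. 2 * (cmod (f z))\<^sup>2 + 2 * (cmod (g z))\<^sup>2)"
      using assms by (intro Bochner_Integration.integrable_add integrable_mult_right A2_integrable)
    have "(cmod (f z + g z))\<^sup>2 \<le> 2 * (cmod (f z))\<^sup>2 + 2 * (cmod (g z))\<^sup>2" for z
    proof -
      have "(cmod (f z + g z))\<^sup>2 \<le> (cmod (f z) + cmod (g z))\<^sup>2"
        by (intro power_mono norm_triangle_ineq) auto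
      then show ?thesis using sum_squares_bound[of "cmod (f z)" "cmod (g z)"]
        by (simp add: power2_sum)
    qed
    then show "AE z in M. norm ((cmod (f z + g z))\<^sup>2) \<le> norm (2 * (cmod (f z))\<^sup>2 + 2 * (cmod (g z))\<^sup>2)"
      by simp
  qed (use assms in measurable)
qed

lemma A2_cmult: assumes "f \<in> A2" shows "(\<lambda>z. c * f z) \<in> A2"
  using assms by (simp add: A2_iff hol_fun_cmult norm_mult power_mult_distrib)

lemma A2_diff: assumes "f \<in> A2" "g \<in> A2" shows "(\<lambda>z. f z - g z) \<in> A2"
  using A2_add[OF assms(1) A2_cmult[OF assms(2), of "-1"]] by simp

lemma A2_bounded:
  assumes "hol_fun f U" "\<And>z. z \<in> U \<Longrightarrow> cmod (f z) \<le> B"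
  shows "f \<in> A2"
  unfolding A2_iff
proof
  show "integrable M (\<lambda>z. (cmod (f z))\<^sup>2)"
    by (rule finite_measure.integrable_const_bound[OF finite_M, of _ "B\<^sup>2"])
       (use assms hol_measurable[OF assms(1)] in \<open>auto simp: power_mono\<close>)
qed fact

lemma ip_integrable: assumes "f \<in> A2" "g \<in> A2" shows "integrable M (\<lambda>z. f z * cnj (g z))"
proof (rule Bochner_Integration.integrable_bound)
  show "integrable M (\<lambda>z. (cmod (f z))\<^sup>2 + (cmod (g z))\<^sup>2)"
    using assms by (intro Bochner_Integration.integrable_add A2_integrable)
  have "cmod (f z) * cmod (g z) \<le> (cmod (f z))\<^sup>2 + (cmod (g z))\<^sup>2" for z
    using sum_squares_bound[of "cmod (f z)" "cmod (g z)"] mult_nonneg_nonneg[of "cmod (f z)" "cmod (g z)"]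
    by (simp del: mult_nonneg_nonneg)
  then show "AE z in M. norm (f z * cnj (g z)) \<le> norm ((cmod (f z))\<^sup>2 + (cmod (g z))\<^sup>2)"
    by (simp add: norm_mult)
qed (use assms in measurable)

lemma ip_add_left: "f \<in> A2 \<Longrightarrow> g \<in> A2 \<Longrightarrow> h \<in> A2 \<Longrightarrow> ip (\<lambda>z. f z + g z) h = ip f h + ip g h"
  unfolding ip_def by (simp add: distrib_right ip_integrable)

lemma ip_cmult_left: "ip (\<lambda>z. c * f z) h = c * ip f h"
  unfolding ip_def by (simp add: mult.assoc)

lemma ip_cnj: "ip g f = cnj (ip f g)"
  unfolding ip_def using Bochner_Integration.integral_cnj[of M "\<lambda>z. f z * cnj (g z)"] by (simp add: mult.commute)

lemma ip_diff_left: "f \<in> A2 \<Longrightarrow> g \<in> A2 \<Longrightarrow> h \<in> A2 \<Longrightarrow> ip (\<lambda>z. f z - g z) h = ip f h - ip g h"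
  using ip_add_left[OF _ A2_cmult[of g "-1"], of f h] ip_cmult_left[of "-1" g h] by simp

lemma ip_self: "ip f f = of_real (nrm f)"
  unfolding ip_def nrm_def by (simp add: complex_mult_cnj cmod_power2 flip: integral_complex_of_real)

lemma nrm_add:
  assumes "f \<in> A2" "g \<in> A2"
  shows "nrm (\<lambda>z. f z + g z) = nrm f + 2 * Re (ip f g) + nrm g"
proof -
  let ?h = "\<lambda>z. f z + g z"
  have h: "?h \<in> A2" using assms by (rule A2_add)
  have "ip ?h ?h = ip f ?h + ip g ?h" using assms h by (rule ip_add_left)
  also have "ip f ?h = cnj (ip ?h f)" by (rule ip_cnj)
  also have "ip ?h f = ip f f + ip g f" using assms by (intro ip_add_left)
  also have "ip g ?h = cnj (ip ?h g)" by (rule ip_cnj)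
  also have "ip ?h g = ip f g + ip g g" using assms by (intro ip_add_left)
  also have "ip g f = cnj (ip f g)" by (rule ip_cnj)
  finally have "Re (ip ?h ?h) = Re (cnj (ip f f + cnj (ip f g)) + cnj (ip f g + ip g g))" by simp
  then show ?thesis by (simp add: ip_self)
qed

lemma nrm_cmult: "nrm (\<lambda>z. c * f z) = (cmod c)\<^sup>2 * nrm f"
  unfolding nrm_def by (simp add: norm_mult power_mult_distrib)

text \<open>The sub-mean value inequality with exponent 2. Continuity of point evaluation is what
  gives the space a reproducing kernel.\<close>

lemma A2_eval:
  assumes f: "f \<in> A2" and R: "0 < R" "ball z R \<subseteq> U"
  shows "(cmod (f z))\<^sup>2 * ball_vol R \<le> nrm f"
proof -
  have "ennreal ((cmod (f z))\<^sup>2 * ball_vol R) = ennreal (cmod (f z) powr 2) * ennreal (ball_vol R)"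
    using ball_vol_pos[OF R(1)] by (simp add: powr_numeral ennreal_mult)
  also have "\<dots> \<le> (\<integral>\<^sup>+y\<in>ball z R. ennreal (cmod (f y) powr 2) \<partial>M)"
    by (rule submean_M[OF A2_hol[OF f] R]) simp
  also have "\<dots> \<le> (\<integral>\<^sup>+y. ennreal ((cmod (f y))\<^sup>2) \<partial>M)"
    by (intro nn_integral_mono) (auto simp: indicator_def powr_numeral)
  finally show ?thesis using nn_nrm[OF f] nrm_nonneg by (simp add: ennreal_le_iff)
qed

lemma cauchy_schwarz:
  assumes "f \<in> A2" "g \<in> A2"
  shows "(cmod (ip f g))\<^sup>2 \<le> nrm f * nrm g"
proof -
  let ?a = "ip f g"
  \<comment> \<open>The squared norm of f - t <f,g> g: the coefficient <f,g> makes the cross term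
    real. The choice t = 1 / \<open>nrm g\<close> gives the inequality, and if \<open>nrm g\<close>
    is 0 a large t forces <f,g> = 0.\<close>
  have *: "0 \<le> nrm f + t\<^sup>2 * (cmod ?a)\<^sup>2 * nrm g - 2 * t * (cmod ?a)\<^sup>2" for t :: real
  proof -
    let ?c = "- of_real t * ?a"
    have "ip f (\<lambda>z. ?c * g z) = cnj (?c) * ?a"
      by (subst ip_cnj, subst ip_cmult_left) (simp add: ip_cnj[of g f])
    moreover have "0 \<le> nrm (\<lambda>z. f z + ?c * g z)" by (rule nrm_nonneg)
    moreover have "Re (cnj ?c * ?a) = - t * (cmod ?a)\<^sup>2"
      unfolding cmod_power2 by (simp add: power2_eq_square algebra_simps)
    ultimately show ?thesis
      using nrm_add[OF assms(1) A2_cmult[OF assms(2), of ?c]] nrm_cmult[of ?c g]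
      by (simp add: norm_mult power_mult_distrib)
  qed
  show ?thesis
  proof (cases "nrm g = 0")
    case True
    have "(cmod ?a)\<^sup>2 = 0"
    proof (rule ccontr)
      assume "(cmod ?a)\<^sup>2 \<noteq> 0"
      then have p: "0 < (cmod ?a)\<^sup>2" by simp
      then show False using *[of "(nrm f + 1) / (cmod ?a)\<^sup>2"] True nrm_nonneg[of f] by simp
    qed
    then show ?thesis using True by simp
  next
    case False
    then have p: "0 < nrm g" using nrm_nonneg[of g] by simp
    have "0 \<le> nrm f - (cmod ?a)\<^sup>2 / nrm g"
      using *[of "1 / nrm g"] p by (simp add: field_simps power2_eq_square)
    then show ?thesis using p by (simp add: field_simps)
  qed
qed

section \<open>Existence and uniqueness of the reproducing kernel\<close>

lemma one_A2: "(\<lambda>z. 1) \<in> A2"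
  by (rule A2_bounded[of _ 1]) auto

lemma sub_balls:
  assumes "z \<in> U"
  shows "\<exists>R>0. ball z R \<subseteq> U \<and> (\<forall>y\<in>ball z R. ball y R \<subseteq> U)"
proof -
  obtain R where R: "0 < R" "ball z R \<subseteq> U" using open_U assms open_contains_ball by blast
  have "ball y (R/2) \<subseteq> U" if "y \<in> ball z (R/2)" for y
  proof
    fix x assume "x \<in> ball y (R/2)"
    then show "x \<in> U" using that dist_triangle[of z x y] R by auto
  qed
  then show ?thesis using R by (intro exI[of _ "R/2"]) (auto simp: subset_iff)
qed

text \<open>A multiple of the function of least norm among those with value \<open>1\<close> at \<open>w\<close>.\<close>

lemma representer:
  assumes w: "w \<in> U"
  shows "\<exists>k\<in>A2. \<forall>g\<in>A2. g w = ip g k"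
proof -
  define V where "V = {nrm f | f. f \<in> A2 \<and> f w = 1}"
  define m where "m = Inf V"
  have Vne: "V \<noteq> {}" using one_A2 unfolding V_def by blast
  have bdd: "bdd_below V" unfolding V_def by (rule bdd_belowI[of _ 0]) (auto simp: nrm_nonneg)
  have m_le: "m \<le> nrm f" if "f \<in> A2" "f w = 1" for f
    unfolding m_def by (rule cInf_lower[OF _ bdd]) (use that V_def in blast)
  have "\<exists>f. f \<in> A2 \<and> f w = 1 \<and> nrm f < m + 1 / real (Suc n)" for n
  proof -
    have "Inf V < m + 1 / real (Suc n)" by (simp add: m_def)
    then show ?thesis using cInf_lessD[OF Vne] unfolding V_def by blast
  qed
  then obtain F where F: "\<And>n. F n \<in> A2" "\<And>n. F n w = 1" and Fm: "\<And>n. nrm (F n) < m + 1 / real (Suc n)"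
    by metis
  \<comment> \<open>Parallelogram law: the midpoint of \<open>F n\<close> and \<open>F k\<close>
    also takes the value 1 at w, so its squared norm is at least m, which leaves little room for the
    difference.\<close>
  have near: "nrm (\<lambda>z. F n z - F k z) \<le> 2 / real (Suc n) + 2 / real (Suc k)" for n k
  proof -
    have a: "nrm (\<lambda>z. F n z + F k z) = nrm (F n) + 2 * Re (ip (F n) (F k)) + nrm (F k)"
      by (rule nrm_add[OF F(1) F(1)])
    have "ip (F n) (\<lambda>z. (-1) * F k z) = - ip (F n) (F k)"
      by (subst ip_cnj, subst ip_cmult_left) (simp add: ip_cnj[of "F k" "F n"])
    then have b: "nrm (\<lambda>z. F n z - F k z) = nrm (F n) - 2 * Re (ip (F n) (F k)) + nrm (F k)"
      using nrm_add[OF F(1)[of n] A2_cmult[OF F(1)[of k], of "-1"]] nrm_cmult[of "-1" "F k"] by simp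
    have "m \<le> nrm (\<lambda>z. (1/2) * (F n z + F k z))"
      by (rule m_le[OF A2_cmult[OF A2_add[OF F(1) F(1)]]]) (simp add: F)
    also have "\<dots> = nrm (\<lambda>z. F n z + F k z) / 4"
      by (subst nrm_cmult) (simp add: power2_eq_square)
    finally have "4 * m \<le> nrm (\<lambda>z. F n z + F k z)" by simp
    moreover have "2 / real (Suc n) = 2 * (1 / real (Suc n))" "2 / real (Suc k) = 2 * (1 / real (Suc k))" by simp_all
    ultimately show ?thesis using a b Fm[of n] Fm[of k] by linarith
  qed
  have cau: "Cauchy (\<lambda>n. F n z)" if z: "z \<in> U" for z
  proof -
    obtain R where R: "0 < R" "ball z R \<subseteq> U" using sub_balls[OF z] by blast
    have bd: "(cmod (F n z - F k z))\<^sup>2 \<le> (2 / real (Suc n) + 2 / real (Suc k)) / ball_vol R" for n k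
      using order_trans[OF A2_eval[OF A2_diff[OF F(1)[of n] F(1)[of k]] R] near[of n k]] ball_vol_pos[OF R(1)]
      by (simp add: pos_le_divide_eq)
    show ?thesis
    proof (rule metric_CauchyI)
      fix e :: real assume e: "0 < e"
      obtain N :: nat where N: "4 / (e\<^sup>2 * ball_vol R) < real (Suc N)"
        using reals_Archimedean2 less_trans by (metis lessI of_nat_less_iff)
      have "dist (F n z) (F k z) < e" if nk: "n \<ge> N" "k \<ge> N" for n k
      proof -
        have "2 / real (Suc n) + 2 / real (Suc k) \<le> 2 / real (Suc N) + 2 / real (Suc N)"
          by (intro add_mono divide_left_mono) (use nk in auto)
        also have "\<dots> < e\<^sup>2 * ball_vol R"
          using N e ball_vol_pos[OF R(1)] by (simp add: pos_divide_less_eq mult_ac)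
        finally have "(2 / real (Suc n) + 2 / real (Suc k)) / ball_vol R < e\<^sup>2"
          using ball_vol_pos[OF R(1)] by (simp add: pos_divide_less_eq)
        then have "(cmod (F n z - F k z))\<^sup>2 < e\<^sup>2" using bd[of n k] by linarith
        then show ?thesis using e by (simp add: dist_norm power_less_imp_less_base)
      qed
      then show "\<exists>N. \<forall>n\<ge>N. \<forall>k\<ge>N. dist (F n z) (F k z) < e" by blast
    qed
  qed
  define f where "f z = lim (\<lambda>n. F n z)" for z
  have lim: "(\<lambda>n. F n z) \<longlonglongrightarrow> f z" if "z \<in> U" for z
    using Cauchy_convergent[OF cau[OF that]] unfolding f_def convergent_LIMSEQ_iff .
  have "hol_fun f {z}" if z: "z \<in> U" for z
  proof -
    obtain R where R: "0 < R" "\<forall>y\<in>ball z R. ball y R \<subseteq> U" "ball z R \<subseteq> U" using sub_balls[OF z] by blast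
    show ?thesis
    proof (rule hol_pointwise_limit_at[of R F])
      show "hol_fun (F n) (ball z R)" for n using A2_hol[OF F(1)] R(3) by (rule hol_fun_subset)
      fix n y assume y: "y \<in> ball z R"
      have "1 / real (Suc n) \<le> 1" by simp
      then have "(cmod (F n y))\<^sup>2 * ball_vol R \<le> m + 1"
        using A2_eval[OF F(1)[of n] R(1) R(2)[rule_format, OF y]] Fm[of n] by linarith
      then have "(cmod (F n y))\<^sup>2 \<le> (m + 1) / ball_vol R"
        using ball_vol_pos[OF R(1)] by (simp add: pos_le_divide_eq)
      then show "cmod (F n y) \<le> sqrt ((m + 1) / ball_vol R)" by (rule real_le_rsqrt)
    next
      show "(\<lambda>n. F n y) \<longlonglongrightarrow> f y" if "y \<in> ball z R" for y using lim R(3) that by blast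
    qed (rule R)
  qed
  then have holf: "hol_fun f U" unfolding hol_fun_def by blast
  have m0: "0 \<le> m" unfolding m_def by (rule cInf_greatest[OF Vne]) (auto simp: V_def nrm_nonneg)
  have "(\<integral>\<^sup>+z. ennreal ((cmod (f z))\<^sup>2) \<partial>M) = (\<integral>\<^sup>+z. liminf (\<lambda>n. ennreal ((cmod (F n z))\<^sup>2)) \<partial>M)"
  proof (rule nn_integral_cong)
    fix z assume "z \<in> space M"
    then have "(\<lambda>n. ennreal ((cmod (F n z))\<^sup>2)) \<longlonglongrightarrow> ennreal ((cmod (f z))\<^sup>2)"
      using lim[of z] by (intro tendsto_ennrealI tendsto_intros) auto
    from lim_imp_Liminf[OF _ this] show "ennreal ((cmod (f z))\<^sup>2) = liminf (\<lambda>n. ennreal ((cmod (F n z))\<^sup>2))"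
      by simp
  qed
  \<comment> \<open>Fatou's lemma: pointwise convergence alone bounds the norm of the limit, and no
    completeness of L2 is invoked.\<close>
  also have "\<dots> \<le> liminf (\<lambda>n. \<integral>\<^sup>+z. ennreal ((cmod (F n z))\<^sup>2) \<partial>M)"
    by (rule nn_integral_liminf) (use A2_measurable[OF F(1)] in measurable)
  also have "\<dots> \<le> liminf (\<lambda>n. ennreal (m + 1 / real (Suc n)))"
    unfolding nn_nrm[OF F(1)] by (intro Liminf_mono always_eventually allI ennreal_leI less_imp_le Fm)
  also have "\<dots> = ennreal m"
  proof (rule lim_imp_Liminf)
    have "(\<lambda>n. m + 1 / real (Suc n)) \<longlonglongrightarrow> m + 0"
      by (intro tendsto_add tendsto_const LIMSEQ_Suc[OF lim_const_over_n[of 1, simplified]])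
    then show "(\<lambda>n. ennreal (m + 1 / real (Suc n))) \<longlonglongrightarrow> ennreal m"
      by (intro tendsto_ennrealI) simp
  qed simp
  finally have le: "(\<integral>\<^sup>+z. ennreal ((cmod (f z))\<^sup>2) \<partial>M) \<le> ennreal m" .
  then have fA: "f \<in> A2" unfolding square_integrable_hol_def using holf
    by (simp add: le_less_trans[OF _ ennreal_less_top])
  have fw: "f w = 1" using lim[OF w] F(2) by (simp add: LIMSEQ_const_iff)
  have nf: "nrm f = m" using le m_le[OF fA fw] nn_nrm[OF fA] m0 by (simp add: ennreal_le_iff)
  have mpos: "0 < m"
  proof -
    obtain R where R: "0 < R" "ball w R \<subseteq> U" using sub_balls[OF w] by blast
    show ?thesis using A2_eval[OF fA R] ball_vol_pos[OF R(1)] fw nf by simp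
  qed
  have orth: "ip g f = 0" if g: "g \<in> A2" "g w = 0" for g
  proof (rule ccontr)
    assume "ip g f \<noteq> 0"
    then have p: "0 < (cmod (ip g f))\<^sup>2" by simp
    \<comment> \<open>A first-order perturbation of the minimiser within the functions of value 1 at
      w. The term 1 in the denominator makes t times \<open>nrm g\<close> strictly less than 2, even
      if \<open>nrm g\<close> is 0.\<close>
    define t where "t = 1 / (nrm g + 1)"
    have t: "0 < t" "t * nrm g < 2" using nrm_nonneg[of g] by (auto simp: t_def field_simps)
    let ?c = "- of_real t * cnj (ip g f)"
    have "m \<le> nrm (\<lambda>z. f z + ?c * g z)"
      by (rule m_le[OF A2_add[OF fA A2_cmult[OF g(1)]]]) (simp add: fw g)
    also have "\<dots> = nrm f + 2 * Re (ip f (\<lambda>z. ?c * g z)) + (cmod ?c)\<^sup>2 * nrm g"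
      by (subst nrm_add[OF fA A2_cmult[OF g(1)]]) (simp only: nrm_cmult)
    also have "ip f (\<lambda>z. ?c * g z) = cnj (?c * ip g f)"
      by (subst ip_cnj, subst ip_cmult_left) simp
    also have "Re (cnj (?c * ip g f)) = - t * (cmod (ip g f))\<^sup>2"
      unfolding cmod_power2 by (simp add: power2_eq_square algebra_simps)
    also have "(cmod ?c)\<^sup>2 = t\<^sup>2 * (cmod (ip g f))\<^sup>2" by (simp add: norm_mult power_mult_distrib)
    finally have "0 \<le> t * (cmod (ip g f))\<^sup>2 * (t * nrm g - 2)"
      by (simp add: nf algebra_simps power2_eq_square)
    moreover have "0 < t * (cmod (ip g f))\<^sup>2" using t p by simp
    ultimately have "0 \<le> t * nrm g - 2" by (simp only: zero_le_mult_iff) linarith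
    then show False using t by simp
  qed
  \<comment> \<open>Since g - g(w) f vanishes at w, it is orthogonal to f; hence <g,f> = g(w) m, and
    dividing by m normalises.\<close>
  let ?k = "\<lambda>z. of_real (1 / m) * f z"
  have "g w = ip g ?k" if g: "g \<in> A2" for g
  proof -
    have "ip (\<lambda>z. g z - g w * f z) f = 0"
      by (rule orth[OF A2_diff[OF g A2_cmult[OF fA]]]) (simp add: fw)
    then have "ip g f = g w * of_real m"
      using ip_diff_left[OF g A2_cmult[OF fA] fA, of "g w"] ip_cmult_left[of "g w" f f] by (simp add: ip_self nf)
    moreover have "ip g ?k = cnj (of_real (1/m)) * ip g f"
      by (subst ip_cnj, subst ip_cmult_left) (simp add: ip_cnj[of f g])
    ultimately show ?thesis using mpos by simp
  qed
  then show ?thesis using A2_cmult[OF fA] by blast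
qed

definition is_kernel :: "(complex ^ 'n \<Rightarrow> complex ^ 'n \<Rightarrow> complex) \<Rightarrow> bool" where
  "is_kernel K \<longleftrightarrow>
     (\<forall>w\<in>U. (\<lambda>z. K z w) \<in> A2) \<and>
     (\<forall>f\<in>A2. \<forall>w\<in>U. f w = (\<integral>z. f z * cnj (K z w) \<partial>M)) \<and>
     (\<forall>z w. z \<notin> U \<or> w \<notin> U \<longrightarrow> K z w = 0)"

text \<open>For fixed w the difference of the two sections represents the zero functional, hence is
  orthogonal to itself; \<open>A2_eval\<close> turns norm 0 into pointwise 0.\<close>

lemma is_kernel_unique:
  assumes "is_kernel K" "is_kernel L"
  shows "K = L"
proof (intro ext)
  fix z w
  show "K z w = L z w"
  proof (cases "z \<in> U \<and> w \<in> U")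
    case True
    have KA: "(\<lambda>z. K z w) \<in> A2" "(\<lambda>z. L z w) \<in> A2" using assms True by (auto simp: is_kernel_def)
    have rep: "ip g (\<lambda>z. K z w) = ip g (\<lambda>z. L z w)" if "g \<in> A2" for g
      using assms that True unfolding is_kernel_def ip_def by (metis (no_types, lifting))
    let ?d = "\<lambda>z. K z w - L z w"
    have d: "?d \<in> A2" using KA by (rule A2_diff)
    have "ip ?d ?d = cnj (ip ?d (\<lambda>z. K z w)) - cnj (ip ?d (\<lambda>z. L z w))"
      using ip_diff_left[OF KA d] ip_cnj by metis
    then have n0: "nrm ?d = 0" using rep[OF d] by (simp add: ip_self)
    obtain R where R: "0 < R" "ball z R \<subseteq> U" using sub_balls[of z] True by blast
    show ?thesis using A2_eval[OF d R] n0 ball_vol_pos[OF R(1)] by (simp add: mult_le_0_iff)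
  qed (use assms in \<open>auto simp: is_kernel_def\<close>)
qed

lemma is_kernel_exists: "\<exists>K. is_kernel K"
proof -
  obtain k where k: "\<And>w. w \<in> U \<Longrightarrow> k w \<in> A2" "\<And>w g. w \<in> U \<Longrightarrow> g \<in> A2 \<Longrightarrow> g w = ip g (k w)"
    using representer by metis
  let ?K = "\<lambda>z w. if z \<in> U \<and> w \<in> U then k w z else 0"
  have "(\<lambda>z. ?K z w) \<in> A2" if w: "w \<in> U" for w
    unfolding A2_iff
  proof
    show "hol_fun (\<lambda>z. ?K z w) U"
      by (rule hol_fun_cong[OF open_U A2_hol[OF k(1)[OF w]]]) (use w in auto)
    show "integrable M (\<lambda>z. (cmod (?K z w))\<^sup>2)"
      using A2_integrable[OF k(1)[OF w]] by (rule Bochner_Integration.integrable_cong[THEN iffD1, rotated -1]) (use w in auto)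
  qed
  moreover have "f w = (\<integral>z. f z * cnj (?K z w) \<partial>M)" if "f \<in> A2" "w \<in> U" for f w
    using k(2)[OF that(2,1)] that unfolding ip_def
    by (subst Bochner_Integration.integral_cong[OF refl, where g = "\<lambda>z. f z * cnj (k w z)"]) auto
  ultimately have "is_kernel ?K" unfolding is_kernel_def by auto
  then show ?thesis by blast
qed

section \<open>Elementary bounds for the kernel\<close>

abbreviation K :: "complex ^ 'n \<Rightarrow> complex ^ 'n \<Rightarrow> complex" where "K \<equiv> bergman_kernel U"
abbreviation kd :: "complex ^ 'n \<Rightarrow> real" where "kd \<equiv> bergman_diag U"

lemma is_kernel_K: "is_kernel K"
proof -
  have "K = (THE K. is_kernel K)" unfolding bergman_kernel_def is_kernel_def ..
  moreover have "\<exists>!K. is_kernel K"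
    by (rule ex_ex1I[OF is_kernel_exists is_kernel_unique])
  then have "is_kernel (THE K. is_kernel K)" by (rule theI')
  ultimately show ?thesis by simp
qed

lemma K_A2: "w \<in> U \<Longrightarrow> (\<lambda>z. K z w) \<in> A2"
  using is_kernel_K by (simp add: is_kernel_def)

lemma K_reproducing: "f \<in> A2 \<Longrightarrow> w \<in> U \<Longrightarrow> ip f (\<lambda>z. K z w) = f w"
  using is_kernel_K by (simp add: is_kernel_def ip_def)

lemma K_hermitian: "z \<in> U \<Longrightarrow> w \<in> U \<Longrightarrow> K w z = cnj (K z w)"
  using K_reproducing[OF K_A2[of w], of z] K_reproducing[OF K_A2[of z], of w]
    ip_cnj[of "\<lambda>x. K x z" "\<lambda>x. K x w"] by simp

lemma nrm_K: "w \<in> U \<Longrightarrow> nrm (\<lambda>z. K z w) = kd w"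
  using K_reproducing[OF K_A2[of w], of w] ip_self[of "\<lambda>z. K z w"]
  unfolding bergman_diag_def by (metis Re_complex_of_real)

lemma K_diag: "w \<in> U \<Longrightarrow> K w w = of_real (kd w)"
  using K_reproducing[OF K_A2[of w], of w] ip_self[of "\<lambda>z. K z w"] nrm_K[of w] by simp

lemma eval_le: "f \<in> A2 \<Longrightarrow> w \<in> U \<Longrightarrow> (cmod (f w))\<^sup>2 \<le> nrm f * kd w"
  using cauchy_schwarz[OF _ K_A2, of f w] K_reproducing nrm_K by simp

lemma kd_pos: assumes w: "w \<in> U" shows "0 < kd w"
proof -
  have "1 \<le> nrm (\<lambda>z. 1) * kd w" using eval_le[OF one_A2 w] by simp
  then show ?thesis using nrm_nonneg[of "\<lambda>z. 1"] mult_nonneg_nonpos[of "nrm (\<lambda>z. 1)" "kd w"]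
    by linarith
qed

lemma K_bound: "z \<in> U \<Longrightarrow> w \<in> U \<Longrightarrow> (cmod (K z w))\<^sup>2 \<le> kd z * kd w"
  using eval_le[OF K_A2[of w], of z] nrm_K[of w] by (simp add: mult.commute)

text \<open>K(.,w) has squared norm K(w,w) and value K(w,w) at w, so \<open>A2_eval\<close> gives an
  inequality with K(w,w) squared on the left and K(w,w) on the right.\<close>

lemma kd_bound:
  assumes R: "0 < R" "ball w R \<subseteq> U"
  shows "kd w \<le> 1 / ball_vol R"
proof -
  have w: "w \<in> U" using R by auto
  have "(kd w)\<^sup>2 * ball_vol R \<le> kd w"
    using A2_eval[OF K_A2[OF w] R] nrm_K[OF w] K_diag[OF w] by simp
  then have "kd w * ball_vol R \<le> 1" using kd_pos[OF w] by (simp add: power2_eq_square)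
  then show ?thesis using ball_vol_pos[OF R(1)] by (simp add: pos_le_divide_eq)
qed

text \<open>Antiholomorphy comes from hermitian symmetry. Joint local boundedness comes from
  |K(z,w)|^2 \<le> K(z,z) K(w,w) and the bound for the diagonal by volumes of Euclidean
  balls.\<close>

lemma sesq_K: "sesq K U"
  unfolding sesq_def
proof (intro conjI ballI)
  show "hol_fun (\<lambda>z. K z w) U" if "w \<in> U" for w using K_A2[OF that] by (rule A2_hol)
  show "hol_fun (\<lambda>w. cnj (K z w)) U" if "z \<in> U" for z
    by (rule hol_fun_cong[OF open_U A2_hol[OF K_A2[OF that]]]) (rule K_hermitian[OF that])
next
  fix a b assume "a \<in> U" "b \<in> U"
  then obtain R1 R2 where R1: "0 < R1" "\<forall>y\<in>ball a R1. ball y R1 \<subseteq> U" "ball a R1 \<subseteq> U"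
    and R2: "0 < R2" "\<forall>y\<in>ball b R2. ball y R2 \<subseteq> U" "ball b R2 \<subseteq> U"
    using sub_balls[of a] sub_balls[of b] by blast
  have "cmod (K z w) \<le> sqrt (1 / ball_vol R1 * (1 / ball_vol R2))"
    if z: "z \<in> ball a R1" and w: "w \<in> ball b R2" for z w
  proof (rule real_le_rsqrt)
    have zw: "z \<in> U" "w \<in> U" using z w R1(3) R2(3) by blast+
    then have "(cmod (K z w))\<^sup>2 \<le> kd z * kd w" by (rule K_bound)
    also have "\<dots> \<le> 1 / ball_vol R1 * (1 / ball_vol R2)"
      using kd_bound[OF R1(1) R1(2)[rule_format, OF z]] kd_bound[OF R2(1) R2(2)[rule_format, OF w]]
        kd_pos[OF zw(2)] ball_vol_pos[OF R1(1)]
      by (intro mult_mono) (auto simp: less_imp_le)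
    finally show "(cmod (K z w))\<^sup>2 \<le> 1 / ball_vol R1 * (1 / ball_vol R2)" .
  qed
  note bd = this
  show "\<exists>R>0. \<exists>M. ball a R \<subseteq> U \<and> ball b R \<subseteq> U \<and> (\<forall>z\<in>ball a R. \<forall>w\<in>ball b R. cmod (K z w) \<le> M)"
  proof (rule exI[of _ "min R1 R2"], intro conjI exI ballI)
    have sub: "ball a (min R1 R2) \<subseteq> ball a R1" "ball b (min R1 R2) \<subseteq> ball b R2" by auto
    then show "ball a (min R1 R2) \<subseteq> U" "ball b (min R1 R2) \<subseteq> U" using R1(3) R2(3) by blast+
    show "cmod (K z w) \<le> sqrt (1 / ball_vol R1 * (1 / ball_vol R2))"
      if "z \<in> ball a (min R1 R2)" "w \<in> ball b (min R1 R2)" for z w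
      using sub that by (intro bd) auto
  qed (use R1 R2 in auto)
qed

lemma kd_continuous: "continuous_on U kd"
proof -
  have "continuous_on U (\<lambda>z. Re (K z z))" by (intro continuous_intros sesq_diag_continuous sesq_K)
  then show ?thesis by (simp add: bergman_diag_def[abs_def])
qed

lemma kd_measurable [measurable]: "kd \<in> borel_measurable M"
  by (rule continuous_measurable[OF kd_continuous])

end

section \<open>The Bergman metric\<close>

lemma dd_cong:
  assumes "open U" "z \<in> U" "hol_fun f U" "\<And>y. y \<in> U \<Longrightarrow> f y = g y"
  shows "dd f z v = dd g z v"
proof -
  have "(g has_derivative dd f z) (at z)"
    by (rule has_derivative_transform_within_open[OF hol_fun_has_derivative[OF assms(3,2)] assms(1,2)]) (rule assms(4))
  from dd_eqI[OF this] show ?thesis by simp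
qed

lemma dd_add: "hol_fun f U \<Longrightarrow> hol_fun g U \<Longrightarrow> z \<in> U \<Longrightarrow> dd (\<lambda>z. f z + g z) z v = dd f z v + dd g z v"
  by (intro dd_eqI[where f' = "\<lambda>v. dd f z v + dd g z v"] has_derivative_add hol_fun_has_derivative)

lemma dd_mult:
  "hol_fun f U \<Longrightarrow> hol_fun g U \<Longrightarrow> z \<in> U \<Longrightarrow> dd (\<lambda>z. f z * g z) z v = f z * dd g z v + dd f z v * g z"
  by (intro dd_eqI[where f' = "\<lambda>v. f z * dd g z v + dd f z v * g z"] has_derivative_mult hol_fun_has_derivative)

lemma dd_const: "dd (\<lambda>z. c) z v = 0"
  by (rule dd_eqI[where f' = "\<lambda>v. 0"]) (rule has_derivative_const)

lemma dd_cmult: "hol_fun f U \<Longrightarrow> z \<in> U \<Longrightarrow> dd (\<lambda>z. c * f z) z v = c * dd f z v"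
  using dd_mult[OF hol_fun_const, of f U z c v] by (simp add: dd_const)

lemma dd_sum:
  "(\<And>i. i \<in> I \<Longrightarrow> hol_fun (f i) U) \<Longrightarrow> z \<in> U \<Longrightarrow> dd (\<lambda>z. \<Sum>i\<in>I. f i z) z v = (\<Sum>i\<in>I. dd (f i) z v)"
  by (intro dd_eqI[where f' = "\<lambda>v. \<Sum>i\<in>I. dd (f i) z v"] has_derivative_sum hol_fun_has_derivative)

lemma dd_comp:
  fixes \<psi> :: "complex ^ 'n \<Rightarrow> complex ^ 'n"
  assumes "hol_fun f U'" "hol_map \<psi> U" "\<psi> z \<in> U'" "z \<in> U"
  shows "dd (\<lambda>z. f (\<psi> z)) z v = dd f (\<psi> z) (complex_jacobian \<psi> z *v v)"
  by (rule dd_eqI[where f' = "\<lambda>v. dd f (\<psi> z) (complex_jacobian \<psi> z *v v)"])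
     (rule has_derivative_compose[OF hol_map_has_derivative[OF assms(2,4)] hol_fun_has_derivative[OF assms(1,3)]])

lemma axis_i: "axis j \<i> = \<i> *s (axis j 1 :: complex ^ 'n)"
  by (simp add: vec_eq_iff axis_def)

text \<open>A real derivative is the sum of a complex-linear part p and the conjugate of a
  complex-linear part q. As the second real direction is \<i> times the first, each Wirtinger
  combination keeps one part and cancels the other.\<close>

lemma wirtinger_eq:
  assumes d: "(F has_derivative (\<lambda>h. p h + cnj (q h))) (at z)"
    and p: "\<And>c v. p (c *s v) = c * p v" and q: "\<And>c v. q (c *s v) = c * q v"
  shows "wirtinger j F z = p (axis j 1)" and "wirtinger_bar j F z = cnj (q (axis j 1))"
  unfolding wirtinger_def wirtinger_bar_def frechet_derivative_at[OF d, symmetric] axis_i p q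
  by (simp_all add: algebra_simps)

text \<open>The conjugation makes the inner derivative holomorphic in \<open>x\<close>; for a hermitian kernel \<open>L\<close> this is
  the mixed derivative of \<open>L\<close> at \<open>(z, z)\<close>, in direction \<open>u\<close> and conjugate direction \<open>v\<close>.\<close>

definition mixed :: "(complex ^ 'n \<Rightarrow> complex ^ 'n \<Rightarrow> complex) \<Rightarrow> complex ^ 'n \<Rightarrow> complex ^ 'n \<Rightarrow> complex ^ 'n \<Rightarrow> complex" where
  "mixed L z u v = dd (\<lambda>x. cnj (dd (\<lambda>y. L y x) z v)) z u"

lemma sesq_cnj_dd: "sesq L U \<Longrightarrow> open U \<Longrightarrow> sesq (\<lambda>x w. cnj (dd (\<lambda>y. L y x) w v)) U"
  by (rule sesq_swap[OF sesq_dd])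

lemma mixed_expand:
  assumes L: "sesq L U" and U: "open U" and z: "z \<in> U"
  shows "mixed L z v v = (\<Sum>i\<in>UNIV. \<Sum>j\<in>UNIV. mixed L z (axis i 1) (axis j 1) * v $ i * cnj (v $ j))"
proof -
  let ?l = "\<lambda>j x. cnj (dd (\<lambda>y. L y x) z (axis j 1))"
  have h: "hol_fun (\<lambda>x. cnj (dd (\<lambda>y. L y x) z v)) U" for v
    by (rule sesqD1[OF sesq_cnj_dd[OF L U] z])
  have "mixed L z v v = dd (\<lambda>x. \<Sum>j\<in>UNIV. cnj (v $ j) * ?l j x) z v"
    unfolding mixed_def
  proof (rule dd_cong[OF U z h])
    fix x assume "x \<in> U"
    then show "cnj (dd (\<lambda>y. L y x) z v) = (\<Sum>j\<in>UNIV. cnj (v $ j) * ?l j x)"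
      by (subst dd_sum_axis[OF sesqD1[OF L] z]) auto
  qed
  also have "\<dots> = (\<Sum>j\<in>UNIV. dd (\<lambda>x. cnj (v $ j) * ?l j x) z v)"
    by (rule dd_sum[OF hol_fun_cmult[OF h] z])
  also have "\<dots> = (\<Sum>j\<in>UNIV. cnj (v $ j) * dd (?l j) z v)"
    by (intro sum.cong refl dd_cmult[OF h z])
  also have "\<dots> = (\<Sum>j\<in>UNIV. \<Sum>i\<in>UNIV. mixed L z (axis i 1) (axis j 1) * v $ i * cnj (v $ j))"
    by (subst dd_sum_axis[OF h z]) (simp add: mixed_def sum_distrib_left mult_ac)
  also have "\<dots> = (\<Sum>i\<in>UNIV. \<Sum>j\<in>UNIV. mixed L z (axis i 1) (axis j 1) * v $ i * cnj (v $ j))"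
    by (rule sum.swap)
  finally show ?thesis .
qed

text \<open>A second derivative test: \<open>L\<close> at \<open>x + e v\<close> is \<open>e\<^sup>2\<close> times the mixed derivative up to \<open>O(e\<^sup>3)\<close>.\<close>

lemma mixed_nonneg:
  assumes L: "sesq L U" and U: "open U" and x: "x \<in> U"
    and zero: "\<And>z. z \<in> U \<Longrightarrow> L z x = 0" "\<And>z. z \<in> U \<Longrightarrow> L x z = 0"
    and nonneg: "\<And>z. z \<in> U \<Longrightarrow> 0 \<le> Re (L z z)"
  shows "0 \<le> Re (mixed L x v v)"
proof -
  obtain R B where R: "0 < R" "ball x R \<subseteq> U"
    and B: "\<And>y w. y \<in> ball x R \<Longrightarrow> w \<in> ball x R \<Longrightarrow> cmod (L y w) \<le> B"
    by (rule sesqD3[OF L x x]; blast)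
  have xR: "x \<in> ball x R" "x \<in> ball x (R/2)" using R by auto
  have B0: "0 \<le> B" using B[OF xR(1) xR(1)] by (meson norm_ge_zero order_trans)
  obtain e where e: "\<And>n. 0 < e n" "\<And>n. e n * norm v \<le> R / 8" "\<And>n. e n \<le> 1" "e \<longlonglongrightarrow> 0"
    using small_steps[of R "norm v"] R by auto
  define y where "y n = x + of_real (e n) *s v" for n
  define m where "m w = cnj (dd (\<lambda>y. L y w) x v)" for w
  have hm: "hol_fun m U" unfolding m_def by (rule sesqD1[OF sesq_cnj_dd[OF L U] x])
  \<comment> \<open>The vanishing of L(.,x) makes m(y) / e a difference quotient of the holomorphic
    function m at x, so that it converges.\<close>
  have mx: "m x = 0"
  proof -
    have "dd (\<lambda>y. L y x) x v = dd (\<lambda>y. 0) x v"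
      by (rule dd_cong[OF U x sesqD1[OF L x]]) (rule zero(1))
    then show ?thesis by (simp add: m_def dd_const)
  qed
  have nv: "norm (of_real (e n) *s v) = e n * norm v" for n using e(1)[of n] by (simp add: norm_vector_scalar)
  have yb: "y n \<in> ball x R" "y n \<in> ball x (R/2)" for n
    using e(2)[of n] R by (auto simp: y_def dist_norm nv)
  have yU: "y n \<in> U" for n using yb R by auto
  have h1: "hol_fun (\<lambda>y. L y w) (ball x R)" if "w \<in> U" for w
    using sesqD1[OF L that] R(2) by (rule hol_fun_subset)
  \<comment> \<open>Because L(.,x) = 0, the Lipschitz bound in the second variable gives |L(.,y)|
    \<le> (2B/R) e |v| on the ball. The second-order remainder, with its factor 8/R^2, is then cubic
    in e, and 16 = 8 times 2.\<close>
  define C where "C = 16 * B / R ^ 3 * norm v ^ 3"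
  have est: "cmod (L (y n) (y n) / of_real ((e n)\<^sup>2) - cnj (m (y n) / of_real (e n))) \<le> C * e n" for n
  proof -
    have lip: "cmod (L z (y n)) \<le> 2 * B / R * (e n * norm v)" if z: "z \<in> ball x R" for z
    proof -
      have zU: "z \<in> U" using z R by auto
      have "cmod (cnj (L z (y n)) - cnj (L z x)) \<le> 2 * B / R * norm (y n - x)"
      proof (rule hol_lipschitz[OF _ _ yb(2) xR(2)])
        show "hol_fun (\<lambda>w. cnj (L z w)) (ball x R)"
          using sesqD2[OF L zU] R(2) by (rule hol_fun_subset)
      qed (use B[OF z] in auto)
      then show ?thesis using zero(1)[OF zU] by (simp add: y_def nv)
    qed
    have "cmod (L (x + of_real (e n) *s v) (y n) - L x (y n) - dd (\<lambda>t. L t (y n)) x (of_real (e n) *s v))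
        \<le> 8 * (2 * B / R * (e n * norm v)) / R\<^sup>2 * (norm (of_real (e n) *s v))\<^sup>2"
      by (rule second_order_bound[OF h1[OF yU] R(1) lip]) (use nv e(2)[of n] R in auto)
    then have s: "cmod (L (y n) (y n) - of_real (e n) * cnj (m (y n))) \<le> C * e n * (e n)\<^sup>2"
      unfolding nv dd_scale[OF h1[OF yU] xR(1)] using zero(2)[OF yU] R
      by (simp add: y_def[symmetric] m_def C_def power2_eq_square power3_eq_cube mult_ac)
    have "L (y n) (y n) / of_real ((e n)\<^sup>2) - cnj (m (y n) / of_real (e n))
      = (L (y n) (y n) - of_real (e n) * cnj (m (y n))) / of_real ((e n)\<^sup>2)"
      using e(1)[of n] by (simp add: field_simps power2_eq_square)
    then have "cmod (L (y n) (y n) / of_real ((e n)\<^sup>2) - cnj (m (y n) / of_real (e n)))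
      = cmod (L (y n) (y n) - of_real (e n) * cnj (m (y n))) / (e n)\<^sup>2"
      by (simp add: norm_divide norm_power)
    also have "\<dots> \<le> C * e n" using s e(1)[of n] by (simp add: pos_divide_le_eq)
    finally show ?thesis .
  qed
  have slice: "((\<lambda>c. m (x + c *s v)) has_field_derivative dd m x v) (at 0)"
    using slice_deriv[OF hm, of x 0 v] x by simp
  have "filterlim (\<lambda>n. complex_of_real (e n)) (at 0) sequentially"
    unfolding filterlim_at using e(1) tendsto_of_real[OF e(4), where 'a = complex]
    by (simp add: less_imp_neq[symmetric])
  from filterlim_compose[OF slice[unfolded has_field_derivative_iff] this]
  have "(\<lambda>n. (m (x + of_real (e n) *s v) - m (x + 0 *s v)) / (of_real (e n) - 0)) \<longlonglongrightarrow> dd m x v" .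
  then have q: "(\<lambda>n. m (y n) / of_real (e n)) \<longlonglongrightarrow> dd m x v" by (simp add: mx y_def)
  have "(\<lambda>n. C * e n) \<longlonglongrightarrow> C * 0" by (intro tendsto_intros e)
  then have "(\<lambda>n. L (y n) (y n) / of_real ((e n)\<^sup>2) - cnj (m (y n) / of_real (e n))) \<longlonglongrightarrow> 0"
    by (intro Lim_null_comparison[OF always_eventually[OF allI[OF est]]]) auto
  from tendsto_add[OF this tendsto_cnj[OF q]]
  have "(\<lambda>n. L (y n) (y n) / of_real ((e n)\<^sup>2)) \<longlonglongrightarrow> cnj (dd m x v)" by simp
  from tendsto_Re[OF this] have "(\<lambda>n. Re (L (y n) (y n) / of_real ((e n)\<^sup>2))) \<longlonglongrightarrow> Re (dd m x v)" by simp
  moreover have "0 \<le> Re (L (y n) (y n) / of_real ((e n)\<^sup>2))" for n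
    using nonneg[OF yU[of n]] by (simp add: Re_divide_of_real del: of_real_power)
  ultimately have "0 \<le> Re (dd m x v)" by (intro LIMSEQ_le_const) auto
  then show ?thesis by (simp add: mixed_def m_def[abs_def])
qed

section \<open>Transformation laws and explicit formulas for the metric\<close>

context bounded_domain
begin

text \<open>Composition with \<psi> followed by multiplication by J preserves square-integrable
  holomorphic functions and their norm. Hence the right side, extended by zero, has the properties
  that characterise the kernel.\<close>

lemma K_transform:
  assumes psi: "automorphism U \<psi>" and z: "z \<in> U" and w: "w \<in> U"
  shows "K z w = jac \<psi> z * K (\<psi> z) (\<psi> w) * cnj (jac \<psi> w)"
proof -
  interpret A: automorphism U \<psi> by fact
  let ?J = "jac \<psi>"
  let ?L = "\<lambda>z w. if z \<in> U \<and> w \<in> U then ?J z * K (\<psi> z) (\<psi> w) * cnj (?J w) else 0"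
  have pull: "(\<lambda>z. ?J z * g (\<psi> z)) \<in> A2" if g: "g \<in> A2" for g
  proof -
    have h: "hol_fun (\<lambda>z. ?J z * g (\<psi> z)) U"
      by (intro hol_fun_mult A.hol_jac hol_fun_comp[OF A2_hol[OF g] A.hol]) (simp add: A.image_U)
    have "(\<integral>\<^sup>+z. ennreal ((cmod (?J z * g (\<psi> z)))\<^sup>2) \<partial>M)
        = (\<integral>\<^sup>+z. ennreal ((cmod (g (\<psi> z)))\<^sup>2) * ennreal ((cmod (?J z))\<^sup>2) \<partial>M)"
      by (intro nn_integral_cong) (simp add: norm_mult power_mult_distrib ennreal_mult' mult.commute)
    also have "\<dots> = (\<integral>\<^sup>+z. ennreal ((cmod (g z))\<^sup>2) \<partial>M)"
      by (rule A.nn_integral_change[where g = "\<lambda>z. ennreal ((cmod (g z))\<^sup>2)"]) (use A2_measurable[OF g] in measurable)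
    also have "\<dots> < \<infinity>" by (simp add: nn_nrm[OF g])
    finally show ?thesis unfolding square_integrable_hol_def using h by blast
  qed
  have "(\<lambda>z. ?L z w) \<in> A2" if w: "w \<in> U" for w
  proof -
    have "(\<lambda>z. cnj (?J w) * (?J z * K (\<psi> z) (\<psi> w))) \<in> A2"
      by (rule A2_cmult[OF pull[OF K_A2[OF A.maps_to[OF w]]]])
    then show ?thesis unfolding A2_iff
    proof (elim conjE, intro conjI)
      assume h: "hol_fun (\<lambda>z. cnj (?J w) * (?J z * K (\<psi> z) (\<psi> w))) U"
        and i: "integrable M (\<lambda>z. (cmod (cnj (?J w) * (?J z * K (\<psi> z) (\<psi> w))))\<^sup>2)"
      show "hol_fun (\<lambda>z. ?L z w) U" by (rule hol_fun_cong[OF open_U h]) (use w in simp)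
      show "integrable M (\<lambda>z. (cmod (?L z w))\<^sup>2)"
        by (rule Bochner_Integration.integrable_cong[THEN iffD1, OF refl _ i]) (use w in \<open>simp add: mult_ac\<close>)
    qed
  qed
  moreover have "f w = (\<integral>z. f z * cnj (?L z w) \<partial>M)" if f: "f \<in> A2" and w: "w \<in> U" for f w
  proof -
    \<comment> \<open>The function whose pull-back, J times its composition with \<psi>, is f:
      reproducing \<open>?g\<close> at \<psi>(w) with K and changing variables reproduces f at w
      with \<open>?L\<close>.\<close>
    let ?g = "\<lambda>y. f (A.\<phi> y) * inverse (?J (A.\<phi> y))"
    have hg: "hol_fun ?g U"
      by (intro hol_fun_mult hol_fun_inverse hol_fun_comp[OF A2_hol[OF f] A.hol_inv] hol_fun_comp[OF A.hol_jac A.hol_inv])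
         (auto simp: A.inv_maps_to A.jac_nz)
    note [measurable] = hol_measurable[OF hg] A2_measurable[OF f]
    have "(\<integral>\<^sup>+y. ennreal ((cmod (?g y))\<^sup>2) \<partial>M) = (\<integral>\<^sup>+z. ennreal ((cmod (?g (\<psi> z)))\<^sup>2) * ennreal ((cmod (?J z))\<^sup>2) \<partial>M)"
      by (rule A.nn_integral_change[where g = "\<lambda>z. ennreal ((cmod (?g z))\<^sup>2)", symmetric]) measurable
    also have "\<dots> = (\<integral>\<^sup>+z. ennreal ((cmod (f z))\<^sup>2) \<partial>M)"
      by (intro nn_integral_cong)
         (simp add: A.jac_nz norm_mult norm_inverse ennreal_mult'[symmetric] power_mult_distrib[symmetric])
    also have "\<dots> < \<infinity>" by (simp add: nn_nrm[OF f])
    finally have g: "?g \<in> A2" unfolding square_integrable_hol_def using hg by blast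
    note [measurable] = A2_measurable[OF K_A2[OF A.maps_to[OF w]]]
    have "f w = ?J w * ?g (\<psi> w)" using w A.jac_nz[OF w] by simp
    also have "?g (\<psi> w) = (\<integral>y. ?g y * cnj (K y (\<psi> w)) \<partial>M)"
      using K_reproducing[OF g A.maps_to[OF w]] by (simp add: ip_def)
    also have "\<dots> = (\<integral>z. of_real ((cmod (?J z))\<^sup>2) * (?g (\<psi> z) * cnj (K (\<psi> z) (\<psi> w))) \<partial>M)"
      by (rule A.integral_change[where g = "\<lambda>y. ?g y * cnj (K y (\<psi> w))", symmetric]) measurable
    also have "?J w * \<dots> = (\<integral>z. ?J w * (of_real ((cmod (?J z))\<^sup>2) * (?g (\<psi> z) * cnj (K (\<psi> z) (\<psi> w)))) \<partial>M)"
      by simp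
    also have "\<dots> = (\<integral>z. f z * cnj (?L z w) \<partial>M)"
      by (rule Bochner_Integration.integral_cong[OF refl])
         (use w in \<open>simp add: A.jac_nz complex_norm_square field_simps del: of_real_power\<close>)
    finally show ?thesis .
  qed
  ultimately have "is_kernel ?L" unfolding is_kernel_def by auto
  from arg_cong[OF is_kernel_unique[OF is_kernel_K this], of "\<lambda>F. F z w"]
  show ?thesis using z w by (simp only: simp_thms if_True)
qed

lemma kd_transform:
  assumes "automorphism U \<psi>" "z \<in> U"
  shows "kd z = (cmod (jac \<psi> z))\<^sup>2 * kd (\<psi> z)"
proof -
  interpret A: automorphism U \<psi> by fact
  have "complex_of_real (kd z) = of_real ((cmod (jac \<psi> z))\<^sup>2 * kd (\<psi> z))"
    using K_transform[OF assms(1,2,2)] assms(2)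
    by (simp add: K_diag[OF assms(2)] K_diag[OF A.maps_to[OF assms(2)]] complex_norm_square mult_ac del: of_real_power)
  then show ?thesis by (simp only: of_real_eq_iff)
qed

text \<open>The numerator of the holomorphic derivative of ln K(z,z): \<open>K1 z v / kd z\<close>
  is that derivative in direction v.\<close>

definition K1 :: "complex ^ 'n \<Rightarrow> complex ^ 'n \<Rightarrow> complex" where
  "K1 z v = dd (\<lambda>y. K y z) z v"

lemma K1_scale: "z \<in> U \<Longrightarrow> K1 z (c *s v) = c * K1 z v"
  unfolding K1_def by (rule dd_scale[OF sesqD1[OF sesq_K]])

lemma kd_has_derivative:
  assumes z: "z \<in> U"
  shows "(kd has_derivative (\<lambda>h. 2 * Re (K1 z h))) (at z)"
proof -
  have "dd (\<lambda>w. cnj (K z w)) z h = K1 z h" for h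
    unfolding K1_def
    by (rule dd_cong[OF open_U z sesqD2[OF sesq_K z]]) (simp add: K_hermitian[OF z])
  then have "((\<lambda>z. K z z) has_derivative (\<lambda>h. K1 z h + cnj (K1 z h))) (at z)"
    using sesq_diag_derivative[OF sesq_K z] by (simp add: K1_def)
  from bounded_linear.has_derivative[OF bounded_linear_Re this]
  show ?thesis by (simp add: bergman_diag_def[abs_def])
qed

lemma ln_kd_has_derivative:
  assumes z: "z \<in> U"
  shows "((\<lambda>u. ln (kd u)) has_derivative (\<lambda>h. 2 * Re (K1 z h) / kd z)) (at z)"
  using has_derivative_compose[OF kd_has_derivative[OF z] DERIV_ln[OF kd_pos[OF z], unfolded has_field_derivative_def]]
  by (simp add: divide_inverse mult.commute)

lemma wirtinger_bar_ln_kd: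
  assumes z: "z \<in> U"
  shows "wirtinger_bar j (\<lambda>u. complex_of_real (ln (kd u))) z = cnj (K1 z (axis j 1)) * of_real (inverse (kd z))"
proof -
  have "((\<lambda>u. complex_of_real (ln (kd u))) has_derivative (\<lambda>h. of_real (2 * Re (K1 z h) / kd z))) (at z)"
    by (rule bounded_linear.has_derivative[OF bounded_linear_of_real ln_kd_has_derivative[OF z]])
  also have "(\<lambda>h. complex_of_real (2 * Re (K1 z h) / kd z))
     = (\<lambda>h. K1 z h * of_real (inverse (kd z)) + cnj (K1 z h * of_real (inverse (kd z))))"
    by (auto simp: fun_eq_iff complex_eq_iff divide_inverse)
  finally show ?thesis
    by (subst wirtinger_eq(2)[where q = "\<lambda>h. K1 z h * of_real (inverse (kd z))"]) (auto simp: K1_scale[OF z])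
qed

lemma bergman_metric_eq:
  assumes z: "z \<in> U"
  shows "bergman_metric U z $ i $ j
    = mixed K z (axis i 1) (axis j 1) * of_real (inverse (kd z))
      - K1 z (axis i 1) * cnj (K1 z (axis j 1)) * of_real ((inverse (kd z))\<^sup>2)"
proof -
  let ?e = "axis j 1 :: complex ^ 'n"
  let ?L = "\<lambda>x w. cnj (dd (\<lambda>y. K y x) w ?e)"
  let ?k = "of_real (inverse (kd z)) :: complex"
  have L: "sesq ?L U" by (rule sesq_cnj_dd[OF sesq_K open_U])
  let ?p = "dd (\<lambda>x. ?L x z) z" and ?q = "dd (\<lambda>w. cnj (?L z w)) z"
  have dL: "((\<lambda>u. cnj (K1 u ?e)) has_derivative (\<lambda>h. ?p h + cnj (?q h))) (at z)"
    using sesq_diag_derivative[OF L z] by (simp add: K1_def)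
  have "((\<lambda>u. inverse (kd u)) has_derivative (\<lambda>h. - (inverse (kd z) * (2 * Re (K1 z h)) * inverse (kd z)))) (at z)"
    by (rule Deriv.has_derivative_inverse[OF _ kd_has_derivative[OF z]]) (use kd_pos[OF z] in simp)
  from bounded_linear.has_derivative[OF bounded_linear_of_real this]
  have "((\<lambda>u. complex_of_real (inverse (kd u))) has_derivative (\<lambda>h. of_real (- (inverse (kd z) * (2 * Re (K1 z h)) * inverse (kd z))))) (at z)" .
  from has_derivative_mult[OF dL this]
  have "((\<lambda>u. cnj (K1 u ?e) * of_real (inverse (kd u))) has_derivative
      (\<lambda>h. cnj (K1 z ?e) * of_real (- (inverse (kd z) * (2 * Re (K1 z h)) * inverse (kd z)))
         + (?p h + cnj (?q h)) * of_real (inverse (kd z)))) (at z)" .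
  then have "((\<lambda>u. wirtinger_bar j (\<lambda>u. complex_of_real (ln (kd u))) u) has_derivative
      (\<lambda>h. cnj (K1 z ?e) * of_real (- (inverse (kd z) * (2 * Re (K1 z h)) * inverse (kd z)))
         + (?p h + cnj (?q h)) * of_real (inverse (kd z)))) (at z)"
    by (rule has_derivative_transform_within_open[OF _ open_U z]) (simp add: wirtinger_bar_ln_kd)
  \<comment> \<open>Sorting into a complex-linear part and the conjugate of one, as
    \<open>wirtinger_eq\<close> requires. The real factor 2 Re \<open>K1 z h\<close>, equal to
    \<open>K1 z h\<close> plus its conjugate, contributes to both.\<close>
  also have "(\<lambda>h. cnj (K1 z ?e) * of_real (- (inverse (kd z) * (2 * Re (K1 z h)) * inverse (kd z)))
         + (?p h + cnj (?q h)) * of_real (inverse (kd z)))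
      = (\<lambda>h. (?p h * ?k - K1 z h * cnj (K1 z ?e) * ?k\<^sup>2) + cnj (?q h * ?k - K1 z h * K1 z ?e * ?k\<^sup>2))"
  proof
    fix h
    have "complex_of_real (2 * Re (K1 z h)) = K1 z h + cnj (K1 z h)" by (simp add: complex_eq_iff)
    then have eq: "of_real (- (inverse (kd z) * (2 * Re (K1 z h)) * inverse (kd z))) = - (?k * (K1 z h + cnj (K1 z h)) * ?k)"
      by (metis of_real_minus of_real_mult)
    show "cnj (K1 z ?e) * of_real (- (inverse (kd z) * (2 * Re (K1 z h)) * inverse (kd z)))
         + (?p h + cnj (?q h)) * of_real (inverse (kd z))
      = (?p h * ?k - K1 z h * cnj (K1 z ?e) * ?k\<^sup>2) + cnj (?q h * ?k - K1 z h * K1 z ?e * ?k\<^sup>2)"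
      unfolding eq by (simp add: algebra_simps power2_eq_square)
  qed
  finally have "wirtinger i (\<lambda>u. wirtinger_bar j (\<lambda>u. complex_of_real (ln (kd u))) u) z
     = ?p (axis i 1) * ?k - K1 z (axis i 1) * cnj (K1 z ?e) * ?k\<^sup>2"
    by (rule wirtinger_eq(1))
       (simp_all add: K1_scale[OF z] dd_scale[OF sesqD1[OF L z] z] dd_scale[OF sesqD2[OF L z, simplified] z] algebra_simps)
  then show ?thesis by (simp add: bergman_metric_def mixed_def)
qed

definition bergman_form :: "complex ^ 'n \<Rightarrow> complex ^ 'n \<Rightarrow> real" where
  "bergman_form z v = Re (mixed K z v v) / kd z - (cmod (K1 z v))\<^sup>2 / (kd z)\<^sup>2"

lemma bergman_norm_eq:
  assumes z: "z \<in> U"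
  shows "bergman_norm U z v = sqrt (bergman_form z v)"
proof -
  let ?k = "of_real (inverse (kd z)) :: complex"
  have K1: "K1 z v = (\<Sum>i\<in>UNIV. v $ i * K1 z (axis i 1))"
    unfolding K1_def by (rule dd_sum_axis[OF sesqD1[OF sesq_K z] z])
  have "(\<Sum>i\<in>UNIV. \<Sum>j\<in>UNIV. bergman_metric U z $ i $ j * v $ i * cnj (v $ j))
    = (\<Sum>i\<in>UNIV. \<Sum>j\<in>UNIV. mixed K z (axis i 1) (axis j 1) * v $ i * cnj (v $ j)) * ?k
      - (\<Sum>i\<in>UNIV. \<Sum>j\<in>UNIV. (v $ i * K1 z (axis i 1)) * cnj (v $ j * K1 z (axis j 1))) * ?k\<^sup>2"
    unfolding sum_distrib_right sum_subtractf[symmetric]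
    by (intro sum.cong refl) (simp add: bergman_metric_eq[OF z] algebra_simps)
  also have "(\<Sum>i\<in>UNIV. \<Sum>j\<in>UNIV. (v $ i * K1 z (axis i 1)) * cnj (v $ j * K1 z (axis j 1))) = K1 z v * cnj (K1 z v)"
    by (simp add: K1 sum_product)
  also have "(\<Sum>i\<in>UNIV. \<Sum>j\<in>UNIV. mixed K z (axis i 1) (axis j 1) * v $ i * cnj (v $ j)) = mixed K z v v"
    by (rule mixed_expand[OF sesq_K open_U z, symmetric])
  also have "K1 z v * cnj (K1 z v) = of_real ((cmod (K1 z v))\<^sup>2)" by (simp add: complex_norm_square del: of_real_power)
  finally have "(\<Sum>i\<in>UNIV. \<Sum>j\<in>UNIV. bergman_metric U z $ i $ j * v $ i * cnj (v $ j))
     = mixed K z v v * ?k - of_real ((cmod (K1 z v))\<^sup>2 * (inverse (kd z))\<^sup>2)" by simp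
  then have "Re (\<Sum>i\<in>UNIV. \<Sum>j\<in>UNIV. bergman_metric U z $ i $ j * v $ i * cnj (v $ j)) = bergman_form z v"
    by (simp only: minus_complex.sel times_complex.sel Re_complex_of_real Im_complex_of_real
        mult_zero_right diff_zero bergman_form_def divide_inverse power_inverse)
  then show ?thesis unfolding bergman_norm_def by simp
qed

lemma dd_K_transform:
  assumes psi: "automorphism U \<psi>" and z: "z \<in> U" and x: "x \<in> U"
  shows "dd (\<lambda>y. K y x) z v = (jac \<psi> z * dd (\<lambda>y. K y (\<psi> x)) (\<psi> z) (complex_jacobian \<psi> z *v v)
      + dd (jac \<psi>) z v * K (\<psi> z) (\<psi> x)) * cnj (jac \<psi> x)"
proof -
  interpret A: automorphism U \<psi> by fact
  note xU = A.maps_to[OF x]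
  have h: "hol_fun (\<lambda>y. K (\<psi> y) (\<psi> x)) U"
    by (rule hol_fun_comp[OF sesqD1[OF sesq_K xU] A.hol]) (simp add: A.image_U)
  have "dd (\<lambda>y. K y x) z v = dd (\<lambda>y. (jac \<psi> y * K (\<psi> y) (\<psi> x)) * cnj (jac \<psi> x)) z v"
    by (rule dd_cong[OF open_U z sesqD1[OF sesq_K x]]) (rule K_transform[OF psi _ x])
  also have "\<dots> = dd (\<lambda>y. jac \<psi> y * K (\<psi> y) (\<psi> x)) z v * cnj (jac \<psi> x)"
    by (subst dd_mult[OF hol_fun_mult[OF A.hol_jac h] hol_fun_const z]) (simp add: dd_const)
  also have "dd (\<lambda>y. jac \<psi> y * K (\<psi> y) (\<psi> x)) z v
     = jac \<psi> z * dd (\<lambda>y. K (\<psi> y) (\<psi> x)) z v + dd (jac \<psi>) z v * K (\<psi> z) (\<psi> x)"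
    by (rule dd_mult[OF A.hol_jac h z])
  also have "dd (\<lambda>y. K (\<psi> y) (\<psi> x)) z v = dd (\<lambda>y. K y (\<psi> x)) (\<psi> z) (complex_jacobian \<psi> z *v v)"
    by (rule dd_comp[OF sesqD1[OF sesq_K xU] A.hol A.maps_to[OF z] z])
  finally show ?thesis .
qed

lemma K1_transform:
  assumes psi: "automorphism U \<psi>" and z: "z \<in> U"
  shows "K1 z v = (dd (jac \<psi>) z v * of_real (kd (\<psi> z)) + jac \<psi> z * K1 (\<psi> z) (complex_jacobian \<psi> z *v v)) * cnj (jac \<psi> z)"
  unfolding K1_def dd_K_transform[OF psi z z]
  by (simp add: K_diag[OF automorphism.maps_to[OF psi z]] add.commute)

lemma mixed_transform:
  fixes v :: "complex ^ 'n"
  assumes psi: "automorphism U \<psi>" and z: "z \<in> U"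
  defines "j \<equiv> jac \<psi> z" and "d \<equiv> dd (jac \<psi>) z v" and "b \<equiv> complex_jacobian \<psi> z *v v"
  shows "mixed K z v v = j * (cnj d * K1 (\<psi> z) b + cnj j * mixed K (\<psi> z) b b)
     + d * (cnj d * of_real (kd (\<psi> z)) + cnj j * cnj (K1 (\<psi> z) b))"
proof -
  interpret A: automorphism U \<psi> by fact
  let ?z = "\<psi> z"
  have zU: "?z \<in> U" by (rule A.maps_to[OF z])
  let ?l = "\<lambda>x. cnj (dd (\<lambda>y. K y x) ?z b)"
  have hl: "hol_fun ?l U" by (rule sesqD1[OF sesq_cnj_dd[OF sesq_K open_U] zU])
  have hk: "hol_fun (\<lambda>x. K x ?z) U" by (rule sesqD1[OF sesq_K zU])
  have hl': "hol_fun (\<lambda>x. ?l (\<psi> x)) U" and hk': "hol_fun (\<lambda>x. K (\<psi> x) ?z) U"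
    by (rule hol_fun_comp[OF hl A.hol] hol_fun_comp[OF hk A.hol], simp add: A.image_U)+
  let ?g = "\<lambda>x. cnj d * K (\<psi> x) ?z + cnj j * ?l (\<psi> x)"
  have hg: "hol_fun ?g U" by (intro hol_fun_add hol_fun_cmult hl' hk')
  have eq: "cnj (dd (\<lambda>y. K y x) z v) = jac \<psi> x * ?g x" if x: "x \<in> U" for x
    unfolding dd_K_transform[OF psi z x] using K_hermitian[OF zU A.maps_to[OF x]]
    by (simp add: j_def d_def b_def algebra_simps)
  have "mixed K z v v = dd (\<lambda>x. jac \<psi> x * ?g x) z v"
    unfolding mixed_def by (rule dd_cong[OF open_U z sesqD1[OF sesq_cnj_dd[OF sesq_K open_U] z] eq])
  also have "\<dots> = j * dd ?g z v + d * ?g z"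
    unfolding j_def d_def by (rule dd_mult[OF A.hol_jac _ z]) (use hg in \<open>simp add: j_def d_def\<close>)
  also have "dd ?g z v = cnj d * dd (\<lambda>x. K (\<psi> x) ?z) z v + cnj j * dd (\<lambda>x. ?l (\<psi> x)) z v"
    by (subst dd_add[OF hol_fun_cmult[OF hk'] hol_fun_cmult[OF hl'] z]) (simp only: dd_cmult[OF hk' z] dd_cmult[OF hl' z])
  also have "dd (\<lambda>x. K (\<psi> x) ?z) z v = K1 ?z b"
    unfolding K1_def b_def by (rule dd_comp[OF hk A.hol zU z])
  also have "dd (\<lambda>x. ?l (\<psi> x)) z v = mixed K ?z b b"
    unfolding mixed_def by (subst dd_comp[OF hl A.hol zU z]) (simp only: b_def)
  finally show ?thesis by (simp add: K_diag[OF zU] K1_def)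
qed

text \<open>ln K(z,z) and ln K(\<psi>(z),\<psi>(z)) differ by ln |J|^2, which is pluriharmonic. In
  the algebra below this appears as the cancellation of all terms containing the derivative d of
  J.\<close>

lemma bergman_form_transform:
  assumes psi: "automorphism U \<psi>" and z: "z \<in> U"
  shows "bergman_form z v = bergman_form (\<psi> z) (complex_jacobian \<psi> z *v v)"
proof -
  interpret A: automorphism U \<psi> by fact
  define j d b k where "j = jac \<psi> z" and "d = dd (jac \<psi>) z v" and "b = complex_jacobian \<psi> z *v v" and "k = kd (\<psi> z)"
  define c h where "c = K1 (\<psi> z) b" and "h = mixed K (\<psi> z) b b"
  have k: "0 < k" unfolding k_def by (rule kd_pos[OF A.maps_to[OF z]])
  have j: "j \<noteq> 0" unfolding j_def by (rule A.jac_nz[OF z])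
  define r where "r = (cmod j)\<^sup>2"
  have r: "0 < r" using j by (simp add: r_def)
  have kz: "kd z = r * k" unfolding r_def j_def k_def by (rule kd_transform[OF psi z])
  have m: "Re (mixed K z v v) = r * Re h + 2 * Re (cnj d * c * j) + (cmod d)\<^sup>2 * k"
    unfolding mixed_transform[OF psi z] r_def
    unfolding j_def[symmetric] d_def[symmetric] b_def[symmetric] k_def[symmetric] c_def[symmetric] h_def[symmetric]
    unfolding cmod_power2 by (simp add: power2_eq_square algebra_simps)
  have n: "(cmod (K1 z v))\<^sup>2 = ((cmod d)\<^sup>2 * k\<^sup>2 + r * (cmod c)\<^sup>2 + 2 * k * Re (cnj d * c * j)) * r"
    unfolding K1_transform[OF psi z] r_def
    unfolding j_def[symmetric] d_def[symmetric] b_def[symmetric] k_def[symmetric] c_def[symmetric]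
    unfolding norm_mult power_mult_distrib complex_mod_cnj cmod_power2
    by (simp add: power2_eq_square algebra_simps)
  show ?thesis
    unfolding bergman_form_def m n kz c_def[symmetric] h_def[symmetric] k_def[symmetric] b_def[symmetric]
    using k r by (simp add: field_simps power2_eq_square)
qed

lemma bergman_norm_transform:
  assumes "automorphism U \<psi>" and "z \<in> U"
  shows "bergman_norm U (\<psi> z) (complex_jacobian \<psi> z *v v) = bergman_norm U z v"
  using bergman_form_transform[OF assms] bergman_norm_eq assms(2) automorphism.maps_to[OF assms]
  by simp

end

section \<open>Linear combinations of kernels and their mixed derivatives\<close>

lemma sesq_add: "sesq L U \<Longrightarrow> sesq L' U \<Longrightarrow> sesq (\<lambda>y w. L y w + L' y w) U"
proof -
  assume L: "sesq L U" "sesq L' U"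
  have "\<exists>R>0. \<exists>M. ball a R \<subseteq> U \<and> ball b R \<subseteq> U \<and> (\<forall>z\<in>ball a R. \<forall>w\<in>ball b R. cmod (L z w + L' z w) \<le> M)"
    if a: "a \<in> U" and b: "b \<in> U" for a b
  proof -
    obtain R M where 1: "0 < R" "ball a R \<subseteq> U" "ball b R \<subseteq> U"
      "\<forall>z\<in>ball a R. \<forall>w\<in>ball b R. cmod (L z w) \<le> M" using L(1) a b unfolding sesq_def by meson
    obtain R' M' where 2: "0 < R'" "ball a R' \<subseteq> U" "ball b R' \<subseteq> U"
      "\<forall>z\<in>ball a R'. \<forall>w\<in>ball b R'. cmod (L' z w) \<le> M'" using L(2) a b unfolding sesq_def by meson
    have "cmod (L z w + L' z w) \<le> M + M'" if "z \<in> ball a (min R R')" "w \<in> ball b (min R R')" for z w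
      using that 1(4) 2(4) by (intro order_trans[OF norm_triangle_ineq] add_mono) auto
    moreover have "ball a (min R R') \<subseteq> U" "ball b (min R R') \<subseteq> U" using 1(2,3) by (auto simp: subset_iff)
    ultimately show ?thesis using 1(1) 2(1) by (intro exI[of _ "min R R'"] conjI exI[of _ "M + M'"]) auto
  qed
  then show ?thesis using L unfolding sesq_def by (simp add: hol_fun_add)
qed

lemma sesq_prod:
  assumes f: "hol_fun f U" and g: "hol_fun g U" and U: "open U"
  shows "sesq (\<lambda>y w. f y * cnj (g w)) U"
  unfolding sesq_def
proof (intro conjI ballI)
  show "hol_fun (\<lambda>z. f z * cnj (g w)) U" for w by (intro hol_fun_mult f hol_fun_const)
  show "hol_fun (\<lambda>w. cnj (f z * cnj (g w))) U" for z by (simp add: hol_fun_cmult g)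
  fix a b assume a: "a \<in> U" and b: "b \<in> U"
  obtain R M where 1: "0 < R" "ball a R \<subseteq> U" "\<And>y. y \<in> ball a R \<Longrightarrow> cmod (f y) \<le> M"
    by (rule hol_fun_locally_bounded[OF f U a]; blast)
  obtain R' M' where 2: "0 < R'" "ball b R' \<subseteq> U" "\<And>y. y \<in> ball b R' \<Longrightarrow> cmod (g y) \<le> M'"
    by (rule hol_fun_locally_bounded[OF g U b]; blast)
  have M0: "0 \<le> M" using 1(3)[of a] 1(1) by (meson centre_in_ball norm_ge_zero order_trans)
  have "cmod (f z * cnj (g w)) \<le> M * M'" if "z \<in> ball a (min R R')" "w \<in> ball b (min R R')" for z w
    using that 1(3) 2(3) M0 unfolding norm_mult complex_mod_cnj by (intro mult_mono) auto
  moreover have "ball a (min R R') \<subseteq> U" "ball b (min R R') \<subseteq> U" using 1(2) 2(2) by (auto simp: subset_iff)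
  ultimately show "\<exists>R>0. \<exists>M. ball a R \<subseteq> U \<and> ball b R \<subseteq> U \<and> (\<forall>z\<in>ball a R. \<forall>w\<in>ball b R. cmod (f z * cnj (g w)) \<le> M)"
    using 1(1) 2(1) by (intro exI[of _ "min R R'"] conjI exI[of _ "M * M'"]) auto
qed

lemma sesq_rmult: "sesq L U \<Longrightarrow> open U \<Longrightarrow> sesq (\<lambda>y w. complex_of_real c * L y w) U"
proof -
  assume L: "sesq L U" and U: "open U"
  have "\<exists>R>0. \<exists>M. ball a R \<subseteq> U \<and> ball b R \<subseteq> U \<and> (\<forall>z\<in>ball a R. \<forall>w\<in>ball b R. cmod (complex_of_real c * L z w) \<le> M)"
    if a: "a \<in> U" and b: "b \<in> U" for a b
  proof -
    obtain R M where 1: "0 < R" "ball a R \<subseteq> U" "ball b R \<subseteq> U"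
      "\<forall>z\<in>ball a R. \<forall>w\<in>ball b R. cmod (L z w) \<le> M" using L a b unfolding sesq_def by meson
    then show ?thesis
      by (intro exI[of _ R] conjI exI[of _ "\<bar>c\<bar> * M"]) (auto simp: norm_mult intro!: mult_left_mono)
  qed
  then show ?thesis using L unfolding sesq_def by (simp add: hol_fun_cmult)
qed

lemma mixed_add:
  assumes L: "sesq L U" "sesq L' U" and U: "open U" and z: "z \<in> U"
  shows "mixed (\<lambda>y w. L y w + L' y w) z u v = mixed L z u v + mixed L' z u v"
proof -
  have h: "hol_fun (\<lambda>x. cnj (dd (\<lambda>y. L y x) z v)) U" "hol_fun (\<lambda>x. cnj (dd (\<lambda>y. L' y x) z v)) U"
    using sesqD1[OF sesq_cnj_dd[OF L(1) U] z] sesqD1[OF sesq_cnj_dd[OF L(2) U] z] .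
  have "mixed (\<lambda>y w. L y w + L' y w) z u v = dd (\<lambda>x. cnj (dd (\<lambda>y. L y x) z v) + cnj (dd (\<lambda>y. L' y x) z v)) z u"
    unfolding mixed_def
    by (rule dd_cong[OF U z, symmetric, OF hol_fun_add[OF h]])
       (simp add: dd_add[OF sesqD1[OF L(1)] sesqD1[OF L(2)] z])
  then show ?thesis by (simp add: dd_add[OF h z] mixed_def)
qed

lemma mixed_rmult:
  assumes L: "sesq L U" and U: "open U" and z: "z \<in> U"
  shows "mixed (\<lambda>y w. complex_of_real c * L y w) z u v = of_real c * mixed L z u v"
proof -
  have h: "hol_fun (\<lambda>x. cnj (dd (\<lambda>y. L y x) z v)) U"
    using sesqD1[OF sesq_cnj_dd[OF L U] z] .
  have "mixed (\<lambda>y w. complex_of_real c * L y w) z u v = dd (\<lambda>x. of_real c * cnj (dd (\<lambda>y. L y x) z v)) z u"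
    unfolding mixed_def
    by (rule dd_cong[OF U z, symmetric, OF hol_fun_cmult[OF h]]) (simp add: dd_cmult[OF sesqD1[OF L] z])
  then show ?thesis by (simp add: dd_cmult[OF h z] mixed_def)
qed

lemma mixed_prod:
  assumes f: "hol_fun f U" and z: "z \<in> U"
  shows "mixed (\<lambda>y w. f y * cnj (f w)) z u v = cnj (dd f z v) * dd f z u"
proof -
  have "dd (\<lambda>y. f y * cnj (f x)) z v = dd f z v * cnj (f x)" for x
    by (subst dd_mult[OF f hol_fun_const z]) (simp add: dd_const)
  then show ?thesis unfolding mixed_def by (simp add: dd_cmult[OF f z])
qed

section \<open>Positivity and local bounds of the metric\<close>

context bounded_domain
begin

text \<open>For \<open>f\<close> vanishing at \<open>x\<close>, Cauchy-Schwarz against \<open>K(., y) - K(., x) K(x, y) / K(x, x)\<close> shows that the kernel \<open>P\<close> is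
  nonnegative on the diagonal; \<open>mixed_nonneg\<close> then bounds the metric from below.\<close>

lemma form_ge:
  assumes x: "x \<in> U" and f: "f \<in> A2" "f x = 0" and N: "0 < N" "nrm f \<le> N"
  shows "(cmod (dd f x v))\<^sup>2 / (N * kd x) \<le> bergman_form x v"
proof -
  let ?g = "\<lambda>y. K y x"
  \<comment> \<open>Subtracting the rank-one kernel of K(.,x) makes P vanish as soon as one argument
    is x. The weight \<open>kd x / N\<close> is the largest for which the Cauchy-Schwarz bound below
    keeps the diagonal nonnegative; a positive N above \<open>nrm f\<close> allows f = 0 as
    well.\<close>
  define P where "P = (\<lambda>y w. complex_of_real (kd x) * K y w
      + (complex_of_real (-1) * (?g y * cnj (?g w)) + complex_of_real (- (kd x / N)) * (f y * cnj (f w))))"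
  have hg: "hol_fun ?g U" by (rule sesqD1[OF sesq_K x])
  have hf: "hol_fun f U" by (rule A2_hol[OF f(1)])
  note s = sesq_rmult[OF sesq_K open_U] sesq_rmult[OF sesq_prod[OF hg hg open_U] open_U]
    sesq_rmult[OF sesq_prod[OF hf hf open_U] open_U]
  have P: "sesq P U" unfolding P_def by (intro sesq_add s)
  have kx: "0 < kd x" by (rule kd_pos[OF x])
  have ineq: "(cmod (f y))\<^sup>2 \<le> N * (kd y - (cmod (K y x))\<^sup>2 / kd x)" if y: "y \<in> U" for y
  proof -
    let ?b = "- (K x y / of_real (kd x))"
    let ?h = "\<lambda>z. K z y + ?b * K z x"
    have h: "?h \<in> A2" by (intro A2_add A2_cmult K_A2 x y)
    have e: "cmod (K x y) = cmod (K y x)" using K_hermitian[OF x y] by simp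
    have "ip (\<lambda>z. K z y) (\<lambda>z. ?b * K z x) = cnj ?b * K x y"
      by (subst ip_cnj, subst ip_cmult_left) (simp add: ip_cnj[of "\<lambda>z. K z x" "\<lambda>z. K z y"] K_reproducing[OF K_A2[OF y] x])
    also have "\<dots> = - of_real ((cmod (K x y))\<^sup>2 / kd x)"
      by (simp add: complex_norm_square mult.commute del: of_real_power)
    finally have "nrm ?h = kd y - 2 * ((cmod (K x y))\<^sup>2 / kd x) + (cmod (K x y) / kd x)\<^sup>2 * kd x"
      using nrm_add[OF K_A2[OF y] A2_cmult[OF K_A2[OF x], of ?b]] nrm_cmult[of ?b "\<lambda>z. K z x"] nrm_K[OF x] nrm_K[OF y] kx
      by (simp add: norm_divide)
    then have nh: "nrm ?h = kd y - (cmod (K y x))\<^sup>2 / kd x"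
      using kx by (simp add: e power2_eq_square)
    have "ip ?h f = ip (\<lambda>z. K z y) f + ip (\<lambda>z. ?b * K z x) f"
      by (rule ip_add_left[OF K_A2[OF y] A2_cmult[OF K_A2[OF x]] f(1)])
    then have "ip f ?h = cnj (ip (\<lambda>z. K z y) f + ip (\<lambda>z. ?b * K z x) f)"
      by (subst ip_cnj) simp
    also have "\<dots> = f y"
      using K_reproducing[OF f(1) y] K_reproducing[OF f(1) x] f(2) ip_cnj[of "\<lambda>z. K z y" f] ip_cnj[of "\<lambda>z. K z x" f]
        ip_cmult_left[of ?b "\<lambda>z. K z x" f] by simp
    finally have "(cmod (f y))\<^sup>2 \<le> nrm f * nrm ?h" using cauchy_schwarz[OF f(1) h] by simp
    also have "\<dots> \<le> N * nrm ?h" by (rule mult_right_mono[OF N(2) nrm_nonneg])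
    finally show ?thesis unfolding nh .
  qed
  have "0 \<le> Re (mixed P x v v)"
  proof (rule mixed_nonneg[OF P open_U x])
    fix z assume z: "z \<in> U"
    show "P z x = 0" by (simp add: P_def f(2) K_diag[OF x])
    show "P x z = 0" using K_hermitian[OF z x] by (simp add: P_def f(2) K_diag[OF x])
    have "P z z = of_real (kd x * kd z - (cmod (K z x))\<^sup>2 - kd x / N * (cmod (f z))\<^sup>2)"
      by (simp add: P_def K_diag[OF z] complex_norm_square del: of_real_power)
    moreover have "kd x / N * (cmod (f z))\<^sup>2 \<le> kd x / N * (N * (kd z - (cmod (K z x))\<^sup>2 / kd x))"
      by (intro mult_left_mono ineq z) (use kx N in auto)
    moreover have "kd x / N * (N * (kd z - (cmod (K z x))\<^sup>2 / kd x)) = kd x * kd z - (cmod (K z x))\<^sup>2"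
      using kx N by (simp add: field_simps)
    ultimately show "0 \<le> Re (P z z)" by simp
  qed
  also have "mixed P x v v = of_real (kd x) * mixed K x v v
      + (of_real (-1) * (cnj (K1 x v) * K1 x v) + of_real (- (kd x / N)) * (cnj (dd f x v) * dd f x v))"
    unfolding P_def K1_def
    by (simp only: mixed_add[OF s(1) sesq_add[OF s(2,3)] open_U x] mixed_add[OF s(2,3) open_U x]
       mixed_rmult[OF sesq_K open_U x] mixed_rmult[OF sesq_prod[OF hg hg open_U] open_U x]
       mixed_rmult[OF sesq_prod[OF hf hf open_U] open_U x] mixed_prod[OF hg x] mixed_prod[OF hf x])
  also have "Re \<dots> = kd x * Re (mixed K x v v) - (cmod (K1 x v))\<^sup>2 - kd x / N * (cmod (dd f x v))\<^sup>2"
    by (simp add: cmod_power2) (simp add: power2_eq_square)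
  finally have "kd x / N * (cmod (dd f x v))\<^sup>2 \<le> kd x * Re (mixed K x v v) - (cmod (K1 x v))\<^sup>2" by simp
  then have "kd x / N * (cmod (dd f x v))\<^sup>2 / (kd x)\<^sup>2 \<le> (kd x * Re (mixed K x v v) - (cmod (K1 x v))\<^sup>2) / (kd x)\<^sup>2"
    by (rule divide_right_mono) simp
  also have "\<dots> = bergman_form x v" using kx by (simp add: bergman_form_def diff_divide_distrib power2_eq_square)
  also have "kd x / N * (cmod (dd f x v))\<^sup>2 / (kd x)\<^sup>2 = (cmod (dd f x v))\<^sup>2 / (N * kd x)"
    using kx by (simp add: power2_eq_square)
  finally show ?thesis .
qed

text \<open>Tested with the affine function y \<mapsto> \<Sum> cnj(v_j) (y_j - x_j): it vanishes at
  x, its derivative in direction v is |v|^2, and its squared norm is at most a multiple of |v|^2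
  since U is bounded.\<close>

lemma form_lower:
  assumes x: "x \<in> U"
  shows "\<exists>c>0. \<forall>v. c * (norm v)\<^sup>2 \<le> bergman_form x v"
proof -
  obtain D where D: "\<And>y. y \<in> U \<Longrightarrow> norm (y - x) \<le> D"
    using bounded_translation[OF bounded_U, of "-x"] unfolding bounded_iff by auto
  have D0: "0 \<le> D" using D[OF x] by simp
  define n where "n = real CARD('n)"
  define V where "V = measure M U"
  \<comment> \<open>The test function is bounded by n D |v|, so its squared norm is at most this
    square times the volume of U; the summand 1 keeps the constant positive.\<close>
  define C where "C = (n * D)\<^sup>2 * V + 1"
  have V: "0 \<le> V" by (simp add: V_def)
  have C: "0 < C" using V by (simp add: C_def add_nonneg_pos)
  have kx: "0 < kd x" by (rule kd_pos[OF x])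
  have "1 / (C * kd x) * (norm v)\<^sup>2 \<le> bergman_form x v" for v
  proof -
    define f where "f = (\<lambda>y. \<Sum>j\<in>UNIV. cnj (v $ j) * (y $ j - x $ j))"
    have hf: "hol_fun f U" unfolding f_def by (intro hol_fun_sum hol_fun_cmult hol_fun_diff hol_fun_coord hol_fun_const)
    have "(f has_derivative (\<lambda>h. \<Sum>j\<in>UNIV. cnj (v $ j) * (h $ j))) (at x)"
      unfolding f_def
      by (auto intro!: derivative_eq_intros bounded_linear_imp_has_derivative[OF bounded_linear_vec_nth])
    then have "dd f x v = (\<Sum>j\<in>UNIV. cnj (v $ j) * (v $ j))" by (rule dd_eqI)
    also have "\<dots> = of_real (\<Sum>j\<in>UNIV. (cmod (v $ j))\<^sup>2)"
      by (simp add: complex_norm_square mult.commute del: of_real_power)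
    also have "(\<Sum>j\<in>UNIV. (cmod (v $ j))\<^sup>2) = (norm v)\<^sup>2"
      by (simp add: norm_vec_def L2_set_def sum_nonneg)
    finally have df: "cmod (dd f x v) = (norm v)\<^sup>2" by (simp add: norm_power)
    have fb: "cmod (f y) \<le> n * norm v * D" if y: "y \<in> U" for y
    proof -
      have "cmod (f y) \<le> (\<Sum>j\<in>(UNIV :: 'n set). norm v * D)"
        unfolding f_def
      proof (rule sum_norm_le)
        fix j
        have "cmod (y $ j - x $ j) \<le> norm (y - x)" using Finite_Cartesian_Product.norm_nth_le[of "y - x" j] by simp
        then show "cmod (cnj (v $ j) * (y $ j - x $ j)) \<le> norm v * D"
          using D[OF y] Finite_Cartesian_Product.norm_nth_le[of v j] unfolding norm_mult complex_mod_cnj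
          by (intro mult_mono) auto
      qed
      then show ?thesis by (simp add: n_def mult_ac)
    qed
    have fA: "f \<in> A2" by (rule A2_bounded[OF hf fb])
    have "nrm f \<le> (\<integral>y. (n * norm v * D)\<^sup>2 \<partial>M)"
      unfolding nrm_def
      by (rule integral_mono[OF A2_integrable[OF fA]])
         (auto intro!: power_mono fb finite_measure.integrable_const[OF finite_M])
    also have "\<dots> = (n * norm v * D)\<^sup>2 * V" by (simp add: V_def)
    also have "\<dots> \<le> C * (norm v)\<^sup>2" by (simp add: C_def power_mult_distrib algebra_simps)
    finally have nf: "nrm f \<le> C * (norm v)\<^sup>2" .
    show ?thesis
    proof (cases "v = 0")
      case True
      have "0 \<le> bergman_form x v"
        using form_ge[OF x A2_cmult[OF one_A2, of 0], of 1 v] by (simp add: nrm_def dd_const)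
      then show ?thesis using True by simp
    next
      case False
      have "(cmod (dd f x v))\<^sup>2 / (C * (norm v)\<^sup>2 * kd x) \<le> bergman_form x v"
        by (rule form_ge[OF x fA _ _ nf]) (use C False in \<open>auto simp: f_def\<close>)
      also have "(cmod (dd f x v))\<^sup>2 / (C * (norm v)\<^sup>2 * kd x) = 1 / (C * kd x) * (norm v)\<^sup>2"
        using False C kx unfolding df by (simp add: field_simps power2_eq_square)
      finally show ?thesis .
    qed
  qed
  moreover have "0 < 1 / (C * kd x)" using C kx by simp
  ultimately show ?thesis by blast
qed

text \<open>Positive definiteness in quantitative form: at the base point it lets the Bergman norm
  dominate the Euclidean norm in which the Cauchy estimates are stated.\<close>

lemma norm_lower:
  assumes x: "x \<in> U"
  shows "\<exists>c>0. \<forall>v. c * norm v \<le> bergman_norm U x v"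
proof -
  obtain c where c: "0 < c" "\<And>v. c * (norm v)\<^sup>2 \<le> bergman_form x v" using form_lower[OF x] by blast
  have "sqrt c * norm v \<le> bergman_norm U x v" for v
    using real_sqrt_le_mono[OF c(2)[of v]] by (simp add: real_sqrt_mult bergman_norm_eq[OF x])
  then show ?thesis using c(1) by (intro exI[of _ "sqrt c"]) auto
qed

lemma norm_nonneg: "x \<in> U \<Longrightarrow> 0 \<le> bergman_norm U x v"
  using norm_lower[of x] by (meson mult_nonneg_nonneg norm_ge_zero less_imp_le order_trans)

lemma bergman_norm_scaleR: "bergman_norm U x (r *\<^sub>R v) = \<bar>r\<bar> * bergman_norm U x v"
proof -
  have c: "cnj (r *\<^sub>R a) = r *\<^sub>R cnj a" for a by (simp add: complex_eq_iff)
  have "(\<Sum>i\<in>UNIV. \<Sum>j\<in>UNIV. bergman_metric U x $ i $ j * (r *\<^sub>R v) $ i * cnj ((r *\<^sub>R v) $ j))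
    = (r\<^sup>2) *\<^sub>R (\<Sum>i\<in>UNIV. \<Sum>j\<in>UNIV. bergman_metric U x $ i $ j * v $ i * cnj (v $ j))"
    by (simp add: scaleR_sum_right vector_scaleR_component power2_eq_square c)
  then show ?thesis unfolding bergman_norm_def by (simp add: real_sqrt_mult)
qed

lemma metric_continuous: "continuous_on U (\<lambda>z. bergman_metric U z $ i $ j)"
proof -
  let ?L = "\<lambda>j x w. cnj (dd (\<lambda>y. K y x) w (axis j 1))"
  have L: "sesq (?L j) U" for j by (rule sesq_cnj_dd[OF sesq_K open_U])
  have m1: "continuous_on U (\<lambda>z. mixed K z (axis i 1) (axis j 1))"
    unfolding mixed_def using sesq_diag_continuous[OF sesq_dd[OF L open_U]] .
  have m2: "continuous_on U (\<lambda>z. cnj (K1 z (axis j 1)))" for j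
    unfolding K1_def using sesq_diag_continuous[OF L] .
  have m3: "continuous_on U (\<lambda>z. K1 z (axis i 1))"
    using continuous_on_cnj[OF m2[of i]] by simp
  have m4: "continuous_on U (\<lambda>z. inverse (kd z))"
    using kd_pos by (intro continuous_on_inverse kd_continuous) (auto simp: less_imp_neq[symmetric])
  have "continuous_on U (\<lambda>z. mixed K z (axis i 1) (axis j 1) * of_real (inverse (kd z))
      - K1 z (axis i 1) * cnj (K1 z (axis j 1)) * of_real ((inverse (kd z))\<^sup>2))"
    by (intro continuous_on_diff continuous_on_mult continuous_on_of_real continuous_on_power m1 m2 m3 m4)
  then show ?thesis
    by (rule continuous_on_eq) (simp add: bergman_metric_eq)
qed

lemma norm_continuous:
  fixes \<gamma> \<delta> :: "'a::topological_space \<Rightarrow> complex ^ 'n"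
  assumes "continuous_on S \<gamma>" "continuous_on S \<delta>" "\<gamma> ` S \<subseteq> U"
  shows "continuous_on S (\<lambda>t. bergman_norm U (\<gamma> t) (\<delta> t))"
  unfolding bergman_norm_def
  by (intro continuous_intros continuous_on_compose2[OF metric_continuous assms(1,3)] assms(2))

text \<open>The norm is continuous, hence bounded on a compact ball times the unit sphere, and
  homogeneity extends the bound to all vectors.\<close>

lemma norm_upper:
  assumes x: "x \<in> U"
  shows "\<exists>R>0. ball x R \<subseteq> U \<and> (\<exists>C>0. \<forall>z\<in>ball x R. \<forall>v. bergman_norm U z v \<le> C * norm v)"
proof -
  obtain R where R: "0 < R" "cball x R \<subseteq> U" using open_U x open_contains_cball by blast
  let ?S = "cball x R \<times> sphere (0 :: complex ^ 'n) 1"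
  have "bounded ((\<lambda>p. bergman_norm U (fst p) (snd p)) ` ?S)"
    by (intro compact_imp_bounded compact_continuous_image norm_continuous continuous_intros compact_Times)
       (use R in auto)
  then obtain C where C: "0 < C" "\<forall>p\<in>?S. norm (bergman_norm U (fst p) (snd p)) \<le> C"
    unfolding bounded_pos by auto
  have "bergman_norm U z v \<le> C * norm v" if z: "z \<in> ball x R" for z v
  proof (cases "v = 0")
    case True
    then show ?thesis using bergman_norm_scaleR[of z 0 0] by simp
  next
    case False
    have "bergman_norm U z ((1 / norm v) *\<^sub>R v) \<le> C"
      using C(2)[rule_format, of "(z, (1 / norm v) *\<^sub>R v)"] z False by auto
    then show ?thesis using False unfolding bergman_norm_scaleR by (simp add: field_simps)
  qed
  then show ?thesis using R C(1) ball_subset_cball[of x R] by (intro exI[of _ R]) blast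
qed

end

section \<open>The Bergman distance\<close>

lemma valid_pathE:
  assumes "valid_path \<gamma>"
  obtains D S where "finite S" "\<And>t. t \<in> {0..1} - S \<Longrightarrow> (\<gamma> has_vector_derivative D t) (at t)"
    "continuous_on ({0..1} - S) D" "continuous_on {0..1} \<gamma>"
  using assms unfolding valid_path_def piecewise_C1_differentiable_on_def C1_differentiable_on_def by blast

lemma valid_pathI:
  assumes "finite S" "\<And>t. t \<in> {0..1} - S \<Longrightarrow> (\<gamma> has_vector_derivative D t) (at t)"
    "continuous_on ({0..1} - S) D" "continuous_on {0..1} \<gamma>"
  shows "valid_path \<gamma>"
  using assms unfolding valid_path_def piecewise_C1_differentiable_on_def C1_differentiable_on_def by blast

text \<open>The finitely many exceptional parameters form a null set, so any derivative valid off
  them computes the length.\<close>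

lemma bergman_length_eq:
  assumes "finite S" "\<And>t. t \<in> {0..1} - S \<Longrightarrow> (\<gamma> has_vector_derivative D t) (at t)"
  shows "bergman_length U \<gamma> = (\<integral>\<^sup>+t\<in>{0..1}. ennreal (bergman_norm U (\<gamma> t) (D t)) \<partial>lborel)"
  unfolding bergman_length_def
proof (rule nn_integral_cong_AE)
  have "AE t in lborel. t \<notin> S"
    by (rule AE_not_in) (rule finite_imp_null_set_lborel[OF assms(1)])
  then show "AE t in lborel. ennreal (bergman_norm U (\<gamma> t) (vector_derivative \<gamma> (at t))) * indicator {0..1} t
      = ennreal (bergman_norm U (\<gamma> t) (D t)) * indicator {0..1} t"
  proof (rule AE_mp, intro AE_I2 impI)
    fix t assume "t \<notin> S"
    then show "ennreal (bergman_norm U (\<gamma> t) (vector_derivative \<gamma> (at t))) * indicator {0..1} t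
      = ennreal (bergman_norm U (\<gamma> t) (D t)) * indicator {0..1} t"
      using vector_derivative_at[OF assms(2)[of t]] by (auto simp: indicator_def)
  qed
qed

context bounded_domain
begin

lemma integrand_measurable:
  assumes S: "finite S" "continuous_on ({0..1} - S) D" and \<gamma>: "continuous_on {0..1} \<gamma>" "\<gamma> ` {0..1} \<subseteq> U"
  shows "(\<lambda>t::real. indicator {0..1} t *\<^sub>R bergman_norm U (\<gamma> t) (D t)) \<in> borel_measurable borel"
proof (rule measurable_discrete_difference[of "\<lambda>t. indicator ({0..1} - S) t *\<^sub>R bergman_norm U (\<gamma> t) (D t)" _ _ S])
  have "continuous_on ({0..1} - S) (\<lambda>t. bergman_norm U (\<gamma> t) (D t))"
    by (rule norm_continuous) (use S(2) \<gamma> in \<open>auto intro: continuous_on_subset\<close>)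
  moreover have "{0..1} - S \<in> sets borel"
    by (intro sets.Diff borel_closed finite_imp_closed S(1) closed_atLeastAtMost)
  ultimately show "(\<lambda>t. indicator ({0..1} - S) t *\<^sub>R bergman_norm U (\<gamma> t) (D t)) \<in> borel_measurable borel"
    by (intro borel_measurable_continuous_on_indicator)
qed (use S in \<open>auto simp: indicator_def countable_finite\<close>)

lemma integrand_measurable':
  assumes S: "finite S" "continuous_on ({0..1} - S) D" and \<gamma>: "continuous_on {0..1} \<gamma>" "\<gamma> ` {0..1} \<subseteq> U"
  shows "(\<lambda>t::real. ennreal (bergman_norm U (\<gamma> t) (D t)) * indicator {0..1} t) \<in> borel_measurable borel"
proof -
  have "(\<lambda>t. ennreal (indicator {0..1} t *\<^sub>R bergman_norm U (\<gamma> t) (D t))) \<in> borel_measurable borel"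
    using integrand_measurable[OF assms] by (rule measurable_compose) measurable
  also have "(\<lambda>t. ennreal (indicator {0..1} t *\<^sub>R bergman_norm U (\<gamma> t) (D t))) = (\<lambda>t. ennreal (bergman_norm U (\<gamma> t) (D t)) * indicator {0..1} t)"
    by (auto simp: indicator_def fun_eq_iff)
  finally show ?thesis .
qed

lemma length_reversepath:
  assumes \<gamma>: "valid_path \<gamma>" "path_image \<gamma> \<subseteq> U"
  shows "bergman_length U (reversepath \<gamma>) = bergman_length U \<gamma>"
proof -
  obtain D S where S: "finite S" and D: "\<And>t. t \<in> {0..1} - S \<Longrightarrow> (\<gamma> has_vector_derivative D t) (at t)"
    and c: "continuous_on ({0..1} - S) D" "continuous_on {0..1} \<gamma>"
    by (rule valid_pathE[OF \<gamma>(1)]; blast)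
  let ?F = "\<lambda>t. ennreal (bergman_norm U (\<gamma> t) (D t)) * indicator {0..1} t"
  have m: "?F \<in> borel_measurable borel"
    by (rule integrand_measurable'[OF S c]) (use \<gamma>(2) in \<open>simp add: path_image_def\<close>)
  have "bergman_length U (reversepath \<gamma>) = (\<integral>\<^sup>+t\<in>{0..1}. ennreal (bergman_norm U (reversepath \<gamma> t) (- D (1 - t))) \<partial>lborel)"
  proof (rule bergman_length_eq)
    show "finite ((\<lambda>s. 1 - s) ` S)" using S by simp
    fix t assume t: "t \<in> {0..1} - (\<lambda>s. 1 - s) ` S"
    then have "1 - t \<in> {0..1} - S" by (auto simp: image_iff)
    from D[OF this] have "((\<gamma> \<circ> (\<lambda>t. 1 - t)) has_vector_derivative (-1) *\<^sub>R D (1 - t)) (at t)"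
      by (intro vector_diff_chain_at) (auto intro!: derivative_eq_intros)
    then show "(reversepath \<gamma> has_vector_derivative - D (1 - t)) (at t)"
      by (simp add: reversepath_def o_def)
  qed
  also have "\<dots> = (\<integral>\<^sup>+t. ?F (1 + (-1) * t) \<partial>lborel)"
  proof (rule nn_integral_cong)
    fix t :: real
    have "bergman_norm U x (- v) = bergman_norm U x v" for x v using bergman_norm_scaleR[of x "-1" v] by simp
    then show "ennreal (bergman_norm U (reversepath \<gamma> t) (- D (1 - t))) * indicator {0..1} t = ?F (1 + (-1) * t)"
      by (cases "t \<in> {0..1}") (auto simp: reversepath_def indicator_def)
  qed
  also have "\<dots> = (\<integral>\<^sup>+t. ?F t \<partial>lborel)"
    using nn_integral_real_affine[OF m, of "-1" 1] by simp
  also have "\<dots> = bergman_length U \<gamma>" by (rule bergman_length_eq[OF S D, symmetric])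
  finally show ?thesis .
qed

lemma length_join:
  assumes 1: "valid_path \<gamma>1" "path_image \<gamma>1 \<subseteq> U" and 2: "valid_path \<gamma>2" "path_image \<gamma>2 \<subseteq> U"
  shows "bergman_length U (\<gamma>1 +++ \<gamma>2) = bergman_length U \<gamma>1 + bergman_length U \<gamma>2"
proof -
  obtain D1 S1 where S1: "finite S1" and D1: "\<And>t. t \<in> {0..1} - S1 \<Longrightarrow> (\<gamma>1 has_vector_derivative D1 t) (at t)"
    and c1: "continuous_on ({0..1} - S1) D1" "continuous_on {0..1} \<gamma>1"
    by (rule valid_pathE[OF 1(1)]; blast)
  obtain D2 S2 where S2: "finite S2" and D2: "\<And>t. t \<in> {0..1} - S2 \<Longrightarrow> (\<gamma>2 has_vector_derivative D2 t) (at t)"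
    and c2: "continuous_on ({0..1} - S2) D2" "continuous_on {0..1} \<gamma>2"
    by (rule valid_pathE[OF 2(1)]; blast)
  let ?F1 = "\<lambda>t. ennreal (bergman_norm U (\<gamma>1 t) (D1 t)) * indicator {0..1} t"
  let ?F2 = "\<lambda>t. ennreal (bergman_norm U (\<gamma>2 t) (D2 t)) * indicator {0..1} t"
  have m1: "?F1 \<in> borel_measurable borel"
    by (rule integrand_measurable'[OF S1 c1]) (use 1(2) in \<open>simp add: path_image_def\<close>)
  have m2: "?F2 \<in> borel_measurable borel"
    by (rule integrand_measurable'[OF S2 c2]) (use 2(2) in \<open>simp add: path_image_def\<close>)
  \<comment> \<open>Each half is run at double speed; the factor 2 cancels against the factor 1/2 of
    the substitution in each integral.\<close>
  let ?D = "\<lambda>t. if t \<le> 1/2 then 2 *\<^sub>R D1 (2 * t) else 2 *\<^sub>R D2 (2 * t - 1)"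
  let ?S = "insert (1/2) ((\<lambda>s. s / 2) ` S1 \<union> (\<lambda>s. (s + 1) / 2) ` S2)"
  have fin: "finite ?S" using S1 S2 by simp
  have "bergman_length U (\<gamma>1 +++ \<gamma>2) = (\<integral>\<^sup>+t\<in>{0..1}. ennreal (bergman_norm U ((\<gamma>1 +++ \<gamma>2) t) (?D t)) \<partial>lborel)"
  proof (rule bergman_length_eq[OF fin])
    fix t assume t: "t \<in> {0..1} - ?S"
    show "((\<gamma>1 +++ \<gamma>2) has_vector_derivative ?D t) (at t)"
    proof (cases "t < 1/2")
      case True
      have "2 * t \<notin> S1"
      proof
        assume "2 * t \<in> S1"
        then have "(2 * t) / 2 \<in> (\<lambda>s. s / 2) ` S1" by (rule imageI)
        then show False using t by simp
      qed
      then have "2 * t \<in> {0..1} - S1" using t True by auto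
      from D1[OF this] have "((\<gamma>1 \<circ> (\<lambda>t. 2 * t)) has_vector_derivative 2 *\<^sub>R D1 (2 * t)) (at t)"
        by (intro vector_diff_chain_at) (auto intro!: derivative_eq_intros)
      then have "((\<gamma>1 +++ \<gamma>2) has_vector_derivative 2 *\<^sub>R D1 (2 * t)) (at t)"
        by (rule has_vector_derivative_transform_within_open[where S = "{..<1/2}"])
           (use True in \<open>auto simp: joinpaths_def\<close>)
      then show ?thesis using True by simp
    next
      case False
      then have t2: "1/2 < t" using t by auto
      have "2 * t - 1 \<notin> S2"
      proof
        assume "2 * t - 1 \<in> S2"
        then have "((2 * t - 1) + 1) / 2 \<in> (\<lambda>s. (s + 1) / 2) ` S2" by (rule imageI)
        then show False using t by simp
      qed
      then have "2 * t - 1 \<in> {0..1} - S2" using t t2 by auto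
      from D2[OF this] have "((\<gamma>2 \<circ> (\<lambda>t. 2 * t - 1)) has_vector_derivative 2 *\<^sub>R D2 (2 * t - 1)) (at t)"
        by (intro vector_diff_chain_at) (auto intro!: derivative_eq_intros)
      then have "((\<gamma>1 +++ \<gamma>2) has_vector_derivative 2 *\<^sub>R D2 (2 * t - 1)) (at t)"
        by (rule has_vector_derivative_transform_within_open[where S = "{1/2<..}"])
           (use t2 in \<open>auto simp: joinpaths_def\<close>)
      then show ?thesis using t2 by simp
    qed
  qed
  also have "\<dots> = (\<integral>\<^sup>+t. ennreal 2 * ?F1 (0 + 2 * t) + ennreal 2 * ?F2 (-1 + 2 * t) \<partial>lborel)"
  proof (rule nn_integral_cong_AE)
    have "AE t in lborel. t \<noteq> (1/2 :: real)" by (rule AE_lborel_singleton)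
    then show "AE t in lborel. ennreal (bergman_norm U ((\<gamma>1 +++ \<gamma>2) t) (?D t)) * indicator {0..1} t
      = ennreal 2 * ?F1 (0 + 2 * t) + ennreal 2 * ?F2 (-1 + 2 * t)"
    proof (rule AE_mp, intro AE_I2 impI)
      fix t :: real assume t: "t \<noteq> 1/2"
      have e: "ennreal (bergman_norm U x (2 *\<^sub>R v)) = ennreal 2 * ennreal (bergman_norm U x v)" for x v
        unfolding bergman_norm_scaleR by (simp add: ennreal_mult')
      show "ennreal (bergman_norm U ((\<gamma>1 +++ \<gamma>2) t) (?D t)) * indicator {0..1} t
        = ennreal 2 * ?F1 (0 + 2 * t) + ennreal 2 * ?F2 (-1 + 2 * t)"
      proof (cases "t < 1/2")
        case True
        then show ?thesis by (simp add: joinpaths_def e indicator_def)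
      next
        case False
        then show ?thesis using t by (simp add: joinpaths_def e indicator_def)
      qed
    qed
  qed
  also have "\<dots> = (\<integral>\<^sup>+t. ennreal 2 * ?F1 (0 + 2 * t) \<partial>lborel) + (\<integral>\<^sup>+t. ennreal 2 * ?F2 (-1 + 2 * t) \<partial>lborel)"
    using m1 m2 by (intro nn_integral_add) (auto intro!: borel_measurable_times measurable_compose[OF _ m1] measurable_compose[OF _ m2])
  also have "(\<integral>\<^sup>+t. ennreal 2 * ?F1 (0 + 2 * t) \<partial>lborel) = (\<integral>\<^sup>+t. ?F1 t \<partial>lborel)"
    using nn_integral_real_affine[OF m1, of 2 0]
    by (subst nn_integral_cmult) (auto intro!: measurable_compose[OF _ m1])
  also have "(\<integral>\<^sup>+t. ennreal 2 * ?F2 (-1 + 2 * t) \<partial>lborel) = (\<integral>\<^sup>+t. ?F2 t \<partial>lborel)"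
    using nn_integral_real_affine[OF m2, of 2 "-1"]
    by (subst nn_integral_cmult) (auto intro!: measurable_compose[OF _ m2])
  also have "(\<integral>\<^sup>+t. ?F1 t \<partial>lborel) = bergman_length U \<gamma>1" by (rule bergman_length_eq[OF S1 D1, symmetric])
  also have "(\<integral>\<^sup>+t. ?F2 t \<partial>lborel) = bergman_length U \<gamma>2" by (rule bergman_length_eq[OF S2 D2, symmetric])
  finally show ?thesis .
qed

section \<open>The distance as an infimum of lengths\<close>

definition paths :: "complex ^ 'n \<Rightarrow> complex ^ 'n \<Rightarrow> (real \<Rightarrow> complex ^ 'n) set" where
  "paths x y = {\<gamma>. valid_path \<gamma> \<and> path_image \<gamma> \<subseteq> U \<and> pathstart \<gamma> = x \<and> pathfinish \<gamma> = y}"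

text \<open>The infimum before conversion to a real number. The conversion sends infinity to 0 and
  would spoil order arguments, so symmetry and the triangle inequality are proved here and
  transferred.\<close>

definition edist :: "complex ^ 'n \<Rightarrow> complex ^ 'n \<Rightarrow> ennreal" where
  "edist x y = (INF \<gamma>\<in>paths x y. bergman_length U \<gamma>)"

abbreviation bd :: "complex ^ 'n \<Rightarrow> complex ^ 'n \<Rightarrow> real" where "bd \<equiv> bergman_dist U"

lemma bd_eq: "bd x y = enn2real (edist x y)"
  unfolding bergman_dist_def edist_def paths_def by (rule arg_cong[where f = "\<lambda>S. enn2real (Inf S)"]) auto

lemma edist_le: "\<gamma> \<in> paths x y \<Longrightarrow> edist x y \<le> bergman_length U \<gamma>"
  unfolding edist_def by (rule INF_lower)

text \<open>An arbitrary admissible path may have infinite length. A connected open set is joined by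
  polynomial paths, whose speed is bounded on [0,1].\<close>

lemma edist_finite:
  assumes "x \<in> U" "y \<in> U"
  shows "edist x y < \<infinity>"
proof -
  obtain g where g: "polynomial_function g" "path_image g \<subseteq> U" "pathstart g = x" "pathfinish g = y"
    using connected_open_polynomial_connected[OF open_U connected_U assms] by blast
  obtain g' where g': "polynomial_function g'" "\<And>t. (g has_vector_derivative g' t) (at t)"
    using has_vector_derivative_polynomial_function[OF g(1)] by metis
  have "compact ((\<lambda>t. bergman_norm U (g t) (g' t)) ` {0..1})"
    using g(2) by (intro compact_continuous_image norm_continuous continuous_on_polymonial_function g(1) g'(1))
      (auto simp: path_image_def)
  then obtain B where B: "\<And>t. t \<in> {0..1} \<Longrightarrow> bergman_norm U (g t) (g' t) \<le> B"
    using compact_imp_bounded bounded_iff by (metis (no_types, lifting) abs_le_D1 image_eqI real_norm_def)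
  have "edist x y \<le> bergman_length U g"
    using g valid_path_polynomial_function[OF g(1)] by (intro edist_le) (simp add: paths_def)
  also have "\<dots> = (\<integral>\<^sup>+t\<in>{0..1}. ennreal (bergman_norm U (g t) (g' t)) \<partial>lborel)"
    by (rule bergman_length_eq[of "{}"]) (use g'(2) in auto)
  also have "\<dots> \<le> (\<integral>\<^sup>+t. ennreal B * indicator {0..1::real} t \<partial>lborel)"
    by (intro nn_integral_mono) (auto simp: indicator_def intro!: ennreal_leI B)
  also have "\<dots> < \<infinity>" by (subst nn_integral_cmult_indicator) (auto simp: ennreal_mult_less_top)
  finally show ?thesis .
qed

lemma edist_bd: "x \<in> U \<Longrightarrow> y \<in> U \<Longrightarrow> edist x y = ennreal (bd x y)"
  using edist_finite unfolding bd_eq by (simp add: less_top)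

lemma bd_nonneg: "0 \<le> bd x y"
  unfolding bd_eq by simp

lemma edist_sym_le: "edist y x \<le> edist x y"
  unfolding edist_def
proof (rule INF_greatest)
  fix \<gamma> assume g: "\<gamma> \<in> paths x y"
  then have "reversepath \<gamma> \<in> paths y x" by (simp add: paths_def valid_path_imp_reverse)
  moreover have "bergman_length U (reversepath \<gamma>) = bergman_length U \<gamma>"
    by (rule length_reversepath) (use g in \<open>auto simp: paths_def\<close>)
  ultimately show "(INF \<gamma>\<in>paths y x. bergman_length U \<gamma>) \<le> bergman_length U \<gamma>"
    by (metis INF_lower)
qed

lemma bd_commute: "bd x y = bd y x"
  unfolding bd_eq using edist_sym_le[of x y] edist_sym_le[of y x] by simp

lemma edist_triangle: "edist x z \<le> edist x y + edist y z"
proof -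
  have "edist x z \<le> bergman_length U g1 + bergman_length U g2" if "g1 \<in> paths x y" "g2 \<in> paths y z" for g1 g2
  proof -
    have "g1 +++ g2 \<in> paths x z"
      using that by (auto simp: paths_def intro!: valid_path_join) (metis path_image_join_subset Un_iff subsetD)
    moreover have "bergman_length U (g1 +++ g2) = bergman_length U g1 + bergman_length U g2"
      by (rule length_join) (use that in \<open>auto simp: paths_def\<close>)
    ultimately show ?thesis by (metis edist_le)
  qed
  note * = this
  show ?thesis
  proof (rule ennreal_le_epsilon)
    fix e :: real assume fin: "edist x y + edist y z < top" and e: "0 < e"
    obtain a where a: "0 \<le> a" "edist x y = ennreal a" using fin by (cases "edist x y") auto
    obtain b where b: "0 \<le> b" "edist y z = ennreal b" using fin by (cases "edist y z") auto
    have "edist x y < ennreal (a + e/2)" "edist y z < ennreal (b + e/2)"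
      unfolding a(2) b(2) using a(1) b(1) e by (auto simp: ennreal_less_iff)
    then obtain g1 g2 where g: "g1 \<in> paths x y" "bergman_length U g1 < ennreal (a + e/2)"
      "g2 \<in> paths y z" "bergman_length U g2 < ennreal (b + e/2)"
      unfolding edist_def INF_less_iff by blast
    have "edist x z \<le> bergman_length U g1 + bergman_length U g2" by (rule *[OF g(1,3)])
    also have "\<dots> \<le> ennreal (a + e/2) + ennreal (b + e/2)" using g by (intro add_mono less_imp_le)
    also have "\<dots> = edist x y + edist y z + ennreal e"
      unfolding a(2) b(2) using a(1) b(1) e by (simp flip: ennreal_plus)
    finally show "edist x z \<le> edist x y + edist y z + ennreal e" .
  qed
qed

lemma bd_triangle:
  assumes "x \<in> U" "y \<in> U" "z \<in> U"
  shows "bd x z \<le> bd x y + bd y z"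
proof -
  have "ennreal (bd x z) \<le> ennreal (bd x y + bd y z)"
    using edist_triangle[of x z y] assms by (simp add: edist_bd bd_nonneg ennreal_plus)
  then show ?thesis by (subst (asm) ennreal_le_iff) (auto simp: bd_nonneg)
qed

lemma bd_le_local:
  assumes C: "0 < C" "\<And>z v. z \<in> ball a R \<Longrightarrow> bergman_norm U z v \<le> C * norm v"
    and sub: "ball a R \<subseteq> U" and xy: "x \<in> ball a R" "y \<in> ball a R"
  shows "bd x y \<le> C * norm (y - x)"
proof -
  have seg: "linepath x y t \<in> ball a R" if "t \<in> {0..1}" for t
    using convex_ball[of a R] xy that by (meson convex_contains_segment linepath_in_path subsetD)
  have "linepath x y \<in> paths x y"
    using seg sub unfolding paths_def path_image_def by auto
  from edist_le[OF this] have "edist x y \<le> bergman_length U (linepath x y)" .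
  also have "\<dots> = (\<integral>\<^sup>+t\<in>{0..1}. ennreal (bergman_norm U (linepath x y t) (y - x)) \<partial>lborel)"
    by (rule bergman_length_eq[of "{}"]) (auto simp: has_vector_derivative_linepath_within)
  also have "\<dots> \<le> (\<integral>\<^sup>+t. ennreal (C * norm (y - x)) * indicator {0..1::real} t \<partial>lborel)"
    by (intro nn_integral_mono) (auto simp: indicator_def intro!: ennreal_leI C seg)
  also have "\<dots> = ennreal (C * norm (y - x))"
    by (subst nn_integral_cmult_indicator) auto
  finally show ?thesis
    unfolding bd_eq using C by (intro enn2real_leI) auto
qed

lemma bd_local:
  assumes "a \<in> U"
  shows "\<exists>R>0. \<exists>C>0. ball a R \<subseteq> U \<and> (\<forall>x\<in>ball a R. \<forall>y\<in>ball a R. bd x y \<le> C * norm (y - x))"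
proof -
  obtain R C where R: "0 < R" "ball a R \<subseteq> U" "0 < C" "\<forall>z\<in>ball a R. \<forall>v. bergman_norm U z v \<le> C * norm v"
    using norm_upper[OF assms] by blast
  then have "\<forall>x\<in>ball a R. \<forall>y\<in>ball a R. bd x y \<le> C * norm (y - x)"
    using bd_le_local[of C a R] by blast
  then show ?thesis using R by blast
qed

text \<open>The triangle inequality reduces continuity in both arguments to the local upper bound of
  the distance by a multiple of the Euclidean one.\<close>

lemma bd_continuous: "continuous_on (U \<times> U) (\<lambda>p. bd (fst p) (snd p))"
  unfolding continuous_on_def
proof
  fix p assume p: "p \<in> U \<times> U"
  obtain a b where ab: "p = (a, b)" "a \<in> U" "b \<in> U" using p by auto
  obtain R C where R: "0 < R" "ball a R \<subseteq> U" "\<forall>x\<in>ball a R. \<forall>y\<in>ball a R. bd x y \<le> C * norm (y - x)"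
    using bd_local[OF ab(2)] by blast
  obtain R' C' where R': "0 < R'" "ball b R' \<subseteq> U" "\<forall>x\<in>ball b R'. \<forall>y\<in>ball b R'. bd x y \<le> C' * norm (y - x)"
    using bd_local[OF ab(3)] by blast
  have lim: "((\<lambda>q. C * norm (fst q - a) + C' * norm (snd q - b)) \<longlongrightarrow> C * norm (a - a) + C' * norm (b - b)) (at p within U \<times> U)"
    unfolding ab(1) by (intro tendsto_intros tendsto_fst[OF tendsto_ident_at, THEN tendsto_eq_rhs] tendsto_snd[OF tendsto_ident_at, THEN tendsto_eq_rhs]) auto
  have "open (ball a R \<times> ball b R')" by (intro open_Times open_ball)
  moreover have "p \<in> ball a R \<times> ball b R'" using ab R R' by auto
  ultimately have "eventually (\<lambda>q. q \<in> ball a R \<times> ball b R') (at p within U \<times> U)"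
    unfolding eventually_at_topological by blast
  then have ev: "eventually (\<lambda>q. norm (bd (fst q) (snd q) - bd a b) \<le> C * norm (fst q - a) + C' * norm (snd q - b)) (at p within U \<times> U)"
  proof (rule eventually_mono)
    fix q assume q: "q \<in> ball a R \<times> ball b R'"
    obtain x y where xy: "q = (x, y)" "x \<in> ball a R" "y \<in> ball b R'" using q by auto
    have U: "x \<in> U" "y \<in> U" using xy R(2) R'(2) by auto
    have "bd a x \<le> C * norm (x - a)" "bd b y \<le> C' * norm (y - b)"
      using R R' xy by (meson centre_in_ball)+
    moreover have "bd a b \<le> bd a x + bd x b" "bd x b \<le> bd x y + bd y b"
      "bd x y \<le> bd x a + bd a y" "bd a y \<le> bd a b + bd b y"
      using bd_triangle U ab by blast+
    moreover have "bd x a = bd a x" "bd y b = bd b y" by (rule bd_commute)+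
    ultimately show "norm (bd (fst q) (snd q) - bd a b) \<le> C * norm (fst q - a) + C' * norm (snd q - b)"
      unfolding xy by (simp add: abs_le_iff)
  qed
  have "((\<lambda>q. bd (fst q) (snd q) - bd a b) \<longlongrightarrow> 0) (at p within U \<times> U)"
    by (rule Lim_null_comparison[OF ev]) (use lim in simp)
  then show "((\<lambda>p. bd (fst p) (snd p)) \<longlongrightarrow> bd (fst p) (snd p)) (at p within U \<times> U)"
    unfolding ab(1) using LIM_zero_iff by fastforce
qed

section \<open>Invariance under automorphisms and oscillation of ln K\<close>

lemma edist_transform_le:
  assumes psi: "automorphism U \<psi>" and "x \<in> U" "y \<in> U"
  shows "edist (\<psi> x) (\<psi> y) \<le> edist x y"
  unfolding edist_def
proof (rule INF_greatest)
  interpret A: automorphism U \<psi> by fact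
  fix \<gamma> assume g: "\<gamma> \<in> paths x y"
  then have v: "valid_path \<gamma>" "path_image \<gamma> \<subseteq> U" "pathstart \<gamma> = x" "pathfinish \<gamma> = y" by (auto simp: paths_def)
  obtain D S where S: "finite S" and D: "\<And>t. t \<in> {0..1} - S \<Longrightarrow> (\<gamma> has_vector_derivative D t) (at t)"
    and c: "continuous_on ({0..1} - S) D" "continuous_on {0..1} \<gamma>"
    by (rule valid_pathE[OF v(1)]; blast)
  have im: "\<gamma> t \<in> U" if "t \<in> {0..1}" for t using v(2) that by (auto simp: path_image_def)
  let ?D = "\<lambda>t. complex_jacobian \<psi> (\<gamma> t) *v D t"
  have D': "((\<psi> \<circ> \<gamma>) has_vector_derivative ?D t) (at t)" if t: "t \<in> {0..1} - S" for t
  proof -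
    have "((\<lambda>t. \<psi> (\<gamma> t)) has_derivative (\<lambda>h. complex_jacobian \<psi> (\<gamma> t) *v (h *\<^sub>R D t))) (at t)"
      by (rule has_derivative_compose[OF D[OF t, unfolded has_vector_derivative_def] A.derivative])
         (use im t in auto)
    then show ?thesis
      by (simp add: has_vector_derivative_def o_def linear_cmul[OF linear_matrix_vector])
  qed
  have jc: "continuous_on U (\<lambda>z. complex_jacobian \<psi> z $ i $ j)" for i j
    by (rule hol_fun_continuous[OF hol_fun_jacobian_entry[OF A.hol open_U]])
  have "continuous_on ({0..1} - S) ?D"
    unfolding matrix_vector_mult_def using im
    by (intro continuous_intros continuous_on_compose2[OF jc] c(1) continuous_on_subset[OF c(2)]) auto
  moreover have "continuous_on {0..1} (\<psi> \<circ> \<gamma>)"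
    using im by (intro continuous_on_compose c continuous_on_subset[OF A.continuous]) auto
  ultimately have "valid_path (\<psi> \<circ> \<gamma>)" using S D' by (intro valid_pathI)
  then have p: "\<psi> \<circ> \<gamma> \<in> paths (\<psi> x) (\<psi> y)"
    using v im A.maps_to unfolding paths_def
    by (auto simp: path_image_compose pathstart_compose pathfinish_compose subset_iff)
  have "bergman_length U (\<psi> \<circ> \<gamma>) = (\<integral>\<^sup>+t\<in>{0..1}. ennreal (bergman_norm U ((\<psi> \<circ> \<gamma>) t) (?D t)) \<partial>lborel)"
    by (rule bergman_length_eq[OF S D'])
  also have "\<dots> = (\<integral>\<^sup>+t\<in>{0..1}. ennreal (bergman_norm U (\<gamma> t) (D t)) \<partial>lborel)"
    using im by (intro nn_integral_cong) (auto simp: indicator_def bergman_norm_transform[OF psi])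
  also have "\<dots> = bergman_length U \<gamma>" by (rule bergman_length_eq[OF S D, symmetric])
  finally show "(INF \<gamma>\<in>paths (\<psi> x) (\<psi> y). bergman_length U \<gamma>) \<le> bergman_length U \<gamma>"
    using p by (metis INF_lower)
qed

text \<open>Images of paths show that an automorphism does not increase distances; applied to the
  inverse automorphism this gives equality.\<close>

lemma bd_transform:
  assumes psi: "automorphism U \<psi>" and xy: "x \<in> U" "y \<in> U"
  shows "bd (\<psi> x) (\<psi> y) = bd x y"
proof -
  interpret A: automorphism U \<psi> by fact
  have "edist (A.\<phi> (\<psi> x)) (A.\<phi> (\<psi> y)) \<le> edist (\<psi> x) (\<psi> y)"
    by (rule edist_transform_le[OF A.inverse_automorphism]) (use xy A.maps_to in auto)
  then have "edist (\<psi> x) (\<psi> y) = edist x y"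
    using edist_transform_le[OF psi xy] xy by simp
  then show ?thesis by (simp add: bd_eq)
qed

text \<open>A pointwise gradient bound relative to the metric integrates along any path to m times
  its length; the infimum over paths gives the distance.\<close>

lemma ln_kd_lipschitz:
  assumes m: "0 < m" and grad: "\<And>z v. z \<in> U \<Longrightarrow> \<bar>2 * Re (K1 z v) / kd z\<bar> \<le> m * bergman_norm U z v"
    and xy: "x \<in> U" "y \<in> U"
  shows "\<bar>ln (kd y) - ln (kd x)\<bar> \<le> m * bd x y"
proof -
  have "ennreal (\<bar>ln (kd y) - ln (kd x)\<bar> / m) \<le> bergman_length U \<gamma>" if g: "\<gamma> \<in> paths x y" for \<gamma>
  \<comment> \<open>A path of infinite length gives no constraint. Finite length makes the speed
    gauge integrable, as the comparison of integrals below requires.\<close>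
  proof (cases "bergman_length U \<gamma> = \<infinity>")
    case False
    from g have v: "valid_path \<gamma>" "path_image \<gamma> \<subseteq> U" "\<gamma> 0 = x" "\<gamma> 1 = y"
      by (auto simp: paths_def pathstart_def pathfinish_def)
    obtain D S where S: "finite S" and D: "\<And>t. t \<in> {0..1} - S \<Longrightarrow> (\<gamma> has_vector_derivative D t) (at t)"
      and c: "continuous_on ({0..1} - S) D" "continuous_on {0..1} \<gamma>"
      by (rule valid_pathE[OF v(1)]; blast)
    have im: "\<gamma> t \<in> U" if "t \<in> {0..1}" for t using v(2) that by (auto simp: path_image_def)
    let ?n = "\<lambda>t. bergman_norm U (\<gamma> t) (D t)"
    let ?N = "\<lambda>t. indicator {0..1} t *\<^sub>R ?n t"
    let ?u = "\<lambda>t. 2 * Re (K1 (\<gamma> t) (D t)) / kd (\<gamma> t)"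
    have N: "?N \<in> borel_measurable borel"
      by (rule integrand_measurable[OF S c]) (use im in auto)
    have N0: "0 \<le> ?N t" for t using im norm_nonneg by (auto simp: indicator_def)
    obtain r where r: "0 \<le> r" "bergman_length U \<gamma> = ennreal r"
      using False by (cases "bergman_length U \<gamma>") auto
    have "(\<integral>\<^sup>+t. ennreal (?N t) \<partial>lborel) = ennreal r"
    proof -
      have "(\<integral>\<^sup>+t. ennreal (?N t) \<partial>lborel) = (\<integral>\<^sup>+t\<in>{0..1}. ennreal (?n t) \<partial>lborel)"
        by (intro nn_integral_cong) (auto simp: indicator_def)
      also have "\<dots> = bergman_length U \<gamma>" by (rule bergman_length_eq[OF S D, symmetric])
      finally show ?thesis by (simp only: r(2))
    qed
    from nn_integral_has_integral[OF N N0 this r(1)] have "(?N has_integral r) UNIV" .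
    moreover have "?N = (\<lambda>t. if t \<in> {0..1} then ?n t else 0)" by (auto simp: indicator_def fun_eq_iff)
    ultimately have In: "(?n has_integral r) {0..1}" by (simp only: has_integral_restrict_UNIV)
    \<comment> \<open>The velocity may be unbounded near points of S. This form of the fundamental
      theorem asks only for a continuous primitive and for derivatives off S.\<close>
    have Iu: "(?u has_integral (ln (kd (\<gamma> 1)) - ln (kd (\<gamma> 0)))) {0..1}"
    proof (rule fundamental_theorem_of_calculus_interior_strong[OF S])
      fix t :: real assume t: "t \<in> {0<..<1} - S"
      then have t': "t \<in> {0..1} - S" "\<gamma> t \<in> U" using im by auto
      have "((\<lambda>t. ln (kd (\<gamma> t))) has_derivative (\<lambda>h. 2 * Re (K1 (\<gamma> t) (h *\<^sub>R D t)) / kd (\<gamma> t))) (at t)"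
        by (rule has_derivative_compose[OF D[OF t'(1), unfolded has_vector_derivative_def] ln_kd_has_derivative[OF t'(2)]])
      moreover have "h *\<^sub>R D t = of_real h *s D t" for h by (simp add: vec_eq_iff scaleR_conv_of_real[of h "_ :: complex"])
      ultimately show "((\<lambda>t. ln (kd (\<gamma> t))) has_vector_derivative ?u t) (at t)"
        by (simp add: has_vector_derivative_def K1_scale[OF t'(2)] mult_ac)
    next
      have "continuous_on {0..1} (\<lambda>t. kd (\<gamma> t))"
        by (rule continuous_on_compose2[OF kd_continuous c(2)]) (use im in auto)
      moreover have "kd (\<gamma> t) \<noteq> 0" if "t \<in> {0..1}" for t using kd_pos[OF im[OF that]] by simp
      ultimately show "continuous_on {0..1} (\<lambda>t. ln (kd (\<gamma> t)))" by (intro continuous_on_ln) auto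
    qed simp
    have b: "\<bar>?u t\<bar> \<le> m * ?n t" if "t \<in> {0..1}" for t by (rule grad[OF im[OF that]])
    have Im: "((\<lambda>t. m * ?n t) has_integral m * r) {0..1}" by (rule has_integral_mult_right[OF In])
    have "ln (kd (\<gamma> 1)) - ln (kd (\<gamma> 0)) \<le> m * r"
      by (rule has_integral_le[OF Iu Im]) (use abs_le_D1[OF b] in blast)
    moreover have "- (ln (kd (\<gamma> 1)) - ln (kd (\<gamma> 0))) \<le> m * r"
      by (rule has_integral_le[OF has_integral_neg[OF Iu] Im]) (use abs_le_D2[OF b] in blast)
    ultimately have "\<bar>ln (kd y) - ln (kd x)\<bar> \<le> m * r" using v by (simp add: abs_le_iff)
    then show ?thesis unfolding r(2) using m by (intro ennreal_leI) (simp add: field_simps)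
  qed simp
  then have "ennreal (\<bar>ln (kd y) - ln (kd x)\<bar> / m) \<le> edist x y"
    unfolding edist_def by (rule INF_greatest)
  then show ?thesis using m by (simp add: edist_bd[OF xy] bd_nonneg field_simps)
qed

end

section \<open>The gradient bound\<close>

context bounded_domain
begin

lemma weighted_integral:
  assumes [measurable]: "g \<in> borel_measurable M"
  shows "(\<integral>\<^sup>+w. g w \<partial>weighted_volume U \<beta>) = (\<integral>\<^sup>+w. ennreal (kd w powr (- \<beta>)) * g w \<partial>M)"
  unfolding weighted_volume_def by (subst nn_integral_density) auto

lemma homogeneous_automorphism:
  assumes "homogeneous U" "x \<in> U" "y \<in> U"
  obtains \<psi> where "automorphism U \<psi>" "\<psi> x = y"
  using assms unfolding homogeneous_def automorphism_def by (metis open_U bounded_U)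

text \<open>Substitute \<open>w = \<psi> z\<close> in the Forelli-Rudin integral; all Jacobian factors collect to the exponent \<open>m\<close>.\<close>

lemma forelli_rudin_pullback:
  assumes t: "t \<in> U" and psi: "automorphism U \<psi>" and m: "m = \<alpha> - 1 - 2 * \<beta>" "0 \<le> c"
    and FR: "(\<integral>\<^sup>+w. ennreal (cmod (K (\<psi> t) w) powr (1 + \<alpha>)) \<partial>weighted_volume U \<beta>)
          \<le> ennreal (c * kd (\<psi> t) powr (\<alpha> - \<beta>))"
  shows "(\<integral>\<^sup>+z. ennreal (cmod (K t z) powr (1 + \<alpha>) * kd z powr (- \<beta>) * cmod (jac \<psi> t / jac \<psi> z) powr m) \<partial>M)
     \<le> ennreal (c * kd t powr (\<alpha> - \<beta>))"
proof -
  interpret A: automorphism U \<psi> by fact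
  define a where "a = cmod (jac \<psi> t)"
  have a: "0 < a" using A.jac_nz[OF t] by (simp add: a_def)
  have tU: "\<psi> t \<in> U" by (rule A.maps_to[OF t])
  have Km: "(\<lambda>w. K s w) \<in> borel_measurable M" if "s \<in> U" for s
  proof -
    have "(\<lambda>w. cnj (K w s)) \<in> borel_measurable M" using hol_measurable[OF sesqD1[OF sesq_K that]] by measurable
    then show ?thesis by (rule measurable_cong[THEN iffD1, rotated]) (use K_hermitian[OF _ that] in simp)
  qed
  note [measurable] = Km[OF tU] Km[OF t] A.jac_measurable
  let ?T = "\<lambda>z. cmod (K t z) powr (1 + \<alpha>) * kd z powr (- \<beta>) * cmod (jac \<psi> t / jac \<psi> z) powr m"
  let ?g = "\<lambda>w. ennreal (kd w powr (- \<beta>)) * ennreal (cmod (K (\<psi> t) w) powr (1 + \<alpha>))"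
  have T: "?g (\<psi> z) * ennreal ((cmod (jac \<psi> z))\<^sup>2) = ennreal (a powr (- (1 + \<alpha> + m))) * ennreal (?T z)" if z: "z \<in> U" for z
  proof -
    define b where "b = cmod (jac \<psi> z)"
    have b: "0 < b" using A.jac_nz[OF z] by (simp add: b_def)
    define x where "x = cmod (K (\<psi> t) (\<psi> z))"
    define k where "k = kd (\<psi> z)"
    have k: "0 < k" unfolding k_def by (rule kd_pos[OF A.maps_to[OF z]])
    have x: "0 \<le> x" by (simp add: x_def)
    have Kt: "cmod (K t z) = a * x * b"
      unfolding K_transform[OF psi t z] by (simp add: a_def b_def x_def norm_mult)
    have kz: "kd z = b powr 2 * k" using kd_transform[OF psi z] b by (simp add: b_def k_def powr_numeral)
    \<comment> \<open>The powers of |J(z)|: 1 + \<alpha> from the kernel, -2\<beta> from the weight,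
      -m from the quotient. By the choice of m they add up to 2, the exponent of the real
      Jacobian.\<close>
    have bb: "b powr (1 + \<alpha>) * b powr (-(2 * \<beta>)) * b powr (- m) = b powr 2"
      unfolding powr_add[symmetric] by (rule arg_cong[where f = "\<lambda>e. b powr e"]) (simp add: m)
    have aa: "a powr (- (1 + \<alpha> + m)) * (a powr (1 + \<alpha>) * a powr m) = 1"
      unfolding powr_add[symmetric] using a by simp
    have "?T z = (a powr (1 + \<alpha>) * a powr m) * (b powr (1 + \<alpha>) * b powr (-(2 * \<beta>)) * b powr (- m)) * (x powr (1 + \<alpha>) * k powr (- \<beta>))"
    proof -
      have "(a * x * b) powr (1 + \<alpha>) = a powr (1 + \<alpha>) * x powr (1 + \<alpha>) * b powr (1 + \<alpha>)"
        using a b x by (simp add: powr_mult)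
      moreover have "(b powr 2 * k) powr (- \<beta>) = b powr (-(2 * \<beta>)) * k powr (- \<beta>)"
        using k powr_powr[of b 2 "- \<beta>"] by (subst powr_mult) (simp_all del: powr_numeral)
      moreover have "(a / b) powr m = a powr m * b powr (- m)"
        using powr_divide[of a b m] a b by (simp add: powr_minus_divide)
      ultimately show ?thesis
        unfolding Kt kz norm_divide a_def[symmetric] b_def[symmetric] by (simp only: mult_ac)
    qed
    then have "a powr (- (1 + \<alpha> + m)) * ?T z = k powr (- \<beta>) * x powr (1 + \<alpha>) * b\<^sup>2"
      unfolding bb using aa b by (simp add: powr_numeral)
    moreover have "?g (\<psi> z) * ennreal ((cmod (jac \<psi> z))\<^sup>2) = ennreal (k powr (- \<beta>) * x powr (1 + \<alpha>) * b\<^sup>2)"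
      by (simp add: k_def x_def b_def ennreal_mult)
    ultimately show ?thesis by (simp add: ennreal_mult[symmetric])
  qed
  have "ennreal (a powr (- (1 + \<alpha> + m))) * (\<integral>\<^sup>+z. ennreal (?T z) \<partial>M)
     = (\<integral>\<^sup>+z. ennreal (a powr (- (1 + \<alpha> + m))) * ennreal (?T z) \<partial>M)"
    by (subst nn_integral_cmult) auto
  also have "\<dots> = (\<integral>\<^sup>+z. ?g (\<psi> z) * ennreal ((cmod (jac \<psi> z))\<^sup>2) \<partial>M)"
    by (intro nn_integral_cong) (simp only: space_M T)
  also have "\<dots> = (\<integral>\<^sup>+w. ?g w \<partial>M)"
    by (rule A.nn_integral_change) measurable
  also have "\<dots> = (\<integral>\<^sup>+w. ennreal (cmod (K (\<psi> t) w) powr (1 + \<alpha>)) \<partial>weighted_volume U \<beta>)"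
    by (rule weighted_integral[symmetric]) measurable
  also have "\<dots> \<le> ennreal (c * kd (\<psi> t) powr (\<alpha> - \<beta>))" by (rule FR)
  \<comment> \<open>On the right |J(t)| occurs through K(t,t) = |J(t)|^2 K(\<psi>(t),\<psi>(t)).
    Since 2(\<alpha> - \<beta>) = 1 + \<alpha> + m, both sides carry the same power of |J(t)| and
    the final bound does not see \<psi>.\<close>
  also have "c * kd (\<psi> t) powr (\<alpha> - \<beta>) = a powr (- (1 + \<alpha> + m)) * (c * kd t powr (\<alpha> - \<beta>))"
  proof -
    have "kd t = a powr 2 * kd (\<psi> t)" using kd_transform[OF psi t] a by (simp add: a_def powr_numeral)
    then have kt: "kd t powr (\<alpha> - \<beta>) = a powr (2 * (\<alpha> - \<beta>)) * kd (\<psi> t) powr (\<alpha> - \<beta>)"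
      using kd_pos[OF tU] powr_powr[of a 2 "\<alpha> - \<beta>"] by (simp only:) (subst powr_mult, simp_all del: powr_numeral)
    have "a powr (- (1 + \<alpha> + m)) * a powr (2 * (\<alpha> - \<beta>)) = 1"
      unfolding powr_add[symmetric] using a by (simp add: m algebra_simps)
    then have "(a powr (- (1 + \<alpha> + m)) * a powr (2 * (\<alpha> - \<beta>))) * (c * kd (\<psi> t) powr (\<alpha> - \<beta>)) = c * kd (\<psi> t) powr (\<alpha> - \<beta>)"
      by simp
    then show ?thesis unfolding kt by (simp only: mult_ac)
  qed
  finally have "ennreal (a powr (- (1 + \<alpha> + m))) * (\<integral>\<^sup>+z. ennreal (?T z) \<partial>M)
     \<le> ennreal (a powr (- (1 + \<alpha> + m))) * ennreal (c * kd t powr (\<alpha> - \<beta>))"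
    using m(2) by (simp add: ennreal_mult)
  then show ?thesis
    by (subst (asm) ennreal_mult_le_mult_iff) (use a in auto)
qed

lemma jac_quotient_bounded:
  assumes fr: "forelli_rudin U" and t: "t \<in> U"
  shows "\<exists>C>0. \<forall>\<psi> v. automorphism U \<psi> \<longrightarrow> cmod (dd (jac \<psi>) t v / jac \<psi> t) \<le> C * norm v"
proof -
  define \<beta> where "\<beta> = \<bar>beta_min U\<bar> + 1"
  have \<beta>: "beta_min U < \<beta>" "0 < \<beta>" by (auto simp: \<beta>_def)
  obtain \<alpha>0 where fr0: "\<forall>\<alpha>'>\<alpha>0. \<exists>c. \<forall>z\<in>U.
      (\<integral>\<^sup>+w. ennreal (cmod (K z w) powr (1 + \<alpha>')) \<partial>weighted_volume U \<beta>) \<le> ennreal (c * kd z powr (\<alpha>' - \<beta>))"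
    using fr \<beta>(1) unfolding forelli_rudin_def by blast
  \<comment> \<open>m \<ge> 1 is required by the sub-mean value inequality for |J(t)/J|^m, and
    \<open>\<alpha>\<close>, determined by m through the exponent relation, has to exceed the
    Forelli-Rudin threshold \<alpha>0.\<close>
  define m where "m = \<bar>\<alpha>0\<bar> + 1"
  define \<alpha> where "\<alpha> = 1 + 2 * \<beta> + m"
  have "\<alpha>0 < \<alpha>" "1 \<le> m" using \<beta>(2) by (auto simp: \<alpha>_def m_def)
  then obtain c where c: "\<forall>z\<in>U. (\<integral>\<^sup>+w. ennreal (cmod (K z w) powr (1 + \<alpha>)) \<partial>weighted_volume U \<beta>)
      \<le> ennreal (c * kd z powr (\<alpha> - \<beta>))"
    using fr0 by blast
  define C2 where "C2 = max c 0 * kd t powr (\<alpha> - \<beta>)"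
  let ?T = "\<lambda>\<psi> z. cmod (K t z) powr (1 + \<alpha>) * kd z powr (- \<beta>) * cmod (jac \<psi> t / jac \<psi> z) powr m"
  have int: "(\<integral>\<^sup>+z. ennreal (?T \<psi> z) \<partial>M) \<le> ennreal C2" if psi: "automorphism U \<psi>" for \<psi>
    unfolding C2_def
  proof (rule forelli_rudin_pullback[OF t psi])
    have "\<psi> t \<in> U" using automorphism.maps_to[OF psi t] .
    then have "(\<integral>\<^sup>+w. ennreal (cmod (K (\<psi> t) w) powr (1 + \<alpha>)) \<partial>weighted_volume U \<beta>) \<le> ennreal (c * kd (\<psi> t) powr (\<alpha> - \<beta>))"
      using c by blast
    also have "\<dots> \<le> ennreal (max c 0 * kd (\<psi> t) powr (\<alpha> - \<beta>))"
      by (intro ennreal_leI mult_right_mono) auto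
    finally show "(\<integral>\<^sup>+w. ennreal (cmod (K (\<psi> t) w) powr (1 + \<alpha>)) \<partial>weighted_volume U \<beta>) \<le> ennreal (max c 0 * kd (\<psi> t) powr (\<alpha> - \<beta>))" .
  qed (auto simp: \<alpha>_def)
  define F where "F z = cmod (K t z) powr (1 + \<alpha>) * kd z powr (- \<beta>)" for z
  define c1 where "c1 = F t / 2"
  have kt: "0 < kd t" by (rule kd_pos[OF t])
  have Ft: "0 < F t" using kt by (simp add: F_def K_diag[OF t])
  have c1: "0 < c1" "c1 < F t" using Ft by (auto simp: c1_def)
  have cK: "continuous_on U (\<lambda>z. K t z)"
    using continuous_on_cnj[OF hol_fun_continuous[OF sesqD2[OF sesq_K t]]] by simp
  have "(F \<longlongrightarrow> F t) (at t)"
  proof -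
    have "((\<lambda>z. K t z) \<longlongrightarrow> K t t) (at t)" "(kd \<longlongrightarrow> kd t) (at t)"
      using cK kd_continuous t open_U by (simp_all add: continuous_on_eq_continuous_at isCont_def)
    then show ?thesis unfolding F_def
      using kt by (intro tendsto_intros) (auto simp: K_diag[OF t])
  qed
  then have "eventually (\<lambda>z. c1 < F z) (nhds t)"
    using c1(2) by (simp add: tendsto_at_iff_tendsto_nhds order_tendstoD(1))
  then obtain d where d: "0 < d" "\<forall>z. dist z t < d \<longrightarrow> c1 < F z" unfolding eventually_nhds_metric by blast
  obtain d' where d': "0 < d'" "ball t d' \<subseteq> U" using open_U t open_contains_ball by blast
  define \<delta> where "\<delta> = min d d'"
  have \<delta>: "0 < \<delta>" "ball t \<delta> \<subseteq> U" "\<And>z. z \<in> ball t \<delta> \<Longrightarrow> c1 < F z"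
    using d d' by (auto simp: \<delta>_def dist_commute)
  have V: "0 < ball_vol (\<delta>/2)" using \<delta> by (intro ball_vol_pos) simp
  define C3 where "C3 = C2 / (c1 * ball_vol (\<delta>/2))"
  have C2: "0 \<le> C2" by (simp add: C2_def)
  have C3: "0 \<le> C3" using c1 V C2 by (simp add: C3_def)
  define C where "C = 2 * (1 + C3) / \<delta>"
  have "cmod (dd (jac \<psi>) t v / jac \<psi> t) \<le> C * norm v" if psi: "automorphism U \<psi>" for \<psi> v
  proof -
    interpret A: automorphism U \<psi> by fact
    \<comment> \<open>Normalised to f(t) = 1. Its derivative at t is -dJ/J, so Cauchy's estimate for
      f is the desired bound.\<close>
    define f where "f = (\<lambda>z. jac \<psi> t * inverse (jac \<psi> z))"
    have hf: "hol_fun f U" unfolding f_def by (intro hol_fun_cmult hol_fun_inverse A.hol_jac A.jac_nz)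
    have "cmod (f y) \<le> 1 + C3" if y: "y \<in> ball t (\<delta>/2)" for y
    proof -
      have sub: "ball y (\<delta>/2) \<subseteq> ball t \<delta>"
      proof
        fix x assume "x \<in> ball y (\<delta>/2)"
        then show "x \<in> ball t \<delta>" using y dist_triangle[of t x y] by simp
      qed
      have meas: "(\<lambda>x. ennreal (cmod (f x) powr m) * indicator (ball y (\<delta>/2)) x) \<in> borel_measurable M"
      proof -
        note [measurable] = hol_measurable[OF hf]
        have [measurable]: "(\<lambda>x. indicator (ball y (\<delta>/2)) x :: ennreal) \<in> borel_measurable M"
          by (intro measurable_restrict_space1 borel_measurable_indicator) simp
        show ?thesis by measurable
      qed
      have "ennreal (c1 * (cmod (f y) powr m * ball_vol (\<delta>/2)))
          = ennreal c1 * (ennreal (cmod (f y) powr m) * ennreal (ball_vol (\<delta>/2)))"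
        using c1 V by (simp add: ennreal_mult)
      also have "\<dots> \<le> ennreal c1 * (\<integral>\<^sup>+x\<in>ball y (\<delta>/2). ennreal (cmod (f x) powr m) \<partial>M)"
        by (intro mult_left_mono submean_M[OF hf]) (use \<delta> sub \<open>1 \<le> m\<close> in auto)
      also have "\<dots> = (\<integral>\<^sup>+x. ennreal c1 * (ennreal (cmod (f x) powr m) * indicator (ball y (\<delta>/2)) x) \<partial>M)"
        by (rule nn_integral_cmult[symmetric, OF meas])
      also have "\<dots> \<le> (\<integral>\<^sup>+x. ennreal (?T \<psi> x) \<partial>M)"
      proof (intro nn_integral_mono)
        fix x
        show "ennreal c1 * (ennreal (cmod (f x) powr m) * indicator (ball y (\<delta>/2)) x) \<le> ennreal (?T \<psi> x)"
        proof (cases "x \<in> ball y (\<delta>/2)")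
          case True
          then have "c1 \<le> F x" using \<delta>(3) sub by (meson less_imp_le subsetD)
          then have "c1 * cmod (f x) powr m \<le> ?T \<psi> x"
            unfolding F_def f_def divide_inverse by (intro mult_right_mono) auto
          then show ?thesis using True c1 by (simp add: ennreal_mult[symmetric] ennreal_leI)
        qed simp
      qed
      also have "\<dots> \<le> ennreal C2" by (rule int[OF psi])
      finally have "c1 * (cmod (f y) powr m * ball_vol (\<delta>/2)) \<le> C2" using C2 by simp
      then have le: "cmod (f y) powr m \<le> C3" using c1 V by (simp add: C3_def pos_le_divide_eq mult_ac)
      show ?thesis
      \<comment> \<open>For m \<ge> 1, |f| is at most |f|^m only where |f| \<ge> 1; the other case
        is the origin of the summand 1 in 1 + \<open>C3\<close>.\<close>
      proof (cases "cmod (f y) \<le> 1")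
        case False
        then have "cmod (f y) powr 1 \<le> cmod (f y) powr m" using \<open>1 \<le> m\<close> by (intro powr_mono) auto
        then show ?thesis using le False by simp
      qed (use C3 in simp)
    qed
    then have "cmod (dd f t v) \<le> (1 + C3) * norm v / (\<delta>/2)"
      using \<delta> by (intro cauchy_bound hol_fun_subset[OF hf]) auto
    moreover have "dd f t v = - (dd (jac \<psi>) t v / jac \<psi> t)"
    proof -
      have "((\<lambda>z. jac \<psi> t * inverse (jac \<psi> z)) has_derivative (\<lambda>v. jac \<psi> t * (- (inverse (jac \<psi> t) * dd (jac \<psi>) t v * inverse (jac \<psi> t))))) (at t)"
        by (intro has_derivative_mult_right Deriv.has_derivative_inverse A.jac_nz t hol_fun_has_derivative[OF A.hol_jac])
      from dd_eqI[OF this] show ?thesis unfolding f_def using A.jac_nz[OF t] by (simp add: field_simps)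
    qed
    moreover have "(1 + C3) * norm v / (\<delta>/2) = C * norm v" by (simp add: C_def algebra_simps)
    ultimately show ?thesis by (simp only: norm_minus_cancel)
  qed
  moreover have "0 < C" using \<delta> C3 by (simp add: C_def add_pos_nonneg)
  ultimately show ?thesis by blast
qed

text \<open>At t the derivative of ln K is one fixed linear functional, hence bounded. Transport to
  z by an automorphism adds only dJ/J at t, and the metric is invariant, so a bound for u at t
  becomes one for v at z.\<close>

theorem gradient_bound:
  assumes fr: "forelli_rudin U" and hom: "homogeneous U"
  shows "\<exists>m>0. \<forall>z\<in>U. \<forall>v. \<bar>2 * Re (K1 z v) / kd z\<bar> \<le> m * bergman_norm U z v"
proof -
  obtain t where t: "t \<in> U" using U_nonempty by blast
  obtain C where C: "0 < C" "\<And>\<psi> v. automorphism U \<psi> \<Longrightarrow> cmod (dd (jac \<psi>) t v / jac \<psi> t) \<le> C * norm v"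
    using jac_quotient_bounded[OF fr t] by blast
  obtain c where c: "0 < c" "\<And>v. c * norm v \<le> bergman_norm U t v" using norm_lower[OF t] by blast
  have bl: "bounded_linear (K1 t)" unfolding K1_def[abs_def] by (rule dd_linear[OF sesqD1[OF sesq_K t] t])
  obtain B where B: "\<And>v. norm (K1 t v) \<le> norm v * B" using bounded_linear.bounded[OF bl] by blast
  have kt: "0 < kd t" by (rule kd_pos[OF t])
  define E where "E = max B 0 / kd t + C"
  have E: "0 < E" using C kt by (simp add: E_def add_nonneg_pos)
  have "\<bar>2 * Re (K1 z v) / kd z\<bar> \<le> (2 * E / c) * bergman_norm U z v" if z: "z \<in> U" for z v
  proof -
    obtain \<psi> where psi: "automorphism U \<psi>" "\<psi> t = z" using homogeneous_automorphism[OF hom t z] .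
    interpret A: automorphism U \<psi> by fact
    have kz: "0 < kd z" by (rule kd_pos[OF z])
    define u where "u = complex_jacobian A.\<phi> z *v v"
    have "complex_jacobian \<psi> t ** complex_jacobian A.\<phi> z = mat 1"
      using A.jac_inverse[OF t] psi(2) matrix_left_right_inverse by metis
    then have u: "complex_jacobian \<psi> t *v u = v" by (simp add: u_def matrix_vector_mul_assoc)
    define j where "j = jac \<psi> t"
    have j: "j \<noteq> 0" unfolding j_def by (rule A.jac_nz[OF t])
    have ktz: "complex_of_real (kd t) = j * cnj j * of_real (kd z)"
      using kd_transform[OF psi(1) t] psi(2) by (simp add: j_def complex_norm_square del: of_real_power)
    have "K1 t u = (dd (jac \<psi>) t u * of_real (kd z) + j * K1 z v) * cnj j"
      using K1_transform[OF psi(1) t, of u] psi(2) u by (simp add: j_def)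
    \<comment> \<open>The differentiated transformation law divided by the undifferentiated one: the
      logarithmic derivative of a product is a sum.\<close>
    then have "K1 t u / of_real (kd t) = dd (jac \<psi>) t u / j + K1 z v / of_real (kd z)"
      unfolding ktz using j kz by (simp add: field_simps)
    then have "K1 z v / of_real (kd z) = K1 t u / of_real (kd t) - dd (jac \<psi>) t u / j" by simp
    then have "cmod (K1 z v / of_real (kd z)) \<le> cmod (K1 t u / of_real (kd t)) + cmod (dd (jac \<psi>) t u / j)"
      by (simp add: norm_triangle_ineq4)
    also have "\<dots> \<le> max B 0 / kd t * norm u + C * norm u"
    proof (rule add_mono)
      have "cmod (K1 t u) \<le> norm u * max B 0" using B[of u] by (meson max.cobounded1 mult_left_mono norm_ge_zero order_trans)
      then show "cmod (K1 t u / of_real (kd t)) \<le> max B 0 / kd t * norm u"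
        using kt by (simp add: norm_divide field_simps)
      show "cmod (dd (jac \<psi>) t u / j) \<le> C * norm u" using C(2)[OF psi(1)] by (simp add: j_def)
    qed
    also have "\<dots> = E * norm u" by (simp add: E_def algebra_simps)
    also have "norm u \<le> bergman_norm U t u / c" using c by (simp add: pos_le_divide_eq mult.commute)
    also have "bergman_norm U t u = bergman_norm U z v" using bergman_norm_transform[OF psi(1) t, of u] u psi(2) by simp
    finally have "cmod (K1 z v) / kd z \<le> E * (bergman_norm U z v / c)" using E kz by (simp add: norm_divide)
    moreover have "\<bar>2 * Re (K1 z v) / kd z\<bar> \<le> 2 * (cmod (K1 z v) / kd z)"
      using abs_Re_le_cmod[of "K1 z v"] kz by (simp add: abs_mult divide_right_mono)
    ultimately show ?thesis by simp
  qed
  moreover have "0 < 2 * E / c" using E c by simp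
  ultimately show ?thesis by blast
qed

end

section \<open>Averages over Bergman balls\<close>

text \<open>Raises the sub-mean value inequality to the power q/s; an infinite integral makes the
  right side infinite because c is positive.\<close>

lemma ennreal_powr_le:
  assumes "ennreal (x powr s) \<le> ennreal c * I" "0 \<le> x" "0 < c" "0 < s" "0 < q"
  shows "ennreal (x powr q) \<le> ennreal (c powr (q / s)) * ennreal_powr I (q / s)"
proof (cases "I = \<infinity>")
  case True
  then show ?thesis using assms(3) by (simp add: ennreal_powr_def ennreal_mult_top)
next
  case False
  then obtain i where i: "0 \<le> i" "I = ennreal i" by (cases I) auto
  have le: "x powr s \<le> c * i" using assms(1,3) i by (simp add: ennreal_mult[symmetric])
  have "x powr q = (x powr s) powr (q / s)" using assms(4) by (simp add: powr_powr)
  also have "\<dots> \<le> (c * i) powr (q / s)" using le assms(4,5) by (intro powr_mono2) auto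
  also have "\<dots> = c powr (q / s) * i powr (q / s)" using assms(3) i by (simp add: powr_mult)
  finally show ?thesis using i by (simp add: ennreal_powr_def ennreal_mult[symmetric] ennreal_leI)
qed

text \<open>The Forelli-Rudin hypothesis enters the estimates below through the number g, a
  Lipschitz constant of ln K(z,z) for the Bergman distance.\<close>

locale homogeneous_fr_domain = bounded_domain U for U :: "(complex ^ 'n) set" +
  fixes g :: real
  assumes hom: "homogeneous U" and g_pos: "0 < g"
    and grad: "\<And>z v. z \<in> U \<Longrightarrow> \<bar>2 * Re (K1 z v) / kd z\<bar> \<le> g * bergman_norm U z v"
begin

abbreviation B :: "complex ^ 'n \<Rightarrow> real \<Rightarrow> (complex ^ 'n) set" where "B \<equiv> bergman_ball U"

lemma B_sub: "B x r \<subseteq> U" and mem_B: "y \<in> B x r \<longleftrightarrow> y \<in> U \<and> bd x y \<le> r"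
  by (auto simp: bergman_ball_def)

lemma B_sets: assumes "x \<in> U" shows "B x r \<in> sets M"
proof -
  have "continuous_on U (\<lambda>y. bd x y)"
    using continuous_on_compose2[OF bd_continuous continuous_on_Pair[OF continuous_on_const[of U x] continuous_on_id]] assms by auto
  then have [measurable]: "(\<lambda>y. bd x y) \<in> borel_measurable M" by (rule continuous_measurable)
  have "{y \<in> space M. bd x y \<le> r} \<in> sets M" by measurable
  then show ?thesis by (simp add: bergman_ball_def)
qed

lemma B_indicator [measurable]: "x \<in> U \<Longrightarrow> (\<lambda>y. indicator (B x r) y :: ennreal) \<in> borel_measurable M"
  by (intro borel_measurable_indicator B_sets)

lemma emeasure_B: "x \<in> U \<Longrightarrow> emeasure lborel (B x r) = emeasure M (B x r)"
  by (rule emeasure_restrict_space[symmetric]) (auto simp: B_sub)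

lemma finite_B: "x \<in> U \<Longrightarrow> emeasure M (B x r) < \<infinity>"
  using finite_measure.emeasure_finite[OF finite_M] by (simp add: less_top)

lemma kd_compare:
  assumes "x \<in> U" "y \<in> U" "bd x y \<le> r"
  shows "kd y \<le> exp (g * r) * kd x" "kd x \<le> exp (g * r) * kd y"
proof -
  have "\<bar>ln (kd y) - ln (kd x)\<bar> \<le> g * bd x y" by (rule ln_kd_lipschitz[OF g_pos grad assms(1,2)])
  also have "\<dots> \<le> g * r" using assms(3) g_pos by simp
  finally have l: "ln (kd y) \<le> g * r + ln (kd x)" "ln (kd x) \<le> g * r + ln (kd y)" by auto
  have "exp (ln (kd y)) \<le> exp (g * r + ln (kd x))" "exp (ln (kd x)) \<le> exp (g * r + ln (kd y))"
    using l by simp_all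
  then show "kd y \<le> exp (g * r) * kd x" "kd x \<le> exp (g * r) * kd y"
    using kd_pos[OF assms(1)] kd_pos[OF assms(2)] by (simp_all add: exp_add)
qed

lemma kd_lower:
  assumes "x \<in> U" "y \<in> B x r"
  shows "exp (- (g * r)) * kd x \<le> kd y"
  using kd_compare(2)[OF assms(1), of y r] assms(2) by (simp add: mem_B exp_minus field_simps)

lemma exp_mult_powr: "0 < x \<Longrightarrow> (exp c * x) powr a = exp (c * a) * x powr (a::real)"
  by (simp add: powr_def ln_mult exp_add[symmetric] algebra_simps)

text \<open>The absolute value of the exponent covers negative powers, for which the two points
  exchange roles.\<close>

lemma kd_powr_compare:
  assumes "x \<in> U" "y \<in> U" "bd x y \<le> r"
  shows "kd y powr a \<le> exp (g * r * \<bar>a\<bar>) * kd x powr a"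
proof (cases "0 \<le> a")
  case True
  have "kd y powr a \<le> (exp (g * r) * kd x) powr a"
    using kd_compare(1)[OF assms] kd_pos[OF assms(2)] True by (intro powr_mono2) auto
  then show ?thesis using True by (simp add: exp_mult_powr[OF kd_pos[OF assms(1)]])
next
  case False
  have "kd x powr (- a) \<le> (exp (g * r) * kd y) powr (- a)"
    using kd_compare(2)[OF assms] kd_pos[OF assms(1)] False by (intro powr_mono2) auto
  also have "\<dots> = exp (g * r * \<bar>a\<bar>) * kd y powr (- a)"
    using False by (simp add: exp_mult_powr[OF kd_pos[OF assms(2)]])
  finally show ?thesis
    using kd_pos[OF assms(1)] kd_pos[OF assms(2)] by (simp add: powr_minus field_simps)
qed

section \<open>Volumes of Bergman balls and mean values over them\<close>

lemma automorphism_to: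
  assumes "t \<in> U" "x \<in> U"
  obtains \<psi> where "automorphism U \<psi>" "\<psi> t = x" "\<And>z. z \<in> U \<Longrightarrow> \<psi> z \<in> B x r \<longleftrightarrow> z \<in> B t r"
proof -
  obtain \<psi> where p: "automorphism U \<psi>" "\<psi> t = x" using homogeneous_automorphism[OF hom assms] .
  have "\<psi> z \<in> B x r \<longleftrightarrow> z \<in> B t r" if "z \<in> U" for z
    using bd_transform[OF p(1) assms(1) that] automorphism.maps_to[OF p(1) that] that by (simp add: mem_B p(2))
  then show ?thesis using that p by blast
qed

text \<open>The measure \<open>K(z,z) dV\<close> is invariant under automorphisms.\<close>

lemma invariant_volume:
  assumes t: "t \<in> U" and x: "x \<in> U"
  shows "(\<integral>\<^sup>+z\<in>B x r. ennreal (kd z) \<partial>M) = (\<integral>\<^sup>+z\<in>B t r. ennreal (kd z) \<partial>M)"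
proof -
  obtain \<psi> where p: "automorphism U \<psi>" "\<psi> t = x" "\<And>z. z \<in> U \<Longrightarrow> \<psi> z \<in> B x r \<longleftrightarrow> z \<in> B t r"
    using automorphism_to[OF t x] by metis
  interpret A: automorphism U \<psi> by fact
  note [measurable] = B_indicator[OF x]
  have "(\<integral>\<^sup>+z\<in>B x r. ennreal (kd z) \<partial>M) = (\<integral>\<^sup>+z. ennreal (kd (\<psi> z)) * indicator (B x r) (\<psi> z) * ennreal ((cmod (jac \<psi> z))\<^sup>2) \<partial>M)"
    by (rule A.nn_integral_change[symmetric]) measurable
  also have "\<dots> = (\<integral>\<^sup>+z\<in>B t r. ennreal (kd z) \<partial>M)"
  proof (rule nn_integral_cong)
    fix z assume "z \<in> space M"
    then have z: "z \<in> U" by simp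
    show "ennreal (kd (\<psi> z)) * indicator (B x r) (\<psi> z) * ennreal ((cmod (jac \<psi> z))\<^sup>2) = ennreal (kd z) * indicator (B t r) z"
      using p(3)[OF z] kd_transform[OF p(1) z] kd_pos[OF A.maps_to[OF z]]
      by (auto simp: indicator_def ennreal_mult[symmetric] mult.commute less_imp_le)
  qed
  finally show ?thesis .
qed

text \<open>The invariant volume of B(x,r) does not depend on x, and on that ball K stays within a
  factor exp(g r) of K(x,x); so the Lebesgue volume is at most a constant over K(x,x).\<close>

lemma volume_upper:
  "\<exists>C>0. \<forall>x\<in>U. measure lborel (B x r) \<le> C / kd x"
proof -
  obtain t where t: "t \<in> U" using U_nonempty by blast
  let ?I = "\<integral>\<^sup>+z\<in>B t r. ennreal (kd z) \<partial>M"
  have "?I \<le> (\<integral>\<^sup>+z. ennreal (exp (g * r) * kd t) * indicator (B t r) z \<partial>M)"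
    using kd_compare(1)[OF t] by (intro nn_integral_mono) (auto simp: indicator_def mem_B intro!: ennreal_leI)
  also have "\<dots> = ennreal (exp (g * r) * kd t) * emeasure M (B t r)"
    by (rule nn_integral_cmult_indicator[OF B_sets[OF t]])
  also have "\<dots> < \<infinity>" using finite_B[OF t] by (simp add: ennreal_mult_less_top)
  finally obtain i where i: "0 \<le> i" "?I = ennreal i" by (cases ?I) auto
  \<comment> \<open>\<open>i + 1\<close> in place of i keeps the constant positive without knowing
    that the invariant volume is.\<close>
  have "measure lborel (B x r) \<le> (exp (g * r) * (i + 1)) / kd x" if x: "x \<in> U" for x
  proof -
    have kx: "0 < kd x" by (rule kd_pos[OF x])
    have "ennreal (exp (- (g * r)) * kd x) * emeasure M (B x r) = (\<integral>\<^sup>+z. ennreal (exp (- (g * r)) * kd x) * indicator (B x r) z \<partial>M)"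
      by (rule nn_integral_cmult_indicator[symmetric, OF B_sets[OF x]])
    also have "\<dots> \<le> (\<integral>\<^sup>+z\<in>B x r. ennreal (kd z) \<partial>M)"
      using kd_lower[OF x] by (intro nn_integral_mono) (auto simp: indicator_def intro!: ennreal_leI)
    also have "\<dots> = ennreal i" using invariant_volume[OF t x] i by simp
    finally have "ennreal (exp (- (g * r)) * kd x * measure lborel (B x r)) \<le> ennreal i"
      using finite_B[OF x] emeasure_B[OF x] kx
      by (simp add: ennreal_mult emeasure_eq_ennreal_measure measure_def)
    then have "exp (- (g * r)) * kd x * measure lborel (B x r) \<le> i" using i by (simp add: ennreal_le_iff)
    then show ?thesis using kx by (simp add: exp_minus field_simps) (smt (verit) exp_gt_zero)
  qed
  moreover have "0 < exp (g * r) * (i + 1)" using i by simp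
  ultimately show ?thesis by blast
qed

text \<open>A positive inner radius at a single point; invariance then gives volume and mean value
  estimates at every point.\<close>

lemma euclidean_ball:
  assumes t: "t \<in> U" and r: "0 < r"
  shows "\<exists>d>0. ball t d \<subseteq> B t r"
proof -
  obtain R C where R: "0 < R" "0 < C" "ball t R \<subseteq> U" "\<forall>x\<in>ball t R. \<forall>y\<in>ball t R. bd x y \<le> C * norm (y - x)"
    using bd_local[OF t] by blast
  have "ball t (min R (r / C)) \<subseteq> B t r"
  proof
    fix y assume y: "y \<in> ball t (min R (r / C))"
    then have "bd t y \<le> C * norm (y - t)" using R by simp
    also have "\<dots> \<le> C * (r / C)" using y R by (intro mult_left_mono) (auto simp: dist_norm norm_minus_commute)
    finally show "y \<in> B t r" using y R by (auto simp: mem_B)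
  qed
  then show ?thesis using R r by (intro exI[of _ "min R (r / C)"]) auto
qed

lemma volume_lower:
  assumes r: "0 < r"
  shows "\<exists>c>0. \<forall>x\<in>U. ennreal (c / kd x) \<le> emeasure M (B x r)"
proof -
  obtain t where t: "t \<in> U" using U_nonempty by blast
  obtain d where d: "0 < d" "ball t d \<subseteq> B t r" using euclidean_ball[OF t r] by blast
  have kt: "0 < kd t" by (rule kd_pos[OF t])
  let ?E = "exp (- (g * r))"
  \<comment> \<open>One factor \<open>?E\<close> compares K with K(t,t) on B(t,r), the other
    compares K with K(x,x) on B(x,r).\<close>
  define c where "c = ?E * kd t * ball_vol d * ?E"
  have c: "0 < c" using kt ball_vol_pos[OF d(1)] by (simp add: c_def)
  have "ennreal (ball_vol d) = emeasure lborel (ball t d)" using emeasure_ball_vol[OF d(1)] by simp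
  also have "\<dots> \<le> emeasure lborel (B t r)"
    using B_sets[OF t] by (intro emeasure_mono d(2)) (simp add: sets_restrict_space_iff)
  finally have bv: "ennreal (ball_vol d) \<le> emeasure M (B t r)" using emeasure_B[OF t] by simp
  have "ennreal (c / kd x) \<le> emeasure M (B x r)" if x: "x \<in> U" for x
  proof -
    have kx: "0 < kd x" by (rule kd_pos[OF x])
    have "ennreal (?E * kd t * ball_vol d) = ennreal (?E * kd t) * ennreal (ball_vol d)"
      using kt ball_vol_pos[OF d(1)] by (simp add: ennreal_mult)
    also have "\<dots> \<le> ennreal (?E * kd t) * emeasure M (B t r)" by (rule mult_left_mono[OF bv]) simp
    also have "\<dots> = (\<integral>\<^sup>+z. ennreal (?E * kd t) * indicator (B t r) z \<partial>M)"
      by (rule nn_integral_cmult_indicator[symmetric, OF B_sets[OF t]])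
    also have "\<dots> \<le> (\<integral>\<^sup>+z\<in>B t r. ennreal (kd z) \<partial>M)"
      using kd_lower[OF t] by (intro nn_integral_mono) (auto simp: indicator_def intro!: ennreal_leI)
    also have "\<dots> = (\<integral>\<^sup>+z\<in>B x r. ennreal (kd z) \<partial>M)" by (rule invariant_volume[OF t x, symmetric])
    also have "\<dots> \<le> (\<integral>\<^sup>+z. ennreal (exp (g * r) * kd x) * indicator (B x r) z \<partial>M)"
      using kd_compare(1)[OF x] by (intro nn_integral_mono) (auto simp: indicator_def mem_B intro!: ennreal_leI)
    also have "\<dots> = ennreal (exp (g * r) * kd x) * emeasure M (B x r)"
      by (rule nn_integral_cmult_indicator[OF B_sets[OF x]])
    finally have "ennreal (?E / kd x) * ennreal (?E * kd t * ball_vol d) \<le> ennreal (?E / kd x) * (ennreal (exp (g * r) * kd x) * emeasure M (B x r))"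
      by (rule mult_left_mono) simp
    moreover have "ennreal (?E / kd x) * ennreal (?E * kd t * ball_vol d) = ennreal (c / kd x)"
      using kx kt ball_vol_pos[OF d(1)] by (subst ennreal_mult[symmetric]) (auto simp: c_def mult_ac)
    moreover have "ennreal (?E / kd x) * (ennreal (exp (g * r) * kd x) * emeasure M (B x r)) = emeasure M (B x r)"
      using kx by (simp add: mult.assoc[symmetric] ennreal_mult[symmetric] exp_minus)
    ultimately show ?thesis by simp
  qed
  then show ?thesis using c by blast
qed

text \<open>The Euclidean sub-mean value inequality for the composition of f with \<psi> on a ball
  about t, moved to x by a change of variables; |J|^2 is a quotient of kernel values and is absorbed
  into K(x,x).\<close>

lemma submean_B:
  assumes r: "0 < r" and s: "1 \<le> s"
  shows "\<exists>C>0. \<forall>f x. hol_fun f U \<longrightarrow> x \<in> U \<longrightarrow>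
    ennreal (cmod (f x) powr s) \<le> ennreal (C * kd x) * (\<integral>\<^sup>+z\<in>B x r. ennreal (cmod (f z) powr s) \<partial>M)"
proof -
  obtain t where t: "t \<in> U" using U_nonempty by blast
  obtain d where d: "0 < d" "ball t d \<subseteq> B t r" using euclidean_ball[OF t r] by blast
  have dU: "ball t d \<subseteq> U" using d(2) B_sub by blast
  have kt: "0 < kd t" by (rule kd_pos[OF t])
  have V: "0 < ball_vol d" by (rule ball_vol_pos[OF d(1)])
  let ?E = "exp (g * r)"
  define C where "C = ?E * ?E / kd t / ball_vol d"
  have C: "0 < C" using kt V by (simp add: C_def)
  have "ennreal (cmod (f x) powr s) \<le> ennreal (C * kd x) * (\<integral>\<^sup>+z\<in>B x r. ennreal (cmod (f z) powr s) \<partial>M)"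
    if f: "hol_fun f U" and x: "x \<in> U" for f x
  proof -
    obtain \<psi> where p: "automorphism U \<psi>" "\<psi> t = x" "\<And>z. z \<in> U \<Longrightarrow> \<psi> z \<in> B x r \<longleftrightarrow> z \<in> B t r"
      using automorphism_to[OF t x] by metis
    interpret A: automorphism U \<psi> by fact
    have kx: "0 < kd x" by (rule kd_pos[OF x])
    note [measurable] = B_indicator[OF x] hol_measurable[OF f]
    have h: "hol_fun (\<lambda>z. f (\<psi> z)) U" by (rule hol_fun_comp[OF f A.hol]) (simp add: A.image_U)
    let ?c = "?E * ?E * kd x / kd t"
    have c: "0 < ?c" using kx kt by simp
    have "ennreal (cmod (f x) powr s) * ennreal (ball_vol d) \<le> (\<integral>\<^sup>+z\<in>ball t d. ennreal (cmod (f (\<psi> z)) powr s) \<partial>M)"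
      using submean_M[OF h d(1) dU s] p(2) by simp
    also have "\<dots> \<le> (\<integral>\<^sup>+z. ennreal ?c * (ennreal (cmod (f (\<psi> z)) powr s) * indicator (B x r) (\<psi> z) * ennreal ((cmod (jac \<psi> z))\<^sup>2)) \<partial>M)"
    proof (rule nn_integral_mono)
      fix z assume "z \<in> space M"
      then have z: "z \<in> U" by simp
      show "ennreal (cmod (f (\<psi> z)) powr s) * indicator (ball t d) z
        \<le> ennreal ?c * (ennreal (cmod (f (\<psi> z)) powr s) * indicator (B x r) (\<psi> z) * ennreal ((cmod (jac \<psi> z))\<^sup>2))"
      proof (cases "z \<in> ball t d")
        case True
        then have zB: "z \<in> B t r" "\<psi> z \<in> B x r" using d(2) p(3)[OF z] by auto
        then have bdz: "bd t z \<le> r" "bd x (\<psi> z) \<le> r" by (auto simp: mem_B)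
        have kp: "0 < kd (\<psi> z)" by (rule kd_pos[OF A.maps_to[OF z]])
        have j: "(cmod (jac \<psi> z))\<^sup>2 = kd z / kd (\<psi> z)" using kd_transform[OF p(1) z] kp by simp
        \<comment> \<open>Since |J(z)|^2 = K(z,z) / K(\<psi>(z),\<psi>(z)), comparing numerator and
          denominator with K(t,t) and K(x,x) shows that the Jacobian, times the constant
          \<open>?c\<close>, is at least 1 and may be inserted.\<close>
        have "kd t * kd (\<psi> z) \<le> (?E * kd z) * (?E * kd x)"
          using kd_compare(2)[OF t z bdz(1)] kd_compare(1)[OF x A.maps_to[OF z] bdz(2)] kp kt kd_pos[OF z]
          by (intro mult_mono) auto
        then have "1 \<le> ?c * (cmod (jac \<psi> z))\<^sup>2"
          unfolding j using kp kt by (simp add: field_simps)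
        then have "cmod (f (\<psi> z)) powr s \<le> ?c * (cmod (f (\<psi> z)) powr s * (cmod (jac \<psi> z))\<^sup>2)"
          using mult_left_mono[of 1 "?c * (cmod (jac \<psi> z))\<^sup>2" "cmod (f (\<psi> z)) powr s"] by (simp add: mult_ac)
        then show ?thesis using True zB(2) c by (simp add: ennreal_mult[symmetric] ennreal_leI)
      qed simp
    qed
    also have "\<dots> = ennreal ?c * (\<integral>\<^sup>+z. ennreal (cmod (f (\<psi> z)) powr s) * indicator (B x r) (\<psi> z) * ennreal ((cmod (jac \<psi> z))\<^sup>2) \<partial>M)"
      by (rule nn_integral_cmult) measurable
    also have "(\<integral>\<^sup>+z. ennreal (cmod (f (\<psi> z)) powr s) * indicator (B x r) (\<psi> z) * ennreal ((cmod (jac \<psi> z))\<^sup>2) \<partial>M)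
        = (\<integral>\<^sup>+z\<in>B x r. ennreal (cmod (f z) powr s) \<partial>M)"
      by (rule A.nn_integral_change) measurable
    finally have "ennreal (1 / ball_vol d) * (ennreal (cmod (f x) powr s) * ennreal (ball_vol d))
       \<le> ennreal (1 / ball_vol d) * (ennreal ?c * (\<integral>\<^sup>+z\<in>B x r. ennreal (cmod (f z) powr s) \<partial>M))"
      by (rule mult_left_mono) simp
    moreover have "ennreal (1 / ball_vol d) * (ennreal (cmod (f x) powr s) * ennreal (ball_vol d)) = ennreal (cmod (f x) powr s)"
      using V by (simp add: ennreal_mult[symmetric])
    moreover have "ennreal (1 / ball_vol d) * (ennreal ?c * (\<integral>\<^sup>+z\<in>B x r. ennreal (cmod (f z) powr s) \<partial>M))
       = ennreal (C * kd x) * (\<integral>\<^sup>+z\<in>B x r. ennreal (cmod (f z) powr s) \<partial>M)"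
      unfolding mult.assoc[symmetric] using V c by (subst ennreal_mult[symmetric]) (auto simp: C_def mult_ac)
    ultimately show ?thesis by simp
  qed
  then show ?thesis using C by blast
qed

text \<open>On B(x,r) the density K^(-\<alpha>) is comparable to its value at x, so passing to the
  weighted measure costs the factor K(x,x)^\<alpha>.\<close>

lemma submean_weighted:
  assumes r: "0 < r" and s: "1 \<le> s"
  shows "\<exists>C>0. \<forall>f x. hol_fun f U \<longrightarrow> x \<in> U \<longrightarrow>
    ennreal (cmod (f x) powr s) \<le> ennreal (C * kd x powr (1 + \<alpha>)) * (\<integral>\<^sup>+z\<in>B x r. ennreal (cmod (f z) powr s) \<partial>weighted_volume U \<alpha>)"
proof -
  obtain C where C: "0 < C" "\<And>f x. hol_fun f U \<Longrightarrow> x \<in> U \<Longrightarrow>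
    ennreal (cmod (f x) powr s) \<le> ennreal (C * kd x) * (\<integral>\<^sup>+z\<in>B x r. ennreal (cmod (f z) powr s) \<partial>M)"
    using submean_B[OF r s] by blast
  let ?E = "exp (g * r * \<bar>\<alpha>\<bar>)"
  have "ennreal (cmod (f x) powr s) \<le> ennreal ((C * ?E) * kd x powr (1 + \<alpha>)) * (\<integral>\<^sup>+z\<in>B x r. ennreal (cmod (f z) powr s) \<partial>weighted_volume U \<alpha>)"
    if f: "hol_fun f U" and x: "x \<in> U" for f x
  proof -
    have kx: "0 < kd x" by (rule kd_pos[OF x])
    note [measurable] = B_indicator[OF x] hol_measurable[OF f]
    have w: "(\<integral>\<^sup>+z\<in>B x r. ennreal (cmod (f z) powr s) \<partial>weighted_volume U \<alpha>)
      = (\<integral>\<^sup>+z. ennreal (kd z powr (- \<alpha>)) * (ennreal (cmod (f z) powr s) * indicator (B x r) z) \<partial>M)"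
      by (rule weighted_integral) measurable
    have "(\<integral>\<^sup>+z\<in>B x r. ennreal (cmod (f z) powr s) \<partial>M)
       \<le> (\<integral>\<^sup>+z. ennreal (?E * kd x powr \<alpha>) * (ennreal (kd z powr (- \<alpha>)) * (ennreal (cmod (f z) powr s) * indicator (B x r) z)) \<partial>M)"
    proof (rule nn_integral_mono)
      fix z assume "z \<in> space M"
      then have z: "z \<in> U" by simp
      show "ennreal (cmod (f z) powr s) * indicator (B x r) z
        \<le> ennreal (?E * kd x powr \<alpha>) * (ennreal (kd z powr (- \<alpha>)) * (ennreal (cmod (f z) powr s) * indicator (B x r) z))"
      proof (cases "z \<in> B x r")
        case True
        then have "kd z powr \<alpha> \<le> ?E * kd x powr \<alpha>" using kd_powr_compare[OF x z] by (simp add: mem_B)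
        then have "1 \<le> (?E * kd x powr \<alpha>) * kd z powr (- \<alpha>)"
          using kd_pos[OF z] by (simp add: powr_minus field_simps)
        then have "cmod (f z) powr s \<le> (?E * kd x powr \<alpha>) * (kd z powr (- \<alpha>) * cmod (f z) powr s)"
          using mult_left_mono[of 1 "(?E * kd x powr \<alpha>) * kd z powr (- \<alpha>)" "cmod (f z) powr s"] by (simp add: mult_ac)
        then show ?thesis using True by (simp add: ennreal_mult[symmetric] ennreal_leI)
      qed simp
    qed
    also have "\<dots> = ennreal (?E * kd x powr \<alpha>) * (\<integral>\<^sup>+z\<in>B x r. ennreal (cmod (f z) powr s) \<partial>weighted_volume U \<alpha>)"
      unfolding w by (rule nn_integral_cmult) measurable
    finally have "ennreal (C * kd x) * (\<integral>\<^sup>+z\<in>B x r. ennreal (cmod (f z) powr s) \<partial>M)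
      \<le> ennreal (C * kd x) * (ennreal (?E * kd x powr \<alpha>) * (\<integral>\<^sup>+z\<in>B x r. ennreal (cmod (f z) powr s) \<partial>weighted_volume U \<alpha>))"
      by (rule mult_left_mono) simp
    also have "\<dots> = ennreal ((C * ?E) * kd x powr (1 + \<alpha>)) * (\<integral>\<^sup>+z\<in>B x r. ennreal (cmod (f z) powr s) \<partial>weighted_volume U \<alpha>)"
      unfolding mult.assoc[symmetric] using C(1) kx by (subst ennreal_mult[symmetric]) (auto simp: powr_add mult_ac)
    finally show ?thesis using C(2)[OF f x] order_trans by blast
  qed
  then show ?thesis using C(1) by (intro exI[of _ "C * ?E"]) auto
qed

text \<open>Continuity is available on U x U only, so the function is cut off there; the cut-off
  does not change it on the space of the product measure.\<close>

lemma bd_measurable: "(\<lambda>p. bd (fst p) (snd p)) \<in> borel_measurable (M \<Otimes>\<^sub>M M)"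
proof -
  have "(\<lambda>p. indicator (U \<times> U) p *\<^sub>R bd (fst p) (snd p)) \<in> borel_measurable borel"
    by (intro borel_measurable_continuous_on_indicator bd_continuous) (auto intro: borel_open open_Times open_U)
  moreover have "(\<lambda>p. (fst p, snd p)) \<in> (M \<Otimes>\<^sub>M M) \<rightarrow>\<^sub>M (borel :: ((complex ^ 'n) \<times> (complex ^ 'n)) measure)"
  proof -
    have "(\<lambda>x. x) \<in> borel_measurable M" by (rule continuous_measurable) (rule continuous_on_id)
    then have "fst \<in> borel_measurable (M \<Otimes>\<^sub>M M)" "snd \<in> borel_measurable (M \<Otimes>\<^sub>M M)"
      using measurable_compose[OF measurable_fst] measurable_compose[OF measurable_snd] by blast+
    then show ?thesis by (rule borel_measurable_Pair)
  qed
  ultimately have "(\<lambda>p. indicator (U \<times> U) (fst p, snd p) *\<^sub>R bd (fst (fst p, snd p)) (snd (fst p, snd p))) \<in> borel_measurable (M \<Otimes>\<^sub>M M)"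
    by (rule measurable_compose[rotated])
  then show ?thesis
    by (rule measurable_cong[THEN iffD1, rotated]) (auto simp: space_pair_measure)
qed

lemma mean_measurable:
  assumes f: "hol_fun f U"
  shows "(\<lambda>w. ennreal_powr (\<integral>\<^sup>+z\<in>B w r. ennreal (cmod (f z) powr s) \<partial>weighted_volume U \<alpha>) a) \<in> borel_measurable M"
proof -
  note [measurable] = bd_measurable hol_measurable[OF f]
  interpret finite_measure M by (rule finite_M)
  \<comment> \<open>The indicator of B(w,r) is written as a condition on the distance, which
    exhibits joint measurability in w and z.\<close>
  let ?h = "\<lambda>w z. ennreal (kd z powr (- \<alpha>)) * (ennreal (cmod (f z) powr s) * (if bd w z \<le> r then 1 else 0))"
  have "(\<lambda>w. \<integral>\<^sup>+z. ?h w z \<partial>M) \<in> borel_measurable M"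
  proof (rule borel_measurable_nn_integral)
    show "(\<lambda>(w, z). ?h w z) \<in> borel_measurable (M \<Otimes>\<^sub>M M)"
      unfolding split_beta' by measurable
  qed
  also have "?this \<longleftrightarrow> (\<lambda>w. \<integral>\<^sup>+z\<in>B w r. ennreal (cmod (f z) powr s) \<partial>weighted_volume U \<alpha>) \<in> borel_measurable M"
  proof (rule measurable_cong)
    fix w assume "w \<in> space M"
    then have w: "w \<in> U" by simp
    note [measurable] = B_indicator[OF w]
    have "(\<integral>\<^sup>+z\<in>B w r. ennreal (cmod (f z) powr s) \<partial>weighted_volume U \<alpha>)
      = (\<integral>\<^sup>+z. ennreal (kd z powr (- \<alpha>)) * (ennreal (cmod (f z) powr s) * indicator (B w r) z) \<partial>M)"
      by (rule weighted_integral) measurable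
    also have "\<dots> = (\<integral>\<^sup>+z. ?h w z \<partial>M)"
      by (intro nn_integral_cong) (simp add: indicator_def mem_B)
    finally show "(\<integral>\<^sup>+z. ?h w z \<partial>M) = (\<integral>\<^sup>+z\<in>B w r. ennreal (cmod (f z) powr s) \<partial>weighted_volume U \<alpha>)" by simp
  qed
  finally have [measurable]: "(\<lambda>w. \<integral>\<^sup>+z\<in>B w r. ennreal (cmod (f z) powr s) \<partial>weighted_volume U \<alpha>) \<in> borel_measurable M" .
  have [measurable]: "enn2real \<in> borel_measurable borel" by simp
  show ?thesis unfolding ennreal_powr_def by measurable
qed

section \<open>The embedding over a sampling sequence\<close>

lemma carleson_embedding:
  fixes z :: "nat \<Rightarrow> complex ^ 'n" and \<mu> :: "(complex ^ 'n) measure"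
  assumes q: "1 \<le> q" and s: "1 \<le> s" and r: "1 \<le> r"
    and \<tau>: "\<tau> = (1 + \<alpha>) * (q / s) + 1" "0 < \<tau>"
    and z: "sampling_sequence U r z" and sets_\<mu>: "sets \<mu> = sets (restrict_space borel U)"
    and C: "0 < C" "\<And>k. emeasure \<mu> (B (z k) r) \<le> ennreal (C * measure lborel (B (z k) r) powr \<tau>)"
  shows "\<exists>C'>0. \<forall>f. hol_fun f U \<longrightarrow>
       (\<integral>\<^sup>+x. ennreal (cmod (f x) powr q) \<partial>\<mu>)
         \<le> ennreal C' * (\<integral>\<^sup>+w. ennreal_powr (\<integral>\<^sup>+x\<in>B w r. ennreal (cmod (f x) powr s) \<partial>weighted_volume U \<alpha>) (q / s) \<partial>M)"
proof -
  have zU: "z k \<in> U" for k using z by (simp add: sampling_sequence_def)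
  have cover: "U = (\<Union>k. B (z k) r)" using z unfolding sampling_sequence_def by blast
  obtain N where N: "\<And>w. w \<in> U \<Longrightarrow> finite {k. w \<in> B (z k) (2 * r)} \<and> card {k. w \<in> B (z k) (2 * r)} \<le> N"
    using z unfolding sampling_sequence_def by blast
  have sets_M\<mu>: "sets \<mu> = sets M"
    unfolding sets_\<mu> by (rule sets_restrict_space_cong) simp
  have space_\<mu>: "space \<mu> = U" using sets_eq_imp_space_eq[OF sets_M\<mu>] by simp
  obtain C1 where C1: "0 < C1" "\<And>f x. hol_fun f U \<Longrightarrow> x \<in> U \<Longrightarrow>
    ennreal (cmod (f x) powr s) \<le> ennreal (C1 * kd x powr (1 + \<alpha>)) * (\<integral>\<^sup>+y\<in>B x (r/2). ennreal (cmod (f y) powr s) \<partial>weighted_volume U \<alpha>)"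
    using submean_weighted[of "r/2" s \<alpha>] r s by auto
  obtain c where c: "0 < c" "\<And>x. x \<in> U \<Longrightarrow> ennreal (c / kd x) \<le> emeasure M (B x (r/2))"
    using volume_lower[of "r/2"] r by auto
  obtain CV where CV: "0 < CV" "\<And>x. x \<in> U \<Longrightarrow> measure lborel (B x r) \<le> CV / kd x"
    using volume_upper[of r] by blast
  define E where "E = exp (g * r * \<bar>\<tau>\<bar>)"
  \<comment> \<open>\<open>C1 powr (q / s)\<close> from the sub-mean value inequality, 1/c from
    averaging over B(x,r/2), and E from replacing the kernel at x by the kernel at the centre
    z_k.\<close>
  define D where "D = C1 powr (q / s) / c * E"
  have D: "0 < D" using C1(1) c(1) by (simp add: D_def E_def)
  define D' where "D' = D * C * CV powr \<tau>"
  have D': "0 < D'" using D C CV by (simp add: D'_def)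
  have "(\<integral>\<^sup>+x. ennreal (cmod (f x) powr q) \<partial>\<mu>)
      \<le> ennreal (D' * real (N + 1)) * (\<integral>\<^sup>+w. ennreal_powr (\<integral>\<^sup>+x\<in>B w r. ennreal (cmod (f x) powr s) \<partial>weighted_volume U \<alpha>) (q / s) \<partial>M)"
    if f: "hol_fun f U" for f
  proof -
    define F where "F w = ennreal_powr (\<integral>\<^sup>+x\<in>B w r. ennreal (cmod (f x) powr s) \<partial>weighted_volume U \<alpha>) (q / s)" for w
    have F_meas [measurable]: "F \<in> borel_measurable M" unfolding F_def by (rule mean_measurable[OF f])
    define I where "I k = (\<integral>\<^sup>+w\<in>B (z k) (2 * r). F w \<partial>M)" for k
    have tri: "bd a w \<le> ra + rb" if "a \<in> U" "b \<in> U" "w \<in> U" "bd a b \<le> ra" "bd b w \<le> rb" for a b w ra rb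
      using bd_triangle[OF that(1,2,3)] that by linarith
    have pt: "ennreal (cmod (f x) powr q) \<le> ennreal (D * kd (z k) powr \<tau>) * I k" if x: "x \<in> B (z k) r" for x k
    proof -
      have xU: "x \<in> U" using x B_sub by blast
      have kx: "0 < kd x" by (rule kd_pos[OF xU])
      let ?c = "C1 * kd x powr (1 + \<alpha>)"
      have c0: "0 < ?c" using C1 kx by simp
      \<comment> \<open>The constant lower bound for F on B(x,r/2): for w there, B(w,r) contains
        B(x,r/2), so the inner integral at w dominates the one at x.\<close>
      let ?y = "cmod (f x) powr q / ?c powr (q / s)"
      have y0: "0 \<le> ?y" by simp
      have F_ge: "ennreal ?y \<le> F w" if w: "w \<in> B x (r/2)" for w
      proof -
        have wU: "w \<in> U" and wx: "bd w x \<le> r / 2" using w bd_commute[of x w] by (auto simp: mem_B)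
        have "B x (r/2) \<subseteq> B w r" using tri[OF wU xU _ wx, of _ "r/2"] by (auto simp: mem_B)
        then have "(\<integral>\<^sup>+y\<in>B x (r/2). ennreal (cmod (f y) powr s) \<partial>weighted_volume U \<alpha>)
           \<le> (\<integral>\<^sup>+y\<in>B w r. ennreal (cmod (f y) powr s) \<partial>weighted_volume U \<alpha>)"
          by (intro nn_integral_mono mult_left_mono) (auto simp: indicator_def)
        then have "ennreal (cmod (f x) powr s) \<le> ennreal ?c * (\<integral>\<^sup>+y\<in>B w r. ennreal (cmod (f y) powr s) \<partial>weighted_volume U \<alpha>)"
          using C1(2)[OF f xU] by (meson mult_left_mono order_trans zero_le)
        then have "ennreal (cmod (f x) powr q) \<le> ennreal (?c powr (q / s)) * F w"
          unfolding F_def by (rule ennreal_powr_le) (use c0 s q in auto)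
        then have "ennreal (1 / ?c powr (q / s)) * ennreal (cmod (f x) powr q) \<le> ennreal (1 / ?c powr (q / s)) * (ennreal (?c powr (q / s)) * F w)"
          by (rule mult_left_mono) simp
        moreover have "ennreal (1 / ?c powr (q / s)) * ennreal (cmod (f x) powr q) = ennreal ?y"
          by (subst ennreal_mult[symmetric]) auto
        moreover have "ennreal (1 / ?c powr (q / s)) * (ennreal (?c powr (q / s)) * F w) = F w"
          unfolding mult.assoc[symmetric] using c0 by (subst ennreal_mult[symmetric]) auto
        ultimately show ?thesis by simp
      qed
      \<comment> \<open>From z_k to x at most r and on to w at most r/2, in total below 2r; this
        explains why bounded overlap is demanded at radius 2r.\<close>
      have sub: "B x (r/2) \<subseteq> B (z k) (2 * r)"
      proof
        fix w assume w: "w \<in> B x (r/2)"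
        then have "bd (z k) w \<le> r + r / 2" using tri[OF zU xU, of w _ r "r/2"] x by (auto simp: mem_B)
        then show "w \<in> B (z k) (2 * r)" using w r by (auto simp: mem_B)
      qed
      have "ennreal ?y * ennreal (c / kd x) \<le> ennreal ?y * emeasure M (B x (r/2))"
        by (rule mult_left_mono[OF c(2)[OF xU]]) simp
      also have "\<dots> = (\<integral>\<^sup>+w. ennreal ?y * indicator (B x (r/2)) w \<partial>M)"
        by (rule nn_integral_cmult_indicator[symmetric, OF B_sets[OF xU]])
      also have "\<dots> \<le> I k"
        unfolding I_def using F_ge sub by (intro nn_integral_mono) (auto simp: indicator_def)
      finally have h1: "ennreal (?c powr (q / s) * (kd x / c)) * (ennreal ?y * ennreal (c / kd x)) \<le> ennreal (?c powr (q / s) * (kd x / c)) * I k"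
        by (rule mult_left_mono) simp
      have h2: "ennreal (?c powr (q / s) * (kd x / c)) * (ennreal ?y * ennreal (c / kd x)) = ennreal (cmod (f x) powr q)"
      proof -
        have "ennreal ?y * ennreal (c / kd x) = ennreal (?y * (c / kd x))"
          using y0 c(1) kx by (intro ennreal_mult[symmetric]) auto
        moreover have "ennreal (?c powr (q / s) * (kd x / c)) * ennreal (?y * (c / kd x)) = ennreal (?c powr (q / s) * (kd x / c) * (?y * (c / kd x)))"
          using y0 c(1) kx by (intro ennreal_mult[symmetric]) auto
        moreover have "?c powr (q / s) * (kd x / c) * (?y * (c / kd x)) = cmod (f x) powr q"
          using c(1) kx c0 C1(1) by simp
        ultimately show ?thesis by simp
      qed
      \<comment> \<open>The exponent of K(x,x) is (1 + \<alpha>) q/s from the pointwise estimate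
        plus 1 from the volume of B(x,r/2), which is exactly \<tau>.\<close>
      have h3: "?c powr (q / s) * (kd x / c) \<le> D * kd (z k) powr \<tau>"
      proof -
        have "?c powr (q / s) = C1 powr (q / s) * kd x powr ((1 + \<alpha>) * (q / s))"
          using C1(1) kx by (simp add: powr_mult powr_powr)
        then have "?c powr (q / s) * (kd x / c) = C1 powr (q / s) / c * kd x powr \<tau>"
          using kx by (simp add: \<tau>(1) powr_add)
        also have "\<dots> \<le> C1 powr (q / s) / c * (E * kd (z k) powr \<tau>)"
          unfolding E_def using kd_powr_compare[OF zU xU] x c(1)
          by (intro mult_left_mono) (auto simp: mem_B)
        finally show ?thesis by (simp add: D_def)
      qed
      have "ennreal (?c powr (q / s) * (kd x / c)) * I k \<le> ennreal (D * kd (z k) powr \<tau>) * I k"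
        by (intro mult_right_mono ennreal_leI h3) simp
      then show ?thesis using h1 unfolding h2 by (rule order_trans[rotated])
    qed
    have piece: "(\<integral>\<^sup>+x\<in>B (z k) r. ennreal (cmod (f x) powr q) \<partial>\<mu>) \<le> ennreal D' * I k" for k
    proof -
      have kz: "0 < kd (z k)" by (rule kd_pos[OF zU])
      have "(\<integral>\<^sup>+x\<in>B (z k) r. ennreal (cmod (f x) powr q) \<partial>\<mu>)
         \<le> (\<integral>\<^sup>+x. (ennreal (D * kd (z k) powr \<tau>) * I k) * indicator (B (z k) r) x \<partial>\<mu>)"
        using pt by (intro nn_integral_mono) (auto simp: indicator_def)
      also have "\<dots> = (ennreal (D * kd (z k) powr \<tau>) * I k) * emeasure \<mu> (B (z k) r)"
        by (rule nn_integral_cmult_indicator) (simp add: sets_M\<mu> B_sets[OF zU])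
      also have "\<dots> \<le> (ennreal (D * kd (z k) powr \<tau>) * I k) * ennreal (C * (CV / kd (z k)) powr \<tau>)"
      proof (rule mult_left_mono)
        have "measure lborel (B (z k) r) powr \<tau> \<le> (CV / kd (z k)) powr \<tau>"
          using CV(2)[OF zU] \<tau>(2) by (intro powr_mono2) auto
        then have "C * measure lborel (B (z k) r) powr \<tau> \<le> C * (CV / kd (z k)) powr \<tau>"
          using C(1) by (intro mult_left_mono) auto
        then show "emeasure \<mu> (B (z k) r) \<le> ennreal (C * (CV / kd (z k)) powr \<tau>)"
          using C(2)[of k] ennreal_leI order_trans by blast
      qed simp
      also have "\<dots> = (ennreal (D * kd (z k) powr \<tau>) * ennreal (C * (CV / kd (z k)) powr \<tau>)) * I k"
        by (simp only: mult_ac)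
      \<comment> \<open>The power \<tau> of K at z_k meets the power -\<tau> coming from the volume
        bound, so the constant is the same for all k.\<close>
      also have "ennreal (D * kd (z k) powr \<tau>) * ennreal (C * (CV / kd (z k)) powr \<tau>) = ennreal D'"
      proof -
        have "(D * kd (z k) powr \<tau>) * (C * (CV / kd (z k)) powr \<tau>) = D'"
          using kz CV(1) by (simp add: D'_def powr_divide)
        then show ?thesis using D C(1) by (simp add: ennreal_mult[symmetric])
      qed
      finally show ?thesis .
    qed
    have fm: "f \<in> borel_measurable \<mu>"
      using hol_measurable[OF f] by (simp cong: measurable_cong_sets add: sets_M\<mu>)
    note [measurable] = fm
    have [measurable]: "(\<lambda>x. indicator (B (z k) r) x :: ennreal) \<in> borel_measurable \<mu>" for k
      using B_sets[OF zU] sets_M\<mu> by (intro borel_measurable_indicator) simp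
    have "(\<integral>\<^sup>+x. ennreal (cmod (f x) powr q) \<partial>\<mu>) \<le> (\<integral>\<^sup>+x. (\<Sum>k. ennreal (cmod (f x) powr q) * indicator (B (z k) r) x) \<partial>\<mu>)"
    proof (rule nn_integral_mono)
      fix x assume "x \<in> space \<mu>"
      then obtain k where k: "x \<in> B (z k) r" using cover space_\<mu> by blast
      have "ennreal (cmod (f x) powr q) = ennreal (cmod (f x) powr q) * indicator (B (z k) r) x" using k by simp
      also have "\<dots> = (\<Sum>i\<in>{k}. ennreal (cmod (f x) powr q) * indicator (B (z i) r) x)"
        by (simp only: sum.insert sum.empty finite.emptyI empty_iff not_False_eq_True add_0_right)
      also have "\<dots> \<le> (\<Sum>i. ennreal (cmod (f x) powr q) * indicator (B (z i) r) x)"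
        by (rule sum_le_suminf) auto
      finally show "ennreal (cmod (f x) powr q) \<le> (\<Sum>i. ennreal (cmod (f x) powr q) * indicator (B (z i) r) x)" .
    qed
    also have "\<dots> = (\<Sum>k. \<integral>\<^sup>+x\<in>B (z k) r. ennreal (cmod (f x) powr q) \<partial>\<mu>)"
      by (rule nn_integral_suminf) measurable
    also have "\<dots> \<le> (\<Sum>k. ennreal D' * I k)" by (intro suminf_le piece) auto
    also have "\<dots> = ennreal D' * (\<Sum>k. I k)" by simp
    also have "(\<Sum>k. I k) = (\<integral>\<^sup>+w. (\<Sum>k. F w * indicator (B (z k) (2 * r)) w) \<partial>M)"
      unfolding I_def
    proof (rule nn_integral_suminf[symmetric])
      fix k
      note [measurable] = B_indicator[OF zU, of k "2 * r"]
      show "(\<lambda>w. F w * indicator (B (z k) (2 * r)) w) \<in> borel_measurable M" by measurable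
    qed
    also have "\<dots> \<le> (\<integral>\<^sup>+w. ennreal (real (N + 1)) * F w \<partial>M)"
    proof (rule nn_integral_mono)
      fix w assume "w \<in> space M"
      then have w: "w \<in> U" by simp
      \<comment> \<open>At each w at most N summands are nonzero, so the sum over k costs a factor
        depending only on the overlap number.\<close>
      let ?A = "{k. w \<in> B (z k) (2 * r)}"
      have "(\<Sum>k. F w * indicator (B (z k) (2 * r)) w) = (\<Sum>k\<in>?A. F w * indicator (B (z k) (2 * r)) w)"
        by (rule suminf_finite) (use N[OF w] in auto)
      also have "\<dots> = (\<Sum>k\<in>?A. F w)" by (intro sum.cong) auto
      also have "\<dots> = of_nat (card ?A) * F w" by simp
      \<comment> \<open>\<open>N + 1\<close> makes the resulting constant positive for every natural
        number N.\<close>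
      also have "\<dots> \<le> of_nat (N + 1) * F w"
        using N[OF w] by (intro mult_right_mono of_nat_mono) auto
      also have "\<dots> = ennreal (real (N + 1)) * F w" by (simp add: ennreal_of_nat_eq_real_of_nat)
      finally show "(\<Sum>k. F w * indicator (B (z k) (2 * r)) w) \<le> ennreal (real (N + 1)) * F w" .
    qed
    also have "\<dots> = ennreal (real (N + 1)) * (\<integral>\<^sup>+w. F w \<partial>M)" by (rule nn_integral_cmult) measurable
    finally have "(\<integral>\<^sup>+x. ennreal (cmod (f x) powr q) \<partial>\<mu>) \<le> ennreal D' * (ennreal (real (N + 1)) * (\<integral>\<^sup>+w. F w \<partial>M))"
      by (simp add: mult_left_mono)
    also have "\<dots> = ennreal (D' * real (N + 1)) * (\<integral>\<^sup>+w. F w \<partial>M)"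
      using D' by (simp only: mult.assoc[symmetric] ennreal_mult[of D' "real (N + 1)"] less_imp_le of_nat_0_le_iff)
    finally show ?thesis unfolding F_def .
  qed
  then show ?thesis using D' by (intro exI[of _ "D' * real (N + 1)"]) auto
qed

end

theorem theorem1:
  fixes U :: "(complex ^ 'n) set" and q s \<alpha> :: real
  assumes "minimal_bounded_homogeneous_domain U"
    and "forelli_rudin U"
    and "1 \<le> q" and "1 \<le> s" and "s \<le> q" and "-1 < \<alpha>"
  shows "\<exists>\<tau>>0. \<forall>r\<ge>1. \<forall>(z :: nat \<Rightarrow> complex ^ 'n) (\<mu> :: (complex ^ 'n) measure).
    sampling_sequence U r z \<longrightarrow>
    sets \<mu> = sets (restrict_space borel U) \<longrightarrow>
    (\<exists>C>0. \<forall>k. emeasure \<mu> (bergman_ball U (z k) r)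
        \<le> ennreal (C * measure lborel (bergman_ball U (z k) r) powr \<tau>)) \<longrightarrow>
    (\<exists>C'>0. \<forall>f. hol_fun f U \<longrightarrow>
       (\<integral>\<^sup>+x. ennreal (cmod (f x) powr q) \<partial>\<mu>)
         \<le> ennreal C' *
           (\<integral>\<^sup>+w. ennreal_powr
              (\<integral>\<^sup>+x\<in>bergman_ball U w r. ennreal (cmod (f x) powr s) \<partial>weighted_volume U \<alpha>)
              (q / s)
            \<partial>restrict_space lborel U))"
proof -
  have U: "domain U" "bounded U" "homogeneous U"
    using assms(1) by (auto simp: minimal_bounded_homogeneous_domain_def)
  interpret bounded_domain U by standard (use U in auto)
  obtain m where m: "0 < m" "\<And>z v. z \<in> U \<Longrightarrow> \<bar>2 * Re (K1 z v) / kd z\<bar> \<le> m * bergman_norm U z v"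
    using gradient_bound[OF assms(2) U(3)] by blast
  interpret homogeneous_fr_domain U m by standard (use U m in auto)
  \<comment> \<open>Fixed before r, the sequence and the measure, as the order of quantifiers
    requires; \<alpha> > -1 makes the first summand positive.\<close>
  define \<tau> where "\<tau> = (1 + \<alpha>) * (q / s) + 1"
  have \<tau>: "0 < \<tau>" using assms by (auto simp: \<tau>_def intro!: add_nonneg_pos)
  show ?thesis
  proof (rule exI[of _ \<tau>], intro conjI allI impI)
    fix r :: real and z :: "nat \<Rightarrow> complex ^ 'n" and \<mu> :: "(complex ^ 'n) measure"
    assume r: "1 \<le> r" and z: "sampling_sequence U r z" and \<mu>: "sets \<mu> = sets (restrict_space borel U)"
      and "\<exists>C>0. \<forall>k. emeasure \<mu> (bergman_ball U (z k) r)
        \<le> ennreal (C * measure lborel (bergman_ball U (z k) r) powr \<tau>)"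
    then obtain C where C: "0 < C"
      "\<And>k. emeasure \<mu> (bergman_ball U (z k) r) \<le> ennreal (C * measure lborel (bergman_ball U (z k) r) powr \<tau>)"
      by blast
    show "\<exists>C'>0. \<forall>f. hol_fun f U \<longrightarrow>
       (\<integral>\<^sup>+x. ennreal (cmod (f x) powr q) \<partial>\<mu>)
         \<le> ennreal C' *
           (\<integral>\<^sup>+w. ennreal_powr
              (\<integral>\<^sup>+x\<in>bergman_ball U w r. ennreal (cmod (f x) powr s) \<partial>weighted_volume U \<alpha>)
              (q / s)
            \<partial>restrict_space lborel U)"
      by (rule carleson_embedding[OF assms(3,4) r \<tau>_def \<tau> z \<mu> C])
  qed (rule \<tau>)
qed

end
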